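(* The system $\mathsf{RCA}_0^{\omega}+\mathsf{QF\text{-}AC}^{0,1}$ proves the implication $\mathsf{Baire}'\rightarrow\mathsf{NIN}$. Here $\mathsf{Baire}'$ is the statement: "Let $(f_n)_{n\in\mathbb N}$ be a sequence of Baire class $1$ functions on $[0,1]$ such that $\lim_{n\to\infty}f_n=f$ (pointwise) for some $f:[0,1]\to\mathbb R$. Then there is a double sequence $(g_{m,n})_{m,n\in\mathbb N}$ of continuous functions on $[0,1]$ such that $\lim_{m\to\infty}g_{m,n}=f_n$ (pointwise) for each $n\in\mathbb N$ (and $\lim_{n\to\infty}\lim_{m\to\infty}g_{m,n}=f$)"; and $\mathsf{NIN}$ is the statement "there is no injection from $[0,1]$ to $\mathbb{N}$".
   Context: Language and base theory. The finite types are generated by: $0$ is a type, and if $\sigma,\tau$ are types then so is $\sigma\to\tau$. Type $0$ is the type of natural numbers, $1:=0\to0$, $n+1:=n\to0$. The language $\mathsf{L}_\omega$ of higher-order arithmetic has variables of all finite types, the constants $0,1,<_0,+_0,\times_0,=_0$ on type $0$, combinators, and recursor constants $\mathbf{R}_\sigma$ for each type $\sigma$. Equality at type $\tau=(\tau_1\to\dots\to\tau_k\to0)$ is defined by $x=_\tau y\equiv(\forall z_1^{\tau_1}\dots z_k^{\tau_k})(xz_1\dots z_k=_0yz_1\dots z_k)$. The theory $\mathsf{RCA}_0^\omega$ (Kohlenbach's base theory of higher-order Reverse Mathematics, with classical logic) consists of: (a) axioms that $0,1,<_0,+_0,\times_0$ form an ordered semi-ring with equality $=_0$; (b) the defining axioms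 of the $\Pi$ and $\Sigma$ combinators (i.e. $K$ and $S$), giving $\lambda$-abstraction in all types; (c) the axiom for $\mathbf{R}_0$: $\mathbf{R}_0(f,m,0)=m$, $\mathbf{R}_0(f,m,n+1)=f(n,\mathbf{R}_0(f,m,n))$ for $m^0,f^1$ (with pairs of numbers coded); (d) extensionality: $x=_\rho y\to\varphi(x)=_\tau\varphi(y)$ for all $x^\rho,y^\rho,\varphi^{\rho\to\tau}$ and all types $\rho,\tau$; (e) induction for quantifier-free formulas of $\mathsf{L}_\omega$ (with parameters of any type); (f) $\mathsf{QF\text{-}AC}^{1,0}$, where for types $\sigma,\tau$ the schema $\mathsf{QF\text{-}AC}^{\sigma,\tau}$ is $(\forall x^\sigma)(\exists y^\tau)A(x,y)\to(\exists Y^{\sigma\to\tau})(\forall x^\sigma)A(x,Y(x))$ for quantifier-free $A$ (variables of any type allowed in $A$). Reals, functions, sets. Real numbers are coded by sequences of rationals $(q_n)$ with $|q_n-q_{n+i}|<2^{-n}$ for all $n,i$; $x=_{\mathbb R}y$ for reals coded by $(q_n),(r_n)$ means $|q_n-r_n|\le2^{-n+1}$ for all $n$, and $<_{\mathbb R}$ is defined similarly. Functions on $\mathbb{R}$ or $[0,1]$ (with values in $\mathbb R$ or $\mathbb N$) are functionals on codes that map $=_{\mathbb R}$-equal reals to equal values. Subsets of $\mathbb R$ are given by characteristic functions. Continuity is the usual epsilon-delta notion for such third-order functions (no codes). $\mathsf{NIN}$ is formalised as: for every $Y:[0,1]\to\mathbb{N}$ there are $x,y\in[0,1]$ with $x\neq_{\mathbb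 R}y$ and $Y(x)=_0Y(y)$. Baire class $1$. A function $g:[0,1]\to\mathbb R$ is called Baire class $1$ if for every non-empty perfect set $P\subseteq[0,1]$ (closed, without isolated points) the restriction of $g$ to $P$ has a point of continuity in $P$. (This condition, which by Baire's characterisation theorem is classically equivalent to being a pointwise limit of continuous functions, is taken as the definition.) *)

theory Defs
  imports Main
begin

section \<open>The language of higher-order arithmetic\<close>

datatype ty = TyN | TyFun ty ty (infixr "\<Rrightarrow>" 70)

abbreviation Ty1 :: ty where "Ty1 \<equiv> TyN \<Rrightarrow> TyN"

text \<open>
  A variable is identified by its index together with its type.  The combinators written
  \<open>\<Pi>\<close> and \<open>\<Sigma>\<close> in the literature are \<open>KK\<close> and \<open>SS\<close>.  Less-than and equality on type 0 are the
  only predicate symbols; they occur in formulas, not in terms.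
\<close>

datatype tm =
    Var nat ty
  | Zero | One | Plus | Times
  | KK ty ty
  | SS ty ty ty
  | Rec ty
  | App tm tm (infixl "\<cdot>" 200)

fun ty_of :: "tm \<Rightarrow> ty" where
  "ty_of (Var x \<sigma>) = \<sigma>"
| "ty_of Zero = TyN"
| "ty_of One = TyN"
| "ty_of Plus = TyN \<Rrightarrow> TyN \<Rrightarrow> TyN"
| "ty_of Times = TyN \<Rrightarrow> TyN \<Rrightarrow> TyN"
| "ty_of (KK \<rho> \<tau>) = \<rho> \<Rrightarrow> \<tau> \<Rrightarrow> \<rho>"
| "ty_of (SS \<delta> \<rho> \<tau>) = (\<delta> \<Rrightarrow> \<rho> \<Rrightarrow> \<tau>) \<Rrightarrow> (\<delta> \<Rrightarrow> \<rho>) \<Rrightarrow> \<delta> \<Rrightarrow> \<tau>"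
| "ty_of (Rec \<sigma>) = (TyN \<Rrightarrow> \<sigma> \<Rrightarrow> \<sigma>) \<Rrightarrow> \<sigma> \<Rrightarrow> TyN \<Rrightarrow> \<sigma>"
| "ty_of (App t u) = (case ty_of t of TyN \<Rightarrow> TyN | TyFun \<sigma> \<tau> \<Rightarrow> \<tau>)"

fun wf_tm :: "tm \<Rightarrow> bool" where
  "wf_tm (App t u) \<longleftrightarrow> wf_tm t \<and> wf_tm u \<and> (\<exists>\<tau>. ty_of t = ty_of u \<Rrightarrow> \<tau>)"
| "wf_tm _ \<longleftrightarrow> True"

datatype fm =
    Fls
  | Eq tm tm
  | Less tm tm
  | Imp fm fm (infixr "\<^bold>\<longrightarrow>" 25)
  | AllV nat ty fm

fun wf_fm :: "fm \<Rightarrow> bool" where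
  "wf_fm Fls \<longleftrightarrow> True"
| "wf_fm (Eq t u) \<longleftrightarrow> wf_tm t \<and> wf_tm u \<and> ty_of t = TyN \<and> ty_of u = TyN"
| "wf_fm (Less t u) \<longleftrightarrow> wf_tm t \<and> wf_tm u \<and> ty_of t = TyN \<and> ty_of u = TyN"
| "wf_fm (Imp \<phi> \<psi>) \<longleftrightarrow> wf_fm \<phi> \<and> wf_fm \<psi>"
| "wf_fm (AllV x \<sigma> \<phi>) \<longleftrightarrow> wf_fm \<phi>"

definition FNeg :: "fm \<Rightarrow> fm" ("\<^bold>\<not> _" [40] 40) where
  "FNeg \<phi> = Imp \<phi> Fls"
definition FOr :: "fm \<Rightarrow> fm \<Rightarrow> fm" (infixr "\<^bold>\<or>" 30) where
  "FOr \<phi> \<psi> = Imp (FNeg \<phi>) \<psi>"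
definition FAnd :: "fm \<Rightarrow> fm \<Rightarrow> fm" (infixr "\<^bold>\<and>" 35) where
  "FAnd \<phi> \<psi> = FNeg (Imp \<phi> (FNeg \<psi>))"
definition ExV :: "nat \<Rightarrow> ty \<Rightarrow> fm \<Rightarrow> fm" where
  "ExV x \<sigma> \<phi> = FNeg (AllV x \<sigma> (FNeg \<phi>))"

text \<open>Equality at higher types is a defined, quantified formula, so it is not quantifier-free.\<close>

fun qfree :: "fm \<Rightarrow> bool" where
  "qfree (Imp \<phi> \<psi>) \<longleftrightarrow> qfree \<phi> \<and> qfree \<psi>"
| "qfree (AllV x \<sigma> \<phi>) \<longleftrightarrow> False"
| "qfree _ \<longleftrightarrow> True"

fun fv_tm :: "tm \<Rightarrow> (nat \<times> ty) set" where
  "fv_tm (Var x \<sigma>) = {(x, \<sigma>)}"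
| "fv_tm (App t u) = fv_tm t \<union> fv_tm u"
| "fv_tm _ = {}"

fun fv :: "fm \<Rightarrow> (nat \<times> ty) set" where
  "fv Fls = {}"
| "fv (Eq t u) = fv_tm t \<union> fv_tm u"
| "fv (Less t u) = fv_tm t \<union> fv_tm u"
| "fv (Imp \<phi> \<psi>) = fv \<phi> \<union> fv \<psi>"
| "fv (AllV x \<sigma> \<phi>) = fv \<phi> - {(x, \<sigma>)}"

fun subst_tm :: "nat \<Rightarrow> ty \<Rightarrow> tm \<Rightarrow> tm \<Rightarrow> tm" where
  "subst_tm x \<sigma> s (Var y \<tau>) = (if (y, \<tau>) = (x, \<sigma>) then s else Var y \<tau>)"
| "subst_tm x \<sigma> s (App t u) = App (subst_tm x \<sigma> s t) (subst_tm x \<sigma> s u)"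
| "subst_tm x \<sigma> s t = t"

text \<open>Substitution of \<open>s\<close> for the free occurrences of a variable; it does not rename bound
  variables and is only used when \<open>s\<close> is free for the variable.\<close>

fun subst_fm :: "nat \<Rightarrow> ty \<Rightarrow> tm \<Rightarrow> fm \<Rightarrow> fm" where
  "subst_fm x \<sigma> s Fls = Fls"
| "subst_fm x \<sigma> s (Eq t u) = Eq (subst_tm x \<sigma> s t) (subst_tm x \<sigma> s u)"
| "subst_fm x \<sigma> s (Less t u) = Less (subst_tm x \<sigma> s t) (subst_tm x \<sigma> s u)"
| "subst_fm x \<sigma> s (Imp \<phi> \<psi>) = Imp (subst_fm x \<sigma> s \<phi>) (subst_fm x \<sigma> s \<psi>)"
| "subst_fm x \<sigma> s (AllV y \<tau> \<phi>) =
     (if (y, \<tau>) = (x, \<sigma>) then AllV y \<tau> \<phi> else AllV y \<tau> (subst_fm x \<sigma> s \<phi>))"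

fun free_for :: "tm \<Rightarrow> nat \<Rightarrow> ty \<Rightarrow> fm \<Rightarrow> bool" where
  "free_for s x \<sigma> (Imp \<phi> \<psi>) \<longleftrightarrow> free_for s x \<sigma> \<phi> \<and> free_for s x \<sigma> \<psi>"
| "free_for s x \<sigma> (AllV y \<tau> \<phi>) \<longleftrightarrow>
     (x, \<sigma>) \<notin> fv (AllV y \<tau> \<phi>) \<or> ((y, \<tau>) \<notin> fv_tm s \<and> free_for s x \<sigma> \<phi>)"
| "free_for s x \<sigma> _ \<longleftrightarrow> True"


section \<open>Classical many-sorted predicate logic\<close>

text \<open>A Hilbert calculus.  Generalisation is unrestricted, so the non-logical axioms in \<open>T\<close> are
  read as their universal closures.\<close>

inductive provable :: "fm set \<Rightarrow> fm \<Rightarrow> bool" (infix "\<turnstile>" 20) for T :: "fm set" where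
  ax: "\<phi> \<in> T \<Longrightarrow> T \<turnstile> \<phi>"
| weaken: "wf_fm \<phi> \<Longrightarrow> wf_fm \<psi> \<Longrightarrow> T \<turnstile> (\<phi> \<^bold>\<longrightarrow> \<psi> \<^bold>\<longrightarrow> \<phi>)"
| distr: "wf_fm \<phi> \<Longrightarrow> wf_fm \<psi> \<Longrightarrow> wf_fm \<chi> \<Longrightarrow>
    T \<turnstile> ((\<phi> \<^bold>\<longrightarrow> \<psi> \<^bold>\<longrightarrow> \<chi>) \<^bold>\<longrightarrow> (\<phi> \<^bold>\<longrightarrow> \<psi>) \<^bold>\<longrightarrow> \<phi> \<^bold>\<longrightarrow> \<chi>)"
| dneg: "wf_fm \<phi> \<Longrightarrow> T \<turnstile> ((\<^bold>\<not> \<^bold>\<not> \<phi>) \<^bold>\<longrightarrow> \<phi>)"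
| inst: "wf_fm \<phi> \<Longrightarrow> wf_tm t \<Longrightarrow> ty_of t = \<sigma> \<Longrightarrow> free_for t x \<sigma> \<phi> \<Longrightarrow>
    T \<turnstile> (AllV x \<sigma> \<phi> \<^bold>\<longrightarrow> subst_fm x \<sigma> t \<phi>)"
| all_imp: "wf_fm \<phi> \<Longrightarrow> wf_fm \<psi> \<Longrightarrow> (x, \<sigma>) \<notin> fv \<phi> \<Longrightarrow>
    T \<turnstile> (AllV x \<sigma> (\<phi> \<^bold>\<longrightarrow> \<psi>) \<^bold>\<longrightarrow> \<phi> \<^bold>\<longrightarrow> AllV x \<sigma> \<psi>)"
| mp: "T \<turnstile> (\<phi> \<^bold>\<longrightarrow> \<psi>) \<Longrightarrow> T \<turnstile> \<phi> \<Longrightarrow> T \<turnstile> \<psi>"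
| gen: "T \<turnstile> \<phi> \<Longrightarrow> T \<turnstile> AllV x \<sigma> \<phi>"


section \<open>Writing formulas and terms with binders\<close>

text \<open>
  To write object-level formulas without capture of variables, a quantified formula is given by
  a function \<open>F\<close> from terms to formulas, and the bound variable is chosen with an index larger
  than every index occurring (free or bound) in \<open>F Zero\<close>.  For the \<open>F\<close> used below, which only
  plug their argument into a fixed context, this variable is fresh.  The same device, followed by
  the usual bracket abstraction, yields \<open>\<lambda>\<close>-terms.
\<close>

fun vmax_tm :: "tm \<Rightarrow> nat" where
  "vmax_tm (Var x \<sigma>) = x"
| "vmax_tm (App t u) = max (vmax_tm t) (vmax_tm u)"
| "vmax_tm _ = 0"

fun vmax :: "fm \<Rightarrow> nat" where
  "vmax Fls = 0"
| "vmax (Eq t u) = max (vmax_tm t) (vmax_tm u)"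
| "vmax (Less t u) = max (vmax_tm t) (vmax_tm u)"
| "vmax (Imp \<phi> \<psi>) = max (vmax \<phi>) (vmax \<psi>)"
| "vmax (AllV x \<sigma> \<phi>) = max x (vmax \<phi>)"

definition Forall :: "ty \<Rightarrow> (tm \<Rightarrow> fm) \<Rightarrow> fm" where
  "Forall \<sigma> F = (let x = Suc (vmax (F Zero)) in AllV x \<sigma> (F (Var x \<sigma>)))"

definition Exists :: "ty \<Rightarrow> (tm \<Rightarrow> fm) \<Rightarrow> fm" where
  "Exists \<sigma> F = (let x = Suc (vmax (F Zero)) in ExV x \<sigma> (F (Var x \<sigma>)))"

fun abs_tm :: "nat \<Rightarrow> ty \<Rightarrow> tm \<Rightarrow> tm" where
  "abs_tm x \<sigma> (App t u) =
     (if (x, \<sigma>) \<notin> fv_tm (App t u) then KK (ty_of (App t u)) \<sigma> \<cdot> App t u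
      else SS \<sigma> (ty_of u) (ty_of (App t u)) \<cdot> abs_tm x \<sigma> t \<cdot> abs_tm x \<sigma> u)"
| "abs_tm x \<sigma> t =
     (if t = Var x \<sigma> then SS \<sigma> (\<sigma> \<Rrightarrow> \<sigma>) \<sigma> \<cdot> KK \<sigma> (\<sigma> \<Rrightarrow> \<sigma>) \<cdot> KK \<sigma> \<sigma>
      else KK (ty_of t) \<sigma> \<cdot> t)"

definition Lam :: "ty \<Rightarrow> (tm \<Rightarrow> tm) \<Rightarrow> tm" where
  "Lam \<sigma> F = (let x = Suc (vmax_tm (F Zero)) in abs_tm x \<sigma> (F (Var x \<sigma>)))"

abbreviation forall_nat :: "(tm \<Rightarrow> fm) \<Rightarrow> fm" (binder "\<^bold>\<forall>\<^sub>0" 10) where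
  "forall_nat F \<equiv> Forall TyN F"
abbreviation exists_nat :: "(tm \<Rightarrow> fm) \<Rightarrow> fm" (binder "\<^bold>\<exists>\<^sub>0" 10) where
  "exists_nat F \<equiv> Exists TyN F"
abbreviation lam_nat :: "(tm \<Rightarrow> tm) \<Rightarrow> tm" (binder "\<^bold>\<lambda>\<^sub>0" 10) where
  "lam_nat F \<equiv> Lam TyN F"

fun EqT :: "ty \<Rightarrow> tm \<Rightarrow> tm \<Rightarrow> fm" where
  "EqT TyN s t = Eq s t"
| "EqT (\<sigma> \<Rrightarrow> \<tau>) s t = Forall \<sigma> (\<lambda>z. EqT \<tau> (s \<cdot> z) (t \<cdot> z))"

abbreviation add :: "tm \<Rightarrow> tm \<Rightarrow> tm" (infixl "\<^bold>+" 120) where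
  "t \<^bold>+ u \<equiv> Plus \<cdot> t \<cdot> u"
abbreviation mul :: "tm \<Rightarrow> tm \<Rightarrow> tm" (infixl "\<^bold>*" 130) where
  "t \<^bold>* u \<equiv> Times \<cdot> t \<cdot> u"
abbreviation eq0 :: "tm \<Rightarrow> tm \<Rightarrow> fm" (infix "\<^bold>=" 50) where
  "t \<^bold>= u \<equiv> Eq t u"
abbreviation lt0 :: "tm \<Rightarrow> tm \<Rightarrow> fm" (infix "\<^bold><" 50) where
  "t \<^bold>< u \<equiv> Less t u"
abbreviation le0 :: "tm \<Rightarrow> tm \<Rightarrow> fm" (infix "\<^bold>\<le>" 50) where
  "t \<^bold>\<le> u \<equiv> (t \<^bold>< u \<^bold>\<or> t \<^bold>= u)"


section \<open>The base theory\<close>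

text \<open>Congruence of application for \<open>=\<^sub>0\<close> is an instance of extensionality below, so only the
  congruence of \<open><\<close> is listed with the equality axioms.\<close>

definition arith_axioms :: "fm set" where
  "arith_axioms = {
     \<^bold>\<forall>\<^sub>0 a. a \<^bold>= a,
     \<^bold>\<forall>\<^sub>0 a. \<^bold>\<forall>\<^sub>0 b. a \<^bold>= b \<^bold>\<longrightarrow> b \<^bold>= a,
     \<^bold>\<forall>\<^sub>0 a. \<^bold>\<forall>\<^sub>0 b. \<^bold>\<forall>\<^sub>0 c. a \<^bold>= b \<^bold>\<longrightarrow> b \<^bold>= c \<^bold>\<longrightarrow> a \<^bold>= c,
     \<^bold>\<forall>\<^sub>0 a. \<^bold>\<forall>\<^sub>0 b. \<^bold>\<forall>\<^sub>0 c. \<^bold>\<forall>\<^sub>0 d. a \<^bold>= b \<^bold>\<longrightarrow> c \<^bold>= d \<^bold>\<longrightarrow> a \<^bold>< c \<^bold>\<longrightarrow> b \<^bold>< d,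
     \<^bold>\<forall>\<^sub>0 a. \<^bold>\<forall>\<^sub>0 b. \<^bold>\<forall>\<^sub>0 c. (a \<^bold>+ b) \<^bold>+ c \<^bold>= a \<^bold>+ (b \<^bold>+ c),
     \<^bold>\<forall>\<^sub>0 a. \<^bold>\<forall>\<^sub>0 b. a \<^bold>+ b \<^bold>= b \<^bold>+ a,
     \<^bold>\<forall>\<^sub>0 a. a \<^bold>+ Zero \<^bold>= a,
     \<^bold>\<forall>\<^sub>0 a. \<^bold>\<forall>\<^sub>0 b. \<^bold>\<forall>\<^sub>0 c. (a \<^bold>* b) \<^bold>* c \<^bold>= a \<^bold>* (b \<^bold>* c),
     \<^bold>\<forall>\<^sub>0 a. \<^bold>\<forall>\<^sub>0 b. a \<^bold>* b \<^bold>= b \<^bold>* a,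
     \<^bold>\<forall>\<^sub>0 a. a \<^bold>* One \<^bold>= a,
     \<^bold>\<forall>\<^sub>0 a. a \<^bold>* Zero \<^bold>= Zero,
     \<^bold>\<forall>\<^sub>0 a. \<^bold>\<forall>\<^sub>0 b. \<^bold>\<forall>\<^sub>0 c. a \<^bold>* (b \<^bold>+ c) \<^bold>= a \<^bold>* b \<^bold>+ a \<^bold>* c,
     \<^bold>\<forall>\<^sub>0 a. \<^bold>\<not> (a \<^bold>< a),
     \<^bold>\<forall>\<^sub>0 a. \<^bold>\<forall>\<^sub>0 b. \<^bold>\<forall>\<^sub>0 c. a \<^bold>< b \<^bold>\<longrightarrow> b \<^bold>< c \<^bold>\<longrightarrow> a \<^bold>< c,
     \<^bold>\<forall>\<^sub>0 a. \<^bold>\<forall>\<^sub>0 b. a \<^bold>< b \<^bold>\<or> a \<^bold>= b \<^bold>\<or> b \<^bold>< a,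
     Zero \<^bold>< One,
     \<^bold>\<forall>\<^sub>0 a. \<^bold>\<forall>\<^sub>0 b. \<^bold>\<forall>\<^sub>0 c. a \<^bold>< b \<^bold>\<longrightarrow> a \<^bold>+ c \<^bold>< b \<^bold>+ c,
     \<^bold>\<forall>\<^sub>0 a. \<^bold>\<forall>\<^sub>0 b. \<^bold>\<forall>\<^sub>0 c. Zero \<^bold>< c \<^bold>\<longrightarrow> a \<^bold>< b \<^bold>\<longrightarrow> a \<^bold>* c \<^bold>< b \<^bold>* c}"

definition K_axiom :: "ty \<Rightarrow> ty \<Rightarrow> fm" where
  "K_axiom \<rho> \<tau> = Forall \<rho> (\<lambda>x. Forall \<tau> (\<lambda>y. EqT \<rho> (KK \<rho> \<tau> \<cdot> x \<cdot> y) x))"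

definition S_axiom :: "ty \<Rightarrow> ty \<Rightarrow> ty \<Rightarrow> fm" where
  "S_axiom \<delta> \<rho> \<tau> =
     Forall (\<delta> \<Rrightarrow> \<rho> \<Rrightarrow> \<tau>) (\<lambda>x. Forall (\<delta> \<Rrightarrow> \<rho>) (\<lambda>y. Forall \<delta> (\<lambda>z.
       EqT \<tau> (SS \<delta> \<rho> \<tau> \<cdot> x \<cdot> y \<cdot> z) (x \<cdot> z \<cdot> (y \<cdot> z)))))"

text \<open>The step function of primitive recursion has two number arguments and is taken in curried
  form, rather than as a function of one coded pair.\<close>

definition rec_axioms :: "fm set" where
  "rec_axioms = {
     Forall (TyN \<Rrightarrow> TyN \<Rrightarrow> TyN) (\<lambda>f. \<^bold>\<forall>\<^sub>0 m. Rec TyN \<cdot> f \<cdot> m \<cdot> Zero \<^bold>= m),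
     Forall (TyN \<Rrightarrow> TyN \<Rrightarrow> TyN) (\<lambda>f. \<^bold>\<forall>\<^sub>0 m. \<^bold>\<forall>\<^sub>0 n.
       Rec TyN \<cdot> f \<cdot> m \<cdot> (n \<^bold>+ One) \<^bold>= f \<cdot> n \<cdot> (Rec TyN \<cdot> f \<cdot> m \<cdot> n))}"

definition ext_axiom :: "ty \<Rightarrow> ty \<Rightarrow> fm" where
  "ext_axiom \<rho> \<tau> =
     Forall \<rho> (\<lambda>x. Forall \<rho> (\<lambda>y. Forall (\<rho> \<Rrightarrow> \<tau>) (\<lambda>\<phi>.
       EqT \<rho> x y \<^bold>\<longrightarrow> EqT \<tau> (\<phi> \<cdot> x) (\<phi> \<cdot> y))))"

definition QF_IND :: "fm set" where
  "QF_IND =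
     {subst_fm n TyN Zero \<phi> \<^bold>\<longrightarrow> AllV n TyN (\<phi> \<^bold>\<longrightarrow> subst_fm n TyN (Var n TyN \<^bold>+ One) \<phi>)
        \<^bold>\<longrightarrow> AllV n TyN \<phi> | n \<phi>. wf_fm \<phi> \<and> qfree \<phi>}"

definition QF_AC :: "ty \<Rightarrow> ty \<Rightarrow> fm set" where
  "QF_AC \<sigma> \<tau> =
     {AllV x \<sigma> (ExV y \<tau> A) \<^bold>\<longrightarrow>
        ExV Y (\<sigma> \<Rrightarrow> \<tau>) (AllV x \<sigma> (subst_fm y \<tau> (Var Y (\<sigma> \<Rrightarrow> \<tau>) \<cdot> Var x \<sigma>) A)) | x y Y A.
      wf_fm A \<and> qfree A \<and> (x, \<sigma>) \<noteq> (y, \<tau>) \<and> (Y, \<sigma> \<Rrightarrow> \<tau>) \<notin> fv A}"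

definition RCA0_omega :: "fm set" where
  "RCA0_omega =
     arith_axioms
     \<union> {K_axiom \<rho> \<tau> | \<rho> \<tau>. True}
     \<union> {S_axiom \<delta> \<rho> \<tau> | \<delta> \<rho> \<tau>. True}
     \<union> rec_axioms
     \<union> {ext_axiom \<rho> \<tau> | \<rho> \<tau>. True}
     \<union> QF_IND
     \<union> QF_AC Ty1 TyN"


section \<open>Coding of rationals and reals\<close>

definition pred_tm :: tm where
  "pred_tm = Rec TyN \<cdot> KK TyN TyN \<cdot> Zero"

definition monus_tm :: tm where
  "monus_tm = (\<^bold>\<lambda>\<^sub>0 a. \<^bold>\<lambda>\<^sub>0 b. Rec TyN \<cdot> (KK Ty1 TyN \<cdot> pred_tm) \<cdot> a \<cdot> b)"

abbreviation monus :: "tm \<Rightarrow> tm \<Rightarrow> tm" (infixl "\<^bold>-" 120) where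
  "t \<^bold>- u \<equiv> monus_tm \<cdot> t \<cdot> u"

definition exp2_tm :: tm where
  "exp2_tm = Rec TyN \<cdot> (\<^bold>\<lambda>\<^sub>0 n. \<^bold>\<lambda>\<^sub>0 k. k \<^bold>+ k) \<cdot> One"

text \<open>Integer square root: the value \<open>k\<close> at \<open>n\<close> is increased by one exactly if
  \<open>(k + 1)\<^sup>2 \<le> n + 1\<close>.\<close>

definition isqrt_tm :: tm where
  "isqrt_tm = Rec TyN \<cdot>
     (\<^bold>\<lambda>\<^sub>0 n. \<^bold>\<lambda>\<^sub>0 k. k \<^bold>+ (One \<^bold>- ((k \<^bold>+ One) \<^bold>* (k \<^bold>+ One) \<^bold>- (n \<^bold>+ One)))) \<cdot> Zero"

text \<open>The pairing function \<open>(a + b)\<^sup>2 + a\<close>, with total left inverses.\<close>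

definition pair_tm :: tm where
  "pair_tm = (\<^bold>\<lambda>\<^sub>0 a. \<^bold>\<lambda>\<^sub>0 b. (a \<^bold>+ b) \<^bold>* (a \<^bold>+ b) \<^bold>+ a)"

definition fst_tm :: tm where
  "fst_tm = (\<^bold>\<lambda>\<^sub>0 p. p \<^bold>- (isqrt_tm \<cdot> p) \<^bold>* (isqrt_tm \<cdot> p))"

definition snd_tm :: tm where
  "snd_tm = (\<^bold>\<lambda>\<^sub>0 p. isqrt_tm \<cdot> p \<^bold>- fst_tm \<cdot> p)"

text \<open>Every number codes a rational: \<open>\<langle>\<langle>a, b\<rangle>, c\<rangle>\<close> codes \<open>(a - b) / (c + 1)\<close>.  A rational has
  many codes, and the order below compares the coded rationals.\<close>

definition rat_tm :: tm where
  "rat_tm = (\<^bold>\<lambda>\<^sub>0 a. \<^bold>\<lambda>\<^sub>0 b. \<^bold>\<lambda>\<^sub>0 c. pair_tm \<cdot> (pair_tm \<cdot> a \<cdot> b) \<cdot> c)"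

definition pos_tm :: tm where "pos_tm = (\<^bold>\<lambda>\<^sub>0 p. fst_tm \<cdot> (fst_tm \<cdot> p))"
definition neg_tm :: tm where "neg_tm = (\<^bold>\<lambda>\<^sub>0 p. snd_tm \<cdot> (fst_tm \<cdot> p))"
definition den_tm :: tm where "den_tm = (\<^bold>\<lambda>\<^sub>0 p. snd_tm \<cdot> p \<^bold>+ One)"

text \<open>The difference of the rationals coded by \<open>p\<close> and \<open>q\<close> has the numerator
  \<open>cross p q - cross q p\<close> over the product of the two denominators.\<close>

definition cross_tm :: tm where
  "cross_tm = (\<^bold>\<lambda>\<^sub>0 p. \<^bold>\<lambda>\<^sub>0 q.
     (pos_tm \<cdot> p) \<^bold>* (den_tm \<cdot> q) \<^bold>+ (neg_tm \<cdot> q) \<^bold>* (den_tm \<cdot> p))"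

definition qadd_tm :: tm where
  "qadd_tm = (\<^bold>\<lambda>\<^sub>0 p. \<^bold>\<lambda>\<^sub>0 q. rat_tm
     \<cdot> ((pos_tm \<cdot> p) \<^bold>* (den_tm \<cdot> q) \<^bold>+ (pos_tm \<cdot> q) \<^bold>* (den_tm \<cdot> p))
     \<cdot> ((neg_tm \<cdot> p) \<^bold>* (den_tm \<cdot> q) \<^bold>+ (neg_tm \<cdot> q) \<^bold>* (den_tm \<cdot> p))
     \<cdot> (pred_tm \<cdot> ((den_tm \<cdot> p) \<^bold>* (den_tm \<cdot> q))))"

definition qdist_tm :: tm where
  "qdist_tm = (\<^bold>\<lambda>\<^sub>0 p. \<^bold>\<lambda>\<^sub>0 q. rat_tm
     \<cdot> ((cross_tm \<cdot> p \<cdot> q \<^bold>- cross_tm \<cdot> q \<cdot> p) \<^bold>+ (cross_tm \<cdot> q \<cdot> p \<^bold>- cross_tm \<cdot> p \<cdot> q))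
     \<cdot> Zero
     \<cdot> (pred_tm \<cdot> ((den_tm \<cdot> p) \<^bold>* (den_tm \<cdot> q))))"

definition q_less :: "tm \<Rightarrow> tm \<Rightarrow> fm" (infix "\<^bold><\<^sub>Q" 50) where
  "p \<^bold><\<^sub>Q q = (cross_tm \<cdot> p \<cdot> q \<^bold>< cross_tm \<cdot> q \<cdot> p)"

definition q_le :: "tm \<Rightarrow> tm \<Rightarrow> fm" (infix "\<^bold>\<le>\<^sub>Q" 50) where
  "p \<^bold>\<le>\<^sub>Q q = (cross_tm \<cdot> p \<cdot> q \<^bold>\<le> cross_tm \<cdot> q \<cdot> p)"

text \<open>Codes of the rationals \<open>2\<^sup>-\<^sup>n\<close> and \<open>2\<^sup>-\<^sup>n\<^sup>+\<^sup>1\<close>.\<close>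

definition eps :: "tm \<Rightarrow> tm" where
  "eps n = rat_tm \<cdot> One \<cdot> Zero \<cdot> (pred_tm \<cdot> (exp2_tm \<cdot> n))"

definition eps2 :: "tm \<Rightarrow> tm" where
  "eps2 n = rat_tm \<cdot> (One \<^bold>+ One) \<cdot> Zero \<cdot> (pred_tm \<cdot> (exp2_tm \<cdot> n))"

definition is_real :: "tm \<Rightarrow> fm" where
  "is_real x = (\<^bold>\<forall>\<^sub>0 n. \<^bold>\<forall>\<^sub>0 i. qdist_tm \<cdot> (x \<cdot> n) \<cdot> (x \<cdot> (n \<^bold>+ i)) \<^bold><\<^sub>Q eps n)"

definition r_eq :: "tm \<Rightarrow> tm \<Rightarrow> fm" (infix "\<^bold>=\<^sub>R" 50) where
  "x \<^bold>=\<^sub>R y = (\<^bold>\<forall>\<^sub>0 n. qdist_tm \<cdot> (x \<cdot> n) \<cdot> (y \<cdot> n) \<^bold>\<le>\<^sub>Q eps2 n)"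

definition r_less :: "tm \<Rightarrow> tm \<Rightarrow> fm" (infix "\<^bold><\<^sub>R" 50) where
  "x \<^bold><\<^sub>R y = (\<^bold>\<exists>\<^sub>0 n. qadd_tm \<cdot> (x \<cdot> n) \<cdot> eps2 n \<^bold><\<^sub>Q y \<cdot> n)"

definition r_le :: "tm \<Rightarrow> tm \<Rightarrow> fm" (infix "\<^bold>\<le>\<^sub>R" 50) where
  "x \<^bold>\<le>\<^sub>R y = (\<^bold>\<not> (y \<^bold><\<^sub>R x))"

text \<open>The code of the real \<open>|x - y|\<close>; the index shift makes it satisfy the convergence condition.\<close>

definition rdist_tm :: tm where
  "rdist_tm = Lam Ty1 (\<lambda>x. Lam Ty1 (\<lambda>y. \<^bold>\<lambda>\<^sub>0 n.
     qdist_tm \<cdot> (x \<cdot> (n \<^bold>+ One)) \<cdot> (y \<cdot> (n \<^bold>+ One))))"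

definition const_real :: "tm \<Rightarrow> tm" where
  "const_real q = KK TyN TyN \<cdot> q"

definition dist_less :: "tm \<Rightarrow> tm \<Rightarrow> tm \<Rightarrow> fm" where
  \<comment> \<open>\<open>|x - y| < 2\<^sup>-\<^sup>k\<close>\<close>
  "dist_less k x y = (rdist_tm \<cdot> x \<cdot> y \<^bold><\<^sub>R const_real (eps k))"

definition in_unit :: "tm \<Rightarrow> fm" where
  "in_unit x =
     (is_real x \<^bold>\<and> const_real (rat_tm \<cdot> Zero \<cdot> Zero \<cdot> Zero) \<^bold>\<le>\<^sub>R x
        \<^bold>\<and> x \<^bold>\<le>\<^sub>R const_real (rat_tm \<cdot> One \<cdot> Zero \<cdot> Zero))"

definition forall_real :: "(tm \<Rightarrow> fm) \<Rightarrow> fm" (binder "\<^bold>\<forall>\<^sub>R" 10) where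
  "forall_real F = Forall Ty1 (\<lambda>x. is_real x \<^bold>\<longrightarrow> F x)"
definition exists_real :: "(tm \<Rightarrow> fm) \<Rightarrow> fm" (binder "\<^bold>\<exists>\<^sub>R" 10) where
  "exists_real F = Exists Ty1 (\<lambda>x. is_real x \<^bold>\<and> F x)"
definition forall_unit :: "(tm \<Rightarrow> fm) \<Rightarrow> fm" (binder "\<^bold>\<forall>\<^sub>I" 10) where
  "forall_unit F = Forall Ty1 (\<lambda>x. in_unit x \<^bold>\<longrightarrow> F x)"
definition exists_unit :: "(tm \<Rightarrow> fm) \<Rightarrow> fm" (binder "\<^bold>\<exists>\<^sub>I" 10) where
  "exists_unit F = Exists Ty1 (\<lambda>x. in_unit x \<^bold>\<and> F x)"


section \<open>Functions and sets of reals\<close>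

definition fun_unit_nat :: "tm \<Rightarrow> fm" where
  "fun_unit_nat Y = (\<^bold>\<forall>\<^sub>I x. \<^bold>\<forall>\<^sub>I y. x \<^bold>=\<^sub>R y \<^bold>\<longrightarrow> Y \<cdot> x \<^bold>= Y \<cdot> y)"

definition fun_unit_real :: "tm \<Rightarrow> fm" where
  "fun_unit_real f =
     ((\<^bold>\<forall>\<^sub>I x. is_real (f \<cdot> x)) \<^bold>\<and>
      (\<^bold>\<forall>\<^sub>I x. \<^bold>\<forall>\<^sub>I y. x \<^bold>=\<^sub>R y \<^bold>\<longrightarrow> f \<cdot> x \<^bold>=\<^sub>R f \<cdot> y))"

definition real_set :: "tm \<Rightarrow> fm" where
  "real_set P =
     ((\<^bold>\<forall>\<^sub>R x. P \<cdot> x \<^bold>= Zero \<^bold>\<or> P \<cdot> x \<^bold>= One) \<^bold>\<and>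
      (\<^bold>\<forall>\<^sub>R x. \<^bold>\<forall>\<^sub>R y. x \<^bold>=\<^sub>R y \<^bold>\<longrightarrow> P \<cdot> x \<^bold>= P \<cdot> y))"

definition set_mem :: "tm \<Rightarrow> tm \<Rightarrow> fm" (infix "\<^bold>\<in>" 50) where
  "x \<^bold>\<in> P = (P \<cdot> x \<^bold>= One)"

definition closed_set :: "tm \<Rightarrow> fm" where
  "closed_set P = (\<^bold>\<forall>\<^sub>R x. (\<^bold>\<not> (x \<^bold>\<in> P)) \<^bold>\<longrightarrow> (\<^bold>\<exists>\<^sub>0 k. \<^bold>\<forall>\<^sub>R y. dist_less k x y \<^bold>\<longrightarrow> \<^bold>\<not> (y \<^bold>\<in> P)))"

definition no_isolated_points :: "tm \<Rightarrow> fm" where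
  "no_isolated_points P =
     (\<^bold>\<forall>\<^sub>R x. x \<^bold>\<in> P \<^bold>\<longrightarrow> (\<^bold>\<forall>\<^sub>0 k. \<^bold>\<exists>\<^sub>R y. y \<^bold>\<in> P \<^bold>\<and> dist_less k x y \<^bold>\<and> \<^bold>\<not> (x \<^bold>=\<^sub>R y)))"

definition perfect_in_unit :: "tm \<Rightarrow> fm" where
  "perfect_in_unit P =
     (real_set P \<^bold>\<and> (\<^bold>\<forall>\<^sub>R x. x \<^bold>\<in> P \<^bold>\<longrightarrow> in_unit x) \<^bold>\<and> closed_set P \<^bold>\<and> no_isolated_points P)"

definition nonempty_set :: "tm \<Rightarrow> fm" where
  "nonempty_set P = (\<^bold>\<exists>\<^sub>R x. x \<^bold>\<in> P)"

definition baire1 :: "tm \<Rightarrow> fm" where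
  "baire1 g =
     (fun_unit_real g \<^bold>\<and>
      Forall (Ty1 \<Rrightarrow> TyN) (\<lambda>P. perfect_in_unit P \<^bold>\<and> nonempty_set P \<^bold>\<longrightarrow>
        (\<^bold>\<exists>\<^sub>R x. x \<^bold>\<in> P \<^bold>\<and>
           (\<^bold>\<forall>\<^sub>0 k. \<^bold>\<exists>\<^sub>0 N. \<^bold>\<forall>\<^sub>R y. y \<^bold>\<in> P \<^bold>\<longrightarrow> dist_less N x y \<^bold>\<longrightarrow> dist_less k (g \<cdot> x) (g \<cdot> y)))))"

definition continuous_unit :: "tm \<Rightarrow> fm" where
  "continuous_unit g =
     (fun_unit_real g \<^bold>\<and>
      (\<^bold>\<forall>\<^sub>I x. \<^bold>\<forall>\<^sub>0 k. \<^bold>\<exists>\<^sub>0 N. \<^bold>\<forall>\<^sub>I y. dist_less N x y \<^bold>\<longrightarrow> dist_less k (g \<cdot> x) (g \<cdot> y)))"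

definition converges :: "(tm \<Rightarrow> tm) \<Rightarrow> tm \<Rightarrow> fm" where
  "converges s l = (\<^bold>\<forall>\<^sub>0 k. \<^bold>\<exists>\<^sub>0 N. \<^bold>\<forall>\<^sub>0 n. N \<^bold>\<le> n \<^bold>\<longrightarrow> dist_less k (s n) l)"


section \<open>The two principles\<close>

definition NIN :: fm where
  "NIN = Forall (Ty1 \<Rrightarrow> TyN) (\<lambda>Y. fun_unit_nat Y \<^bold>\<longrightarrow>
     (\<^bold>\<exists>\<^sub>I x. \<^bold>\<exists>\<^sub>I y. (\<^bold>\<not> (x \<^bold>=\<^sub>R y)) \<^bold>\<and> Y \<cdot> x \<^bold>= Y \<cdot> y))"

text \<open>The term \<open>g \<cdot> m \<cdot> n\<close> denotes \<open>g\<^bsub>m,n\<^esub>\<close>.  In the iterated limit, the sequence \<open>L\<close> consists of the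
  inner limits.\<close>

definition Baire' :: fm where
  "Baire' =
     Forall (TyN \<Rrightarrow> Ty1 \<Rrightarrow> Ty1) (\<lambda>f. Forall (Ty1 \<Rrightarrow> Ty1) (\<lambda>h.
       (\<^bold>\<forall>\<^sub>0 n. baire1 (f \<cdot> n)) \<^bold>\<and> fun_unit_real h \<^bold>\<and> (\<^bold>\<forall>\<^sub>I x. converges (\<lambda>n. f \<cdot> n \<cdot> x) (h \<cdot> x)) \<^bold>\<longrightarrow>
       Exists (TyN \<Rrightarrow> TyN \<Rrightarrow> Ty1 \<Rrightarrow> Ty1) (\<lambda>g.
         (\<^bold>\<forall>\<^sub>0 m. \<^bold>\<forall>\<^sub>0 n. continuous_unit (g \<cdot> m \<cdot> n)) \<^bold>\<and>
         (\<^bold>\<forall>\<^sub>0 n. \<^bold>\<forall>\<^sub>I x. converges (\<lambda>m. g \<cdot> m \<cdot> n \<cdot> x) (f \<cdot> n \<cdot> x)) \<^bold>\<and>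
         (\<^bold>\<forall>\<^sub>I x. Exists (TyN \<Rrightarrow> Ty1) (\<lambda>L.
            (\<^bold>\<forall>\<^sub>0 n. is_real (L \<cdot> n) \<^bold>\<and> converges (\<lambda>m. g \<cdot> m \<cdot> n \<cdot> x) (L \<cdot> n)) \<^bold>\<and>
            converges (\<lambda>n. L \<cdot> n) (h \<cdot> x))))))"

end

theory Submission
  imports Defs "HOL-Library.Countable" "HOL-Computational_Algebra.Fraction_Field"
begin

text \<open>
  By completeness it suffices to derive a contradiction from the failure of \<open>NIN\<close> in an extensional
  Henkin model of \<open>Baire'\<close>, whose numbers may be nonstandard.  Let \<open>Y\<close> be an injection of the unit
  interval into the numbers.  Evaluating \<open>Y\<close> at the limit of a sequence \<open>2\<^sup>-\<^sup>n\<close> that stops at the first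
  zero of a function decides whether there is a zero, so the model satisfies arithmetical
  comprehension.  The function \<open>f\<^sub>n\<close> with value 1 at the point \<open>x\<close> with \<open>Y x = n\<close>, if any, and 0
  elsewhere is of Baire class 1, and \<open>f\<^sub>n\<close> tends to 0, so \<open>Baire'\<close> gives continuous \<open>g\<^bsub>m,n\<^esub>\<close> tending
  to \<open>f\<^sub>n\<close>.  Call an interval hit by \<open>n\<close> if, for some \<open>B\<close> and all \<open>M\<close>, it contains a rational \<open>r\<close> with
  \<open>g\<^bsub>m,n\<^esub>(r) > 1/2\<close> for all \<open>m\<close> from \<open>B\<close> to \<open>M\<close>.  This is arithmetical, by bisection a hit interval
  contains a point \<open>x\<close> with \<open>Y x = n\<close>, and conversely an interval containing all late rational
  approximations of such a point is hit.  Hence two disjoint intervals are not both hit by \<open>n\<close>, and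
  there are nested intervals the \<open>(n+1)\<close>-st of which is not hit by \<open>n\<close>; at their common point \<open>Y\<close> has
  no possible value.
\<close>

text \<open>Working in a model replaces derivations in the calculus, but its numbers need not be
  standard, so induction over HOL naturals says nothing about them: every induction has to be an
  instance of the model's own schema, with the property spelled out as a quantifier-free formula and
  its parameters kept in an assignment. Once number quantifiers can be decided by a functional of
  the model, arithmetical formulas become terms, and induction and comprehension extend to them.
  That is why hits are defined through rational points and finite bounds M: a quantifier over reals
  would leave this class. Inequalities are computed in an ordered field around the numbers of the
  model; it need not be archimedean, so small positive quantities have to come from numbers of the
  model. Intervals are divided into four parts, since halves share an endpoint while the two outer
  quarters are a definite distance apart; the length 4^-k is at most 2^-k, the precision that the
  coding of reals demands at index k.\<close>

instance ty :: countable by countable_datatype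
instance tm :: countable by countable_datatype
instance fm :: countable by countable_datatype

section \<open>Free variables, substitution and renaming of bound variables\<close>

lemma vmax_tm_fv: "(x, \<sigma>) \<in> fv_tm t \<Longrightarrow> x \<le> vmax_tm t"
  by (induction t) auto

lemma vmax_fv: "(x, \<sigma>) \<in> fv \<phi> \<Longrightarrow> x \<le> vmax \<phi>"
  by (induction \<phi>) (auto dest: vmax_tm_fv)

lemma subst_tm_fresh: "(x, \<sigma>) \<notin> fv_tm t \<Longrightarrow> subst_tm x \<sigma> s t = t"
  by (induction t) auto

lemma subst_fm_fresh: "(x, \<sigma>) \<notin> fv \<phi> \<Longrightarrow> subst_fm x \<sigma> s \<phi> = \<phi>"
  by (induction \<phi>) (auto simp: subst_tm_fresh)

lemma ty_of_subst: "ty_of s = \<sigma> \<Longrightarrow> ty_of (subst_tm x \<sigma> s t) = ty_of t"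
  by (induction t) auto

lemma wf_subst_tm: "wf_tm t \<Longrightarrow> wf_tm s \<Longrightarrow> ty_of s = \<sigma> \<Longrightarrow> wf_tm (subst_tm x \<sigma> s t)"
  by (induction t) (auto simp: ty_of_subst)

lemma wf_subst_fm: "wf_fm \<phi> \<Longrightarrow> wf_tm s \<Longrightarrow> ty_of s = \<sigma> \<Longrightarrow> wf_fm (subst_fm x \<sigma> s \<phi>)"
  by (induction \<phi>) (auto simp: ty_of_subst wf_subst_tm)

lemma fv_subst_tm: "fv_tm (subst_tm x \<sigma> s t) \<subseteq> (fv_tm t - {(x, \<sigma>)}) \<union> fv_tm s"
  by (induction t) auto

lemma fv_subst_fm: "fv (subst_fm x \<sigma> s \<phi>) \<subseteq> (fv \<phi> - {(x, \<sigma>)}) \<union> fv_tm s"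
proof (induction \<phi>)
  case (Eq t u)
  then show ?case using fv_subst_tm[of x \<sigma> s t] fv_subst_tm[of x \<sigma> s u] by auto
next
  case (Less t u)
  then show ?case using fv_subst_tm[of x \<sigma> s t] fv_subst_tm[of x \<sigma> s u] by auto
qed auto

lemma free_for_fresh_var: "vmax \<phi> < y \<Longrightarrow> free_for (Var y \<sigma>) x \<sigma> \<phi>"
  by (induction \<phi>) auto

lemma subst_tm_back: "vmax_tm t < y \<Longrightarrow> subst_tm y \<sigma> (Var x \<sigma>) (subst_tm x \<sigma> (Var y \<sigma>) t) = t"
  by (induction t) auto

text \<open>An index above all of \<phi> occurs in it neither free nor bound, so replacing x by y
  loses no information.\<close>

lemma subst_fm_back: "vmax \<phi> < y \<Longrightarrow> subst_fm y \<sigma> (Var x \<sigma>) (subst_fm x \<sigma> (Var y \<sigma>) \<phi>) = \<phi>"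
proof (induction \<phi>)
  case (AllV z \<tau> \<phi>)
  show ?case
  proof (cases "(z, \<tau>) = (x, \<sigma>)")
    case True
    have "(y, \<sigma>) \<notin> fv \<phi>" using AllV.prems vmax_fv[of y \<sigma> \<phi>] by auto
    then show ?thesis using True by (simp add: subst_fm_fresh)
  qed (use AllV in auto)
qed (auto simp: subst_tm_back)

lemma free_for_back: "vmax \<phi> < y \<Longrightarrow> free_for (Var x \<sigma>) y \<sigma> (subst_fm x \<sigma> (Var y \<sigma>) \<phi>)"
proof (induction \<phi>)
  case (AllV z \<tau> \<phi>)
  have "(y, \<sigma>) \<notin> fv \<phi>" using AllV.prems vmax_fv[of y \<sigma> \<phi>] by auto
  then show ?case using AllV by auto
qed auto

lemma fv_rename: "x \<noteq> y \<Longrightarrow> (x, \<sigma>) \<notin> fv (AllV y \<sigma> (subst_fm x \<sigma> (Var y \<sigma>) \<phi>))"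
  using fv_subst_fm[of x \<sigma> "Var y \<sigma>" \<phi>] by auto

fun bvs :: "fm \<Rightarrow> nat set" where
  "bvs (Imp \<phi> \<psi>) = bvs \<phi> \<union> bvs \<psi>"
| "bvs (AllV x \<sigma> \<phi>) = insert x (bvs \<phi>)"
| "bvs _ = {}"

lemma bvs_subst [simp]: "bvs (subst_fm x \<sigma> s \<phi>) = bvs \<phi>"
  by (induction \<phi>) auto

lemma free_for_bvs: "(\<And>y. y \<in> bvs \<phi> \<Longrightarrow> vmax_tm s < y) \<Longrightarrow> free_for s x \<sigma> \<phi>"
proof (induction \<phi>)
  case (AllV y \<tau> \<phi>)
  have "(y, \<tau>) \<notin> fv_tm s" using AllV.prems[of y] vmax_tm_fv[of y \<tau> s] by force
  then show ?case using AllV by auto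
qed auto

text \<open>Terms are not counted, so an instance of a quantified formula is smaller than the
  formula. The truth lemma needs such a measure because an instance is not a subformula.\<close>

fun fsize :: "fm \<Rightarrow> nat" where
  "fsize (Imp \<phi> \<psi>) = Suc (fsize \<phi> + fsize \<psi>)"
| "fsize (AllV x \<sigma> \<phi>) = Suc (fsize \<phi>)"
| "fsize _ = 0"

lemma fsize_subst [simp]: "fsize (subst_fm x \<sigma> s \<phi>) = fsize \<phi>"
  by (induction \<phi>) auto

section \<open>Derivations from hypotheses and the deduction theorem\<close>

lemma wf_FNeg [simp]: "wf_fm (FNeg \<phi>) \<longleftrightarrow> wf_fm \<phi>"
  by (simp add: FNeg_def)

text \<open>Generalisation is left out: with it, a hypothesis would yield its universal closure and
  the deduction theorem would fail. Theorems of T enter whole through \<open>lift\<close>, and the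
  well-formedness premises keep ill-formed axioms of an arbitrary T out.\<close>

inductive ded :: "fm set \<Rightarrow> fm set \<Rightarrow> fm \<Rightarrow> bool" for T \<Gamma> where
  hyp: "\<phi> \<in> \<Gamma> \<Longrightarrow> wf_fm \<phi> \<Longrightarrow> ded T \<Gamma> \<phi>"
| lift: "T \<turnstile> \<phi> \<Longrightarrow> wf_fm \<phi> \<Longrightarrow> ded T \<Gamma> \<phi>"
| mp: "ded T \<Gamma> (\<phi> \<^bold>\<longrightarrow> \<psi>) \<Longrightarrow> ded T \<Gamma> \<phi> \<Longrightarrow> ded T \<Gamma> \<psi>"

lemma ded_wf: "ded T \<Gamma> \<phi> \<Longrightarrow> wf_fm \<phi>"
  by (induction rule: ded.induct) auto

lemma ded_mono: "ded T \<Gamma> \<phi> \<Longrightarrow> \<Gamma> \<subseteq> \<Delta> \<Longrightarrow> ded T \<Delta> \<phi>"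
  by (induction rule: ded.induct) (auto intro: ded.intros)

lemma ded_finite: "ded T \<Gamma> \<phi> \<Longrightarrow> \<exists>\<Delta>. finite \<Delta> \<and> \<Delta> \<subseteq> \<Gamma> \<and> ded T \<Delta> \<phi>"
proof (induction rule: ded.induct)
  case (hyp \<phi>)
  then show ?case by (intro exI[of _ "{\<phi>}"]) (auto intro: ded.intros)
next
  case (lift \<phi>)
  then show ?case by (intro exI[of _ "{}"]) (auto intro: ded.intros)
next
  case (mp \<phi> \<psi>)
  then obtain A B where "finite A" "A \<subseteq> \<Gamma>" "ded T A (\<phi> \<^bold>\<longrightarrow> \<psi>)" "finite B" "B \<subseteq> \<Gamma>" "ded T B \<phi>" by blast
  then show ?case
    by (intro exI[of _ "A \<union> B"]) (auto intro: ded.mp ded_mono[where \<Delta> = "A \<union> B"])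
qed

lemma imp_refl: "wf_fm \<phi> \<Longrightarrow> T \<turnstile> (\<phi> \<^bold>\<longrightarrow> \<phi>)"
  by (rule provable.mp[OF provable.mp[OF distr[of \<phi> "\<phi> \<^bold>\<longrightarrow> \<phi>" \<phi>]]]) (auto intro: weaken)

lemma ded_weaken: "ded T \<Gamma> \<phi> \<Longrightarrow> wf_fm \<alpha> \<Longrightarrow> ded T \<Gamma> (\<alpha> \<^bold>\<longrightarrow> \<phi>)"
  by (rule ded.mp[OF ded.lift[OF weaken[of \<phi> \<alpha>]]]) (auto dest: ded_wf)

lemma ded_deduction: "ded T (insert \<alpha> \<Gamma>) \<phi> \<Longrightarrow> wf_fm \<alpha> \<Longrightarrow> ded T \<Gamma> (\<alpha> \<^bold>\<longrightarrow> \<phi>)"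
proof (induction rule: ded.induct)
  case (hyp \<phi>)
  then show ?case by (cases "\<phi> = \<alpha>") (auto intro: ded.hyp ded.lift imp_refl ded_weaken)
next
  case (lift \<phi>)
  then show ?case by (auto intro: ded.lift ded_weaken)
next
  case (mp \<phi> \<psi>)
  have wf: "wf_fm \<phi>" "wf_fm \<psi>" using ded_wf[OF mp.hyps(1)] by auto
  show ?case
    by (rule ded.mp[OF ded.mp[OF ded.lift[OF distr[of \<alpha> \<phi> \<psi>]]]]) (use mp wf in auto)
qed

lemma ded_imp: "ded T \<Gamma> (\<alpha> \<^bold>\<longrightarrow> \<phi>) \<Longrightarrow> ded T (insert \<alpha> \<Gamma>) \<phi>"
proof (rule ded.mp)
  assume *: "ded T \<Gamma> (\<alpha> \<^bold>\<longrightarrow> \<phi>)"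
  then show "ded T (insert \<alpha> \<Gamma>) (\<alpha> \<^bold>\<longrightarrow> \<phi>)" by (rule ded_mono) auto
  show "ded T (insert \<alpha> \<Gamma>) \<alpha>" using ded_wf[OF *] by (auto intro: ded.hyp)
qed

lemma ded_empty: "ded T {} \<phi> \<Longrightarrow> T \<turnstile> \<phi>"
  by (induction rule: ded.induct) (auto intro: provable.mp)

text \<open>Generalisation is available for theorems only. The hypotheses are discharged one after
  the other, the resulting theorem is generalised, and \<open>all_imp\<close> moves the quantifier
  back past each of them; finiteness of \<Gamma> makes this an induction.\<close>

lemma ded_gen: "finite \<Gamma> \<Longrightarrow> ded T \<Gamma> \<psi> \<Longrightarrow> (\<And>\<gamma>. \<gamma> \<in> \<Gamma> \<Longrightarrow> (y, \<sigma>) \<notin> fv \<gamma> \<and> wf_fm \<gamma>) \<Longrightarrow>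
   ded T \<Gamma> (AllV y \<sigma> \<psi>)"
proof (induction arbitrary: \<psi> rule: finite_induct)
  case empty
  show ?case by (rule ded.lift[OF gen[OF ded_empty[OF empty(1)]]]) (simp add: ded_wf[OF empty(1)])
next
  case (insert \<alpha> \<Gamma>)
  have a: "wf_fm \<alpha>" "(y, \<sigma>) \<notin> fv \<alpha>" using insert.prems by auto
  have "ded T \<Gamma> (AllV y \<sigma> (\<alpha> \<^bold>\<longrightarrow> \<psi>))"
    using insert a by (auto intro: ded_deduction)
  then have "ded T \<Gamma> (\<alpha> \<^bold>\<longrightarrow> AllV y \<sigma> \<psi>)"
    by (rule ded.mp[OF ded.lift[OF all_imp], rotated 4]) (use a ded_wf[OF insert.prems(1)] in auto)
  then show ?case by (rule ded_imp)
qed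

lemma provable_trans: "T \<turnstile> (\<phi> \<^bold>\<longrightarrow> \<psi>) \<Longrightarrow> T \<turnstile> (\<psi> \<^bold>\<longrightarrow> \<chi>) \<Longrightarrow> wf_fm \<phi> \<Longrightarrow> wf_fm \<psi> \<Longrightarrow> wf_fm \<chi> \<Longrightarrow> T \<turnstile> (\<phi> \<^bold>\<longrightarrow> \<chi>)"
  by (rule ded_empty, rule ded_deduction,
      rule ded.mp[OF ded.lift[of T "\<psi> \<^bold>\<longrightarrow> \<chi>"]], simp_all, rule ded.mp[OF ded.lift[of T "\<phi> \<^bold>\<longrightarrow> \<psi>"]])
     (auto intro: ded.hyp)

lemma all_rename:
  assumes "wf_fm \<phi>" "vmax (AllV x \<sigma> \<phi>) < y"
  shows "T \<turnstile> (AllV y \<sigma> (subst_fm x \<sigma> (Var y \<sigma>) \<phi>) \<^bold>\<longrightarrow> AllV x \<sigma> \<phi>)"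
    and "T \<turnstile> (AllV x \<sigma> \<phi> \<^bold>\<longrightarrow> AllV y \<sigma> (subst_fm x \<sigma> (Var y \<sigma>) \<phi>))"
proof -
  let ?\<psi> = "subst_fm x \<sigma> (Var y \<sigma>) \<phi>"
  have wf: "wf_fm ?\<psi>" using assms by (auto intro: wf_subst_fm)
  have y: "vmax \<phi> < y" "x \<noteq> y" using assms by auto
  have "T \<turnstile> (AllV y \<sigma> ?\<psi> \<^bold>\<longrightarrow> subst_fm y \<sigma> (Var x \<sigma>) ?\<psi>)"
    by (rule inst) (use wf y in \<open>auto intro: free_for_back\<close>)
  then have "T \<turnstile> AllV x \<sigma> (AllV y \<sigma> ?\<psi> \<^bold>\<longrightarrow> \<phi>)"
    using y by (intro gen) (simp add: subst_fm_back)
  then show "T \<turnstile> (AllV y \<sigma> ?\<psi> \<^bold>\<longrightarrow> AllV x \<sigma> \<phi>)"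
    by (rule provable.mp[OF all_imp, rotated 3]) (use wf assms fv_rename[OF y(2)] in auto)
  have "T \<turnstile> (AllV x \<sigma> \<phi> \<^bold>\<longrightarrow> ?\<psi>)"
    by (rule inst) (use assms y in \<open>auto intro: free_for_fresh_var\<close>)
  then have "T \<turnstile> AllV y \<sigma> (AllV x \<sigma> \<phi> \<^bold>\<longrightarrow> ?\<psi>)" by (rule gen)
  then show "T \<turnstile> (AllV x \<sigma> \<phi> \<^bold>\<longrightarrow> AllV y \<sigma> ?\<psi>)"
    by (rule provable.mp[OF all_imp, rotated 3]) (use wf assms y vmax_fv[of y \<sigma> \<phi>] in auto)
qed

lemma all_mono:
  assumes "T \<turnstile> (\<phi> \<^bold>\<longrightarrow> \<psi>)" "wf_fm \<phi>" "wf_fm \<psi>"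
  shows "T \<turnstile> (AllV x \<sigma> \<phi> \<^bold>\<longrightarrow> AllV x \<sigma> \<psi>)"
proof -
  have ff: "free_for (Var x \<sigma>) x \<sigma> \<phi>" for \<phi> by (induction \<phi>) auto
  have st: "subst_tm x \<sigma> (Var x \<sigma>) t = t" for t by (induction t) auto
  have ss: "subst_fm x \<sigma> (Var x \<sigma>) \<phi> = \<phi>" for \<phi> by (induction \<phi>) (auto simp: st)
  have "T \<turnstile> (AllV x \<sigma> \<phi> \<^bold>\<longrightarrow> \<phi>)"
    using inst[of \<phi> "Var x \<sigma>" \<sigma> x T] assms ff ss by simp
  then have "T \<turnstile> AllV x \<sigma> (AllV x \<sigma> \<phi> \<^bold>\<longrightarrow> \<psi>)"
    by (intro gen provable_trans[OF _ assms(1)]) (use assms in auto)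
  then show ?thesis
    by (rule provable.mp[OF all_imp, rotated 3]) (use assms in auto)
qed

lemma imp_mono:
  assumes "T \<turnstile> (\<phi>' \<^bold>\<longrightarrow> \<phi>)" "T \<turnstile> (\<psi> \<^bold>\<longrightarrow> \<psi>')" "wf_fm \<phi>" "wf_fm \<psi>" "wf_fm \<phi>'" "wf_fm \<psi>'"
  shows "T \<turnstile> ((\<phi> \<^bold>\<longrightarrow> \<psi>) \<^bold>\<longrightarrow> (\<phi>' \<^bold>\<longrightarrow> \<psi>'))"
proof (rule ded_empty, rule ded_deduction, rule ded_deduction)
  let ?\<Gamma> = "{\<phi>', \<phi> \<^bold>\<longrightarrow> \<psi>}"
  have 1: "ded T ?\<Gamma> \<phi>" by (rule ded.mp[OF ded.lift[OF assms(1)]]) (use assms in \<open>auto intro: ded.hyp\<close>)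
  have "ded T ?\<Gamma> \<psi>" by (rule ded.mp[OF ded.hyp 1]) (use assms in auto)
  then show "ded T ?\<Gamma> \<psi>'" by (rule ded.mp[OF ded.lift[OF assms(2)], rotated]) (use assms in auto)
qed (use assms in auto)

section \<open>Structures\<close>

text \<open>Equality is a parameter because the same semantics serves two structures: the term
  model, where it is membership of the equation in a maximal consistent set, and the quotient, where
  it is identity.\<close>

locale fo_structure =
  fixes D :: "ty \<Rightarrow> 'a set" and ap :: "'a \<Rightarrow> 'a \<Rightarrow> 'a" and cn :: "tm \<Rightarrow> 'a"
    and eq le :: "'a \<Rightarrow> 'a \<Rightarrow> bool"
begin

fun ev :: "(nat \<times> ty \<Rightarrow> 'a) \<Rightarrow> tm \<Rightarrow> 'a" where
  "ev e (Var x \<sigma>) = e (x, \<sigma>)"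
| "ev e (App t u) = ap (ev e t) (ev e u)"
| "ev e t = cn t"

fun sat :: "(nat \<times> ty \<Rightarrow> 'a) \<Rightarrow> fm \<Rightarrow> bool" where
  "sat e Fls \<longleftrightarrow> False"
| "sat e (Eq t u) \<longleftrightarrow> eq (ev e t) (ev e u)"
| "sat e (Less t u) \<longleftrightarrow> le (ev e t) (ev e u)"
| "sat e (Imp \<phi> \<psi>) \<longleftrightarrow> (sat e \<phi> \<longrightarrow> sat e \<psi>)"
| "sat e (AllV x \<sigma> \<phi>) \<longleftrightarrow> (\<forall>d\<in>D \<sigma>. sat (e((x, \<sigma>) := d)) \<phi>)"

definition valid :: "(nat \<times> ty \<Rightarrow> 'a) \<Rightarrow> bool" where
  "valid e \<longleftrightarrow> (\<forall>x \<sigma>. e (x, \<sigma>) \<in> D \<sigma>)"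

lemma valid_upd [intro]: "valid e \<Longrightarrow> d \<in> D \<sigma> \<Longrightarrow> valid (e((x, \<sigma>) := d))"
  by (auto simp: valid_def)

lemma ev_cong: "(\<And>v. v \<in> fv_tm t \<Longrightarrow> e v = e' v) \<Longrightarrow> ev e t = ev e' t"
  by (induction t) auto

lemma sat_cong: "(\<And>v. v \<in> fv \<phi> \<Longrightarrow> e v = e' v) \<Longrightarrow> sat e \<phi> = sat e' \<phi>"
proof (induction \<phi> arbitrary: e e')
  case (Eq t u)
  then show ?case using ev_cong[of t e e'] ev_cong[of u e e'] by auto
next
  case (Less t u)
  then show ?case using ev_cong[of t e e'] ev_cong[of u e e'] by auto
next
  case (Imp \<phi> \<psi>)
  have "sat e \<phi> = sat e' \<phi>" by (rule Imp) (simp add: Imp.prems)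
  moreover have "sat e \<psi> = sat e' \<psi>" by (rule Imp) (simp add: Imp.prems)
  ultimately show ?case by simp
next
  case (AllV x \<sigma> \<phi>)
  have "sat (e((x, \<sigma>) := d)) \<phi> = sat (e'((x, \<sigma>) := d)) \<phi>" for d
    by (rule AllV) (use AllV.prems in auto)
  then show ?case by simp
qed auto

lemma ev_subst: "ev e (subst_tm x \<sigma> s t) = ev (e((x, \<sigma>) := ev e s)) t"
  by (induction t) auto

lemma sat_subst: "free_for s x \<sigma> \<phi> \<Longrightarrow> sat e (subst_fm x \<sigma> s \<phi>) = sat (e((x, \<sigma>) := ev e s)) \<phi>"
proof (induction \<phi> arbitrary: e)
  case (AllV y \<tau> \<phi>)
  show ?case
  proof (cases "(x, \<sigma>) \<in> fv (AllV y \<tau> \<phi>)")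
    case False
    have "sat (e((x, \<sigma>) := ev e s)) (AllV y \<tau> \<phi>) = sat e (AllV y \<tau> \<phi>)"
      by (rule sat_cong) (use False in auto)
    then show ?thesis by (metis False subst_fm_fresh)
  next
    case True
    then have ne: "(y, \<tau>) \<noteq> (x, \<sigma>)" and y: "(y, \<tau>) \<notin> fv_tm s" and ff: "free_for s x \<sigma> \<phi>"
      using AllV.prems by auto
    have "ev (e((y, \<tau>) := d)) s = ev e s" for d by (rule ev_cong) (use y in auto)
    then have "sat (e((y, \<tau>) := d)) (subst_fm x \<sigma> s \<phi>) = sat (e((x, \<sigma>) := ev e s, (y, \<tau>) := d)) \<phi>" for d
      unfolding AllV.IH[OF ff] by (simp only: fun_upd_twist[OF ne])
    then show ?thesis by (simp only: subst_fm.simps sat.simps if_not_P[OF ne])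
  qed
qed (auto simp: ev_subst)

text \<open>Substitution does not rename bound variables, so the truth lemma passes to such a variant
  before it substitutes a term.\<close>

lemma rename_apart:
  "wf_fm \<phi> \<Longrightarrow> \<exists>\<phi>'. wf_fm \<phi>' \<and> (\<forall>T. T \<turnstile> (\<phi> \<^bold>\<longrightarrow> \<phi>')) \<and> (\<forall>T. T \<turnstile> (\<phi>' \<^bold>\<longrightarrow> \<phi>)) \<and> (\<forall>e. sat e \<phi>' = sat e \<phi>) \<and>
     fsize \<phi>' = fsize \<phi> \<and> (\<forall>y\<in>bvs \<phi>'. B < y)"
proof (induction \<phi>)
  case (Imp \<phi> \<psi>)
  then obtain \<phi>' \<psi>' where
    "wf_fm \<phi>' \<and> (\<forall>T. T \<turnstile> (\<phi> \<^bold>\<longrightarrow> \<phi>')) \<and> (\<forall>T. T \<turnstile> (\<phi>' \<^bold>\<longrightarrow> \<phi>)) \<and> (\<forall>e. sat e \<phi>' = sat e \<phi>) \<and>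
      fsize \<phi>' = fsize \<phi> \<and> (\<forall>y\<in>bvs \<phi>'. B < y)"
    "wf_fm \<psi>' \<and> (\<forall>T. T \<turnstile> (\<psi> \<^bold>\<longrightarrow> \<psi>')) \<and> (\<forall>T. T \<turnstile> (\<psi>' \<^bold>\<longrightarrow> \<psi>)) \<and> (\<forall>e. sat e \<psi>' = sat e \<psi>) \<and>
      fsize \<psi>' = fsize \<psi> \<and> (\<forall>y\<in>bvs \<psi>'. B < y)"
    by auto
  then show ?case using Imp.prems
    by (intro exI[of _ "\<phi>' \<^bold>\<longrightarrow> \<psi>'"]) (auto intro!: imp_mono)
next
  case (AllV x \<sigma> \<phi>)
  then obtain \<phi>' where \<phi>':
    "wf_fm \<phi>'" "\<And>T. T \<turnstile> (\<phi> \<^bold>\<longrightarrow> \<phi>')" "\<And>T. T \<turnstile> (\<phi>' \<^bold>\<longrightarrow> \<phi>)" "\<And>e. sat e \<phi>' = sat e \<phi>"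
      "fsize \<phi>' = fsize \<phi>" "\<And>y. y\<in>bvs \<phi>' \<Longrightarrow> B < y"
    by auto
  define y where "y = Suc (max B (vmax (AllV x \<sigma> \<phi>')))"
  have y: "vmax (AllV x \<sigma> \<phi>') < y" "B < y" by (auto simp: y_def)
  let ?\<psi> = "AllV y \<sigma> (subst_fm x \<sigma> (Var y \<sigma>) \<phi>')"
  have wf: "wf_fm \<phi>" "wf_fm (subst_fm x \<sigma> (Var y \<sigma>) \<phi>')"
    using AllV.prems \<phi>' by (auto intro: wf_subst_fm)
  have "T \<turnstile> (AllV x \<sigma> \<phi> \<^bold>\<longrightarrow> ?\<psi>)" for T
    by (rule provable_trans[OF all_mono[OF \<phi>'(2)] all_rename(2)]) (use wf \<phi>' y in auto)
  moreover have "T \<turnstile> (?\<psi> \<^bold>\<longrightarrow> AllV x \<sigma> \<phi>)" for T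
    by (rule provable_trans[OF all_rename(1) all_mono[OF \<phi>'(3)]]) (use wf \<phi>' y in auto)
  moreover have "sat (e((y, \<sigma>) := d)) (subst_fm x \<sigma> (Var y \<sigma>) \<phi>') = sat (e((x, \<sigma>) := d)) \<phi>" for e d
  proof -
    have "sat (e((y, \<sigma>) := d)) (subst_fm x \<sigma> (Var y \<sigma>) \<phi>') = sat (e((y, \<sigma>) := d, (x, \<sigma>) := d)) \<phi>'"
      by (subst sat_subst) (use y in \<open>auto intro: free_for_fresh_var\<close>)
    also have "\<dots> = sat (e((x, \<sigma>) := d)) \<phi>'"
      by (rule sat_cong) (use y vmax_fv[of y \<sigma> \<phi>'] in auto)
    finally show ?thesis using \<phi>' by simp
  qed
  ultimately show ?case using wf \<phi>' y by (intro exI[of _ ?\<psi>]) auto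
next
  case Fls
  then show ?case by (intro exI[of _ Fls]) (auto intro: imp_refl)
next
  case (Eq t u)
  then show ?case by (intro exI[of _ "Eq t u"]) (auto intro: imp_refl)
next
  case (Less t u)
  then show ?case by (intro exI[of _ "Less t u"]) (auto intro: imp_refl)
qed

end

section \<open>Maximal consistent sets with witnesses\<close>

definition cons :: "fm set \<Rightarrow> fm set \<Rightarrow> bool" where
  "cons T \<Gamma> \<longleftrightarrow> \<not> ded T \<Gamma> Fls"

lemma cons_mono: "cons T \<Delta> \<Longrightarrow> \<Gamma> \<subseteq> \<Delta> \<Longrightarrow> cons T \<Gamma>"
  by (auto simp: cons_def dest: ded_mono)

lemma not_cons_neg: "\<not> cons T (insert \<phi> \<Gamma>) \<Longrightarrow> wf_fm \<phi> \<Longrightarrow> ded T \<Gamma> (FNeg \<phi>)"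
  by (auto simp: cons_def FNeg_def intro: ded_deduction)

lemma not_cons_pos: "\<not> cons T (insert (FNeg \<phi>) \<Gamma>) \<Longrightarrow> wf_fm \<phi> \<Longrightarrow> ded T \<Gamma> \<phi>"
  by (rule ded.mp[OF ded.lift[OF dneg[of \<phi>]]]) (auto intro: not_cons_neg)

lemma ded_contra: "ded T \<Gamma> (FNeg \<phi>) \<Longrightarrow> ded T \<Gamma> \<phi> \<Longrightarrow> ded T \<Gamma> Fls"
  unfolding FNeg_def by (rule ded.mp)

text \<open>Variables serve as Henkin constants. At a finite stage there is always one whose index
  exceeds all indices in use, so the language is not extended.\<close>

fun witness :: "fm set \<Rightarrow> fm \<Rightarrow> fm set" where
  "witness \<Gamma> (Imp (AllV x \<sigma> \<psi>) Fls) =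
     {FNeg (subst_fm x \<sigma> (Var (Suc (Max (vmax ` insert (AllV x \<sigma> \<psi>) \<Gamma>))) \<sigma>) \<psi>)}"
| "witness \<Gamma> _ = {}"

definition fine :: "fm set \<Rightarrow> fm set \<Rightarrow> bool" where
  "fine T \<Gamma> \<longleftrightarrow> finite \<Gamma> \<and> (\<forall>\<gamma>\<in>\<Gamma>. wf_fm \<gamma>) \<and> cons T \<Gamma>"

text \<open>If the counterexample were inconsistent with \<Gamma>, the instance at the fresh
  variable would follow from \<Gamma>; since \<Gamma> does not mention that variable, the instance
  could be generalised and would contradict the negated universal formula in \<Gamma>.\<close>

lemma fine_witness:
  assumes "fine T \<Gamma>" "FNeg (AllV x \<sigma> \<psi>) \<in> \<Gamma>"
  shows "fine T (witness \<Gamma> (FNeg (AllV x \<sigma> \<psi>)) \<union> \<Gamma>)"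
proof -
  define y where "y = Suc (Max (vmax ` insert (AllV x \<sigma> \<psi>) \<Gamma>))"
  have fin: "finite \<Gamma>" and wf\<Gamma>: "\<And>\<gamma>. \<gamma> \<in> \<Gamma> \<Longrightarrow> wf_fm \<gamma>" and con: "cons T \<Gamma>"
    using assms by (auto simp: fine_def)
  have y: "vmax \<gamma> < y" if "\<gamma> \<in> insert (AllV x \<sigma> \<psi>) \<Gamma>" for \<gamma>
    unfolding y_def less_Suc_eq_le by (rule Max_ge) (use that fin in auto)
  have wf: "wf_fm \<psi>" using wf\<Gamma>[OF assms(2)] by simp
  let ?\<psi> = "subst_fm x \<sigma> (Var y \<sigma>) \<psi>"
  have wf': "wf_fm ?\<psi>" using wf by (auto intro: wf_subst_fm)
  have "cons T (insert (FNeg ?\<psi>) \<Gamma>)"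
  proof (rule ccontr)
    assume "\<not> ?thesis"
    then have "ded T \<Gamma> ?\<psi>" using wf' by (rule not_cons_pos)
    then have "ded T \<Gamma> (AllV y \<sigma> ?\<psi>)"
      using fin wf\<Gamma> y by (intro ded_gen) (fastforce dest: vmax_fv)+
    then have "ded T \<Gamma> (AllV x \<sigma> \<psi>)"
      by (rule ded.mp[OF ded.lift[OF all_rename(1)], rotated 3]) (use wf wf' y[of "AllV x \<sigma> \<psi>"] in auto)
    then have "ded T \<Gamma> Fls"
      by (rule ded_contra[OF ded.hyp[OF assms(2)], rotated]) (use wf in auto)
    then show False using con by (simp add: cons_def)
  qed
  moreover have "witness \<Gamma> (FNeg (AllV x \<sigma> \<psi>)) = {FNeg ?\<psi>}"
    by (simp add: FNeg_def y_def)
  ultimately show ?thesis using fin wf\<Gamma> wf' by (auto simp: fine_def)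
qed

text \<open>A negation added in the last case gets no witness at this stage; it gets one at the
  stage at which the negation itself is enumerated.\<close>

definition step :: "fm set \<Rightarrow> fm set \<Rightarrow> fm \<Rightarrow> fm set" where
  "step T \<Gamma> \<phi> =
     (if \<not> wf_fm \<phi> then \<Gamma>
      else if cons T (insert \<phi> \<Gamma>) then witness (insert \<phi> \<Gamma>) \<phi> \<union> insert \<phi> \<Gamma>
      else insert (FNeg \<phi>) \<Gamma>)"

lemma step_fine:
  assumes "fine T \<Gamma>"
  shows "fine T (step T \<Gamma> \<phi>)"
proof -
  consider "\<not> wf_fm \<phi>" | "wf_fm \<phi>" "cons T (insert \<phi> \<Gamma>)" | "wf_fm \<phi>" "\<not> cons T (insert \<phi> \<Gamma>)" by blast
  then show ?thesis
  proof cases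
    case 1
    then show ?thesis using assms by (simp add: step_def)
  next
    case 2
    have *: "fine T (insert \<phi> \<Gamma>)" using 2 assms by (simp add: fine_def)
    have "fine T (witness (insert \<phi> \<Gamma>) \<phi> \<union> insert \<phi> \<Gamma>)"
    proof (cases "witness (insert \<phi> \<Gamma>) \<phi> = {}")
      case False
      then obtain x \<sigma> \<psi> where "\<phi> = FNeg (AllV x \<sigma> \<psi>)"
        unfolding FNeg_def by (cases "(insert \<phi> \<Gamma>, \<phi>)" rule: witness.cases) auto
      then show ?thesis using fine_witness[OF *] by auto
    qed (use * in simp)
    then show ?thesis using 2 by (simp add: step_def)
  next
    case 3
    have "cons T (insert (FNeg \<phi>) \<Gamma>)"
    proof (rule ccontr)
      assume "\<not> ?thesis"
      then have "ded T \<Gamma> \<phi>" using 3 by (auto intro: not_cons_pos)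
      then have "ded T \<Gamma> Fls" using not_cons_neg[OF 3(2,1)] by (auto intro: ded_contra)
      then show False using assms by (simp add: fine_def cons_def)
    qed
    then show ?thesis using 3 assms by (simp add: step_def fine_def)
  qed
qed

primrec chain :: "fm set \<Rightarrow> fm set \<Rightarrow> nat \<Rightarrow> fm set" where
  "chain T \<Gamma> 0 = \<Gamma>"
| "chain T \<Gamma> (Suc n) = step T (chain T \<Gamma> n) (from_nat n)"

lemma chain_fine: "fine T \<Gamma> \<Longrightarrow> fine T (chain T \<Gamma> n)"
  by (induction n) (auto intro: step_fine)

lemma chain_mono: "m \<le> n \<Longrightarrow> chain T \<Gamma> m \<subseteq> chain T \<Gamma> n"
  by (induction n rule: dec_induct) (auto simp: step_def)

text \<open>The index of the witnessing variable exceeds all indices of \<psi>, so substituting it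
  captures nothing and the semantic substitution lemma applies.\<close>

locale henkin =
  fixes T G :: "fm set"
  assumes G_wf: "\<phi> \<in> G \<Longrightarrow> wf_fm \<phi>"
    and G_cons: "cons T G"
    and G_max: "wf_fm \<phi> \<Longrightarrow> \<phi> \<in> G \<or> FNeg \<phi> \<in> G"
    and G_wit: "FNeg (AllV x \<sigma> \<psi>) \<in> G \<Longrightarrow> \<exists>y>vmax \<psi>. FNeg (subst_fm x \<sigma> (Var y \<sigma>) \<psi>) \<in> G"

lemma henkin_exists:
  assumes "wf_fm \<chi>" "\<not> (T \<turnstile> \<chi>)"
  shows "\<exists>G. henkin T G \<and> FNeg \<chi> \<in> G"
proof -
  have "cons T {FNeg \<chi>}"
    using not_cons_pos[of T \<chi> "{}"] assms ded_empty by blast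
  then have fine0: "fine T {FNeg \<chi>}" using assms by (simp add: fine_def)
  define C where "C = chain T {FNeg \<chi>}"
  define G where "G = (\<Union>n. C n)"
  have fine: "fine T (C n)" for n unfolding C_def by (rule chain_fine[OF fine0])
  have C_step: "C (Suc n) = step T (C n) (from_nat n)" for n by (simp add: C_def)
  have mono: "C m \<subseteq> C n" if "m \<le> n" for m n unfolding C_def by (rule chain_mono[OF that])
  have stage: "C (Suc (to_nat \<phi>)) = step T (C (to_nat \<phi>)) \<phi>" for \<phi> by (simp add: C_step)
  have sub: "\<exists>n. \<Delta> \<subseteq> C n" if "finite \<Delta>" "\<Delta> \<subseteq> G" for \<Delta>
    using that
  proof (induction rule: finite_induct)
    case (insert \<phi> \<Delta>)
    then obtain m n where "\<Delta> \<subseteq> C m" "\<phi> \<in> C n" by (auto simp: G_def)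
    then have "insert \<phi> \<Delta> \<subseteq> C (max m n)" using mono[of m "max m n"] mono[of n "max m n"] by auto
    then show ?case by blast
  qed simp
  have "henkin T G"
  proof
    show Gwf: "wf_fm \<phi>" if "\<phi> \<in> G" for \<phi> using that fine by (auto simp: G_def fine_def)
    show con: "cons T G"
      unfolding cons_def
    proof
      assume "ded T G Fls"
      then obtain \<Delta> where \<Delta>: "finite \<Delta>" "\<Delta> \<subseteq> G" "ded T \<Delta> Fls"
        using ded_finite[of T G Fls] by auto
      then obtain n where "\<Delta> \<subseteq> C n" using sub by metis
      then have "ded T (C n) Fls" using ded_mono[OF \<Delta>(3)] by simp
      then show False using fine[of n] by (simp add: fine_def cons_def)
    qed
    show "\<phi> \<in> G \<or> FNeg \<phi> \<in> G" if "wf_fm \<phi>" for \<phi>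
    proof -
      have "\<phi> \<in> C (Suc (to_nat \<phi>)) \<or> FNeg \<phi> \<in> C (Suc (to_nat \<phi>))"
        unfolding stage step_def using that by auto
      then show ?thesis by (auto simp: G_def)
    qed
    show "\<exists>y>vmax \<psi>. FNeg (subst_fm x \<sigma> (Var y \<sigma>) \<psi>) \<in> G" if "FNeg (AllV x \<sigma> \<psi>) \<in> G" for x \<sigma> \<psi>
    proof -
      let ?\<phi> = "FNeg (AllV x \<sigma> \<psi>)"
      let ?C = "C (to_nat ?\<phi>)"
      \<comment> \<open>Whatever the order of the enumeration, the formula passes the consistency
        test at its own stage, because everything tested there lies in the consistent set
        \<open>G\<close>.\<close>
      have "insert ?\<phi> ?C \<subseteq> G" using that by (auto simp: G_def)
      then have "cons T (insert ?\<phi> ?C)" using con by (rule cons_mono[rotated])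
      moreover have "wf_fm ?\<phi>" by (rule Gwf[OF that])
      ultimately have "witness (insert ?\<phi> ?C) ?\<phi> \<subseteq> C (Suc (to_nat ?\<phi>))"
        unfolding stage step_def by auto
      then have "witness (insert ?\<phi> ?C) ?\<phi> \<subseteq> G" by (auto simp: G_def)
      moreover have "vmax \<psi> < Suc (Max (vmax ` insert (AllV x \<sigma> \<psi>) (insert ?\<phi> ?C)))"
      proof -
        have "vmax (AllV x \<sigma> \<psi>) \<le> Max (vmax ` insert (AllV x \<sigma> \<psi>) (insert ?\<phi> ?C))"
          by (rule Max_ge) (use fine[of "to_nat ?\<phi>"] in \<open>auto simp: fine_def\<close>)
        then show ?thesis by simp
      qed
      ultimately show ?thesis unfolding FNeg_def witness.simps by blast
    qed
  qed
  moreover have "FNeg \<chi> \<in> G" by (auto simp: G_def C_def intro!: exI[of _ 0])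
  ultimately show ?thesis by blast
qed

section \<open>The term model\<close>

definition tms :: "ty \<Rightarrow> tm set" where
  "tms \<sigma> = {t. wf_tm t \<and> ty_of t = \<sigma>}"

definition Vr :: "nat \<times> ty \<Rightarrow> tm" where
  "Vr v = Var (fst v) (snd v)"

lemma Vr_simp [simp]: "Vr (x, \<sigma>) = Var x \<sigma>"
  by (simp add: Vr_def)

context henkin
begin

interpretation raw: fo_structure tms App "\<lambda>t. t" "\<lambda>s t. Eq s t \<in> G" "\<lambda>s t. Less s t \<in> G" .

lemma G_ded: "ded T G \<phi> \<Longrightarrow> \<phi> \<in> G"
proof -
  assume *: "ded T G \<phi>"
  have "FNeg \<phi> \<notin> G"
    using ded_contra[OF ded.hyp *] G_cons G_wf unfolding cons_def by blast
  then show "\<phi> \<in> G" using G_max[OF ded_wf[OF *]] by blast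
qed

lemma G_thm: "T \<turnstile> \<phi> \<Longrightarrow> wf_fm \<phi> \<Longrightarrow> \<phi> \<in> G"
  by (intro G_ded ded.lift)

lemma G_mp: "(\<phi> \<^bold>\<longrightarrow> \<psi>) \<in> G \<Longrightarrow> \<phi> \<in> G \<Longrightarrow> \<psi> \<in> G"
proof -
  assume *: "(\<phi> \<^bold>\<longrightarrow> \<psi>) \<in> G" "\<phi> \<in> G"
  show "\<psi> \<in> G" by (rule G_ded, rule ded.mp[OF ded.hyp[OF *(1)] ded.hyp[OF *(2)]]) (use G_wf[OF *(1)] in auto)
qed

lemma G_neg: "wf_fm \<phi> \<Longrightarrow> FNeg \<phi> \<in> G \<longleftrightarrow> \<phi> \<notin> G"
  using G_max[of \<phi>] ded_contra[OF ded.hyp ded.hyp, of \<phi> G T] G_cons unfolding cons_def by auto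

lemma G_imp: "wf_fm \<phi> \<Longrightarrow> wf_fm \<psi> \<Longrightarrow> (\<phi> \<^bold>\<longrightarrow> \<psi>) \<in> G \<longleftrightarrow> (\<phi> \<in> G \<longrightarrow> \<psi> \<in> G)"
proof
  assume wf: "wf_fm \<phi>" "wf_fm \<psi>" and *: "\<phi> \<in> G \<longrightarrow> \<psi> \<in> G"
  show "(\<phi> \<^bold>\<longrightarrow> \<psi>) \<in> G"
  proof (cases "\<phi> \<in> G")
    case True
    then show ?thesis using wf * by (auto intro: G_ded[OF ded_weaken[OF ded.hyp]])
  next
    case False
    then have "FNeg \<phi> \<in> G" using wf by (simp add: G_neg)
    then have n: "ded T G (FNeg \<phi>)" using wf by (intro ded.hyp) simp_all
    have "ded T (insert \<phi> G) \<phi>" using wf by (intro ded.hyp) simp_all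
    then have "ded T (insert \<phi> G) Fls"
      by (rule ded_contra[OF ded_mono[OF n subset_insertI[of G \<phi>]]])
    then have "ded T (insert (FNeg \<psi>) (insert \<phi> G)) Fls" by (rule ded_mono) auto
    then have "ded T (insert \<phi> G) \<psi>" using wf by (intro not_cons_pos) (auto simp: cons_def)
    then show ?thesis using wf by (auto intro: G_ded[OF ded_deduction])
  qed
next
  assume "(\<phi> \<^bold>\<longrightarrow> \<psi>) \<in> G"
  then show "\<phi> \<in> G \<longrightarrow> \<psi> \<in> G" using G_mp by blast
qed

lemma ev_raw: "raw.ev Vr t = t"
  by (induction t) auto

lemma truth: "wf_fm \<phi> \<Longrightarrow> raw.sat Vr \<phi> \<longleftrightarrow> \<phi> \<in> G"
proof (induction "fsize \<phi>" arbitrary: \<phi> rule: less_induct)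
  case less
  show ?case
  proof (cases \<phi>)
    case Fls
    then show ?thesis using G_cons ded.hyp[of Fls G T] by (auto simp: cons_def)
  next
    case (Eq t u)
    then show ?thesis by (simp add: ev_raw)
  next
    case (Less t u)
    then show ?thesis by (simp add: ev_raw)
  next
    case (Imp \<alpha> \<beta>)
    then have "raw.sat Vr \<alpha> \<longleftrightarrow> \<alpha> \<in> G" "raw.sat Vr \<beta> \<longleftrightarrow> \<beta> \<in> G"
      using less by auto
    then show ?thesis using less.prems Imp by (simp add: G_imp)
  next
    case (AllV x \<sigma> \<psi>)
    have wf: "wf_fm \<psi>" using less.prems AllV by simp
    show ?thesis
    proof
      assume sat: "raw.sat Vr \<phi>"
      show "\<phi> \<in> G"
      proof (rule ccontr)
        assume "\<phi> \<notin> G"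
        then have "FNeg (AllV x \<sigma> \<psi>) \<in> G" using AllV less.prems by (simp add: G_neg)
        then obtain y where y: "vmax \<psi> < y" and "FNeg (subst_fm x \<sigma> (Var y \<sigma>) \<psi>) \<in> G" using G_wit by blast
        then have "subst_fm x \<sigma> (Var y \<sigma>) \<psi> \<notin> G" using wf by (simp add: G_neg wf_subst_fm)
        moreover have "raw.sat Vr (subst_fm x \<sigma> (Var y \<sigma>) \<psi>) \<longleftrightarrow> subst_fm x \<sigma> (Var y \<sigma>) \<psi> \<in> G"
          by (rule less.hyps) (use AllV wf wf_subst_fm in auto)
        moreover have "raw.sat Vr (subst_fm x \<sigma> (Var y \<sigma>) \<psi>)"
          using raw.sat_subst[OF free_for_fresh_var[OF y], of Vr] sat AllV
          by (simp add: ev_raw tms_def)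
        ultimately show False by blast
      qed
    next
      assume \<phi>: "\<phi> \<in> G"
      show "raw.sat Vr \<phi>"
        unfolding AllV raw.sat.simps
      proof
        fix t assume "t \<in> tms \<sigma>"
        then have t: "wf_tm t" "ty_of t = \<sigma>" by (auto simp: tms_def)
        obtain \<psi>' where \<psi>': "wf_fm \<psi>'" "\<And>T. T \<turnstile> (\<psi> \<^bold>\<longrightarrow> \<psi>')" "\<And>e. raw.sat e \<psi>' = raw.sat e \<psi>"
          "fsize \<psi>' = fsize \<psi>" "\<forall>z\<in>bvs \<psi>'. vmax_tm t < z"
          using raw.rename_apart[OF wf, of "vmax_tm t"] by blast
        have ff: "free_for t x \<sigma> \<psi>'" by (rule free_for_bvs) (use \<psi>' in auto)
        have "AllV x \<sigma> \<psi>' \<in> G"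
          by (rule G_mp[OF G_thm[OF all_mono[OF \<psi>'(2)]]]) (use wf \<psi>' \<phi> AllV in auto)
        then have "subst_fm x \<sigma> t \<psi>' \<in> G"
          by (rule G_mp[OF G_thm[OF inst], rotated -1]) (use t ff \<psi>' wf_subst_fm in auto)
        moreover have "raw.sat Vr (subst_fm x \<sigma> t \<psi>') \<longleftrightarrow> subst_fm x \<sigma> t \<psi>' \<in> G"
          by (rule less.hyps) (use AllV \<psi>' t wf_subst_fm in auto)
        ultimately show "raw.sat (Vr((x, \<sigma>) := t)) \<psi>"
          using raw.sat_subst[OF ff, of Vr] \<psi>' by (simp add: ev_raw)
      qed
    qed
  qed
qed

end

section \<open>Evaluating formulas with binders\<close>

text \<open>Assignments below are long chains of updates. A lookup should be resolved by comparing
  variables, not by unfolding every update into a case distinction.\<close>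

declare fun_upd_apply [simp del] fun_upd_same [simp] fun_upd_other [simp]

text \<open>At higher types the two terms sit under binders of the defined equality. This bound
  recovers, from an index above the whole formula, that it is fresh for both terms.\<close>

lemma vmax_EqT: "max (vmax_tm s) (vmax_tm t) \<le> vmax (EqT \<tau> s t)"
proof (induction \<tau> arbitrary: s t)
  case (TyFun \<sigma> \<tau>)
  show ?case
    using TyFun(2)[of "s \<cdot> Var (Suc (vmax (EqT \<tau> (s \<cdot> Zero) (t \<cdot> Zero)))) \<sigma>" "t \<cdot> Var (Suc (vmax (EqT \<tau> (s \<cdot> Zero) (t \<cdot> Zero)))) \<sigma>"]
    by (simp add: Forall_def Let_def)
qed simp

lemma vmax_EqT_less: "vmax (EqT \<tau> s t) < x \<Longrightarrow> vmax_tm s < x \<and> vmax_tm t < x"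
  using vmax_EqT[of s t \<tau>] by simp

lemma wf_EqT: "wf_tm s \<Longrightarrow> wf_tm t \<Longrightarrow> ty_of s = \<tau> \<Longrightarrow> ty_of t = \<tau> \<Longrightarrow> wf_fm (EqT \<tau> s t)"
  by (induction \<tau> arbitrary: s t) (auto simp: Forall_def Let_def)

lemma vmax_Forall_less:
  "vmax (Forall \<sigma> F) < x \<longleftrightarrow> Suc (vmax (F Zero)) < x \<and> vmax (F (Var (Suc (vmax (F Zero))) \<sigma>)) < x"
  by (simp add: Forall_def Let_def)

lemma wf_Forall: "(\<And>x. wf_fm (F (Var x \<sigma>))) \<Longrightarrow> wf_fm (Forall \<sigma> F)"
  by (simp add: Forall_def Let_def)

context fo_structure
begin

lemma ev_fresh [simp]: "vmax_tm t < x \<Longrightarrow> ev (e((x, \<sigma>) := d)) t = ev e t"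
  by (rule ev_cong) (auto dest: vmax_tm_fv)

text \<open>The body is evaluated at an arbitrary index beyond those of \<open>F Zero\<close>, so
  that no later argument has to compute the index that \<open>Forall\<close> picks.\<close>

lemma sat_Forall:
  assumes "\<And>x d. vmax (F Zero) < x \<Longrightarrow> d \<in> D \<sigma> \<Longrightarrow> sat (e((x, \<sigma>) := d)) (F (Var x \<sigma>)) \<longleftrightarrow> P d"
  shows "sat e (Forall \<sigma> F) \<longleftrightarrow> (\<forall>d\<in>D \<sigma>. P d)"
  using assms by (simp add: Forall_def Let_def)

fun eqv :: "ty \<Rightarrow> 'a \<Rightarrow> 'a \<Rightarrow> bool" where
  "eqv TyN a b \<longleftrightarrow> eq a b"
| "eqv (\<sigma> \<Rrightarrow> \<tau>) a b \<longleftrightarrow> (\<forall>c\<in>D \<sigma>. eqv \<tau> (ap a c) (ap b c))"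

lemma sat_EqT: "sat e (EqT \<tau> s t) \<longleftrightarrow> eqv \<tau> (ev e s) (ev e t)"
proof (induction \<tau> arbitrary: s t e)
  case (TyFun \<sigma> \<tau>)
  show ?case
    unfolding EqT.simps eqv.simps
    by (rule sat_Forall) (use TyFun in \<open>auto dest!: vmax_EqT_less\<close>)
qed simp

lemma sat_ext_axiom:
  "sat e (ext_axiom \<rho> \<tau>) \<longleftrightarrow>
   (\<forall>x\<in>D \<rho>. \<forall>y\<in>D \<rho>. \<forall>f\<in>D (\<rho> \<Rrightarrow> \<tau>). eqv \<rho> x y \<longrightarrow> eqv \<tau> (ap f x) (ap f y))"
  unfolding ext_axiom_def
  by (intro sat_Forall) (auto dest!: vmax_EqT_less simp: sat_EqT vmax_Forall_less)

end

lemma wf_ext_axiom: "wf_fm (ext_axiom \<rho> \<tau>)"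
  unfolding ext_axiom_def by (intro wf_Forall) (simp add: wf_EqT)

section \<open>The extensional quotient of the term model\<close>

locale hmodel = fo_structure D ap cn "(=)" le
  for D :: "ty \<Rightarrow> 'a set" and ap cn and le +
  fixes T :: "fm set"
  assumes ap_in [intro]: "f \<in> D (\<sigma> \<Rrightarrow> \<tau>) \<Longrightarrow> x \<in> D \<sigma> \<Longrightarrow> ap f x \<in> D \<tau>"
    and cn_in: "wf_tm t \<Longrightarrow> cn t \<in> D (ty_of t)"
    and extensional: "f \<in> D (\<sigma> \<Rrightarrow> \<tau>) \<Longrightarrow> g \<in> D (\<sigma> \<Rrightarrow> \<tau>) \<Longrightarrow> (\<And>x. x \<in> D \<sigma> \<Longrightarrow> ap f x = ap g x) \<Longrightarrow> f = g"
    and nonempty: "D \<sigma> \<noteq> {}"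
    and axioms_sat: "p \<in> T \<Longrightarrow> wf_fm p \<Longrightarrow> valid e \<Longrightarrow> sat e p"

context henkin
begin

interpretation raw: fo_structure tms App "\<lambda>t. t" "\<lambda>s t. Eq s t \<in> G" "\<lambda>s t. Less s t \<in> G" .

text \<open>The truth lemma speaks only of the assignment that sends each variable to itself. Since
  a theorem stays a theorem when generalised, any other assignment can be reached by changing one
  free variable at a time.\<close>

lemma raw_theorem:
  assumes "T \<turnstile> \<phi>" "wf_fm \<phi>" "raw.valid e"
  shows "raw.sat e \<phi>"
proof -
  have *: "raw.valid e \<longrightarrow> (\<forall>v. v \<notin> V \<longrightarrow> e v = Vr v) \<longrightarrow> (\<forall>\<phi>. (T \<turnstile> \<phi>) \<longrightarrow> wf_fm \<phi> \<longrightarrow> raw.sat e \<phi>)"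
    if "finite V" for V e
    using that
  proof (induction V arbitrary: e rule: finite_induct)
    case empty
    have "e = Vr" if "\<forall>v. e v = Vr v" using that by blast
    then show ?case using truth G_thm by auto
  next
    case (insert v V)
    show ?case
    proof (intro impI allI)
      fix \<phi> assume e: "raw.valid e" "\<forall>w. w \<notin> insert v V \<longrightarrow> e w = Vr w" and \<phi>: "T \<turnstile> \<phi>" "wf_fm \<phi>"
      obtain x \<sigma> where v: "v = (x, \<sigma>)" by (cases v)
      have "raw.valid (e(v := Vr v))" unfolding v by (rule raw.valid_upd[OF e(1)]) (simp add: tms_def)
      moreover have "\<forall>w. w \<notin> V \<longrightarrow> (e(v := Vr v)) w = Vr w" using e(2) by (auto simp: fun_upd_apply)
      moreover have "T \<turnstile> AllV x \<sigma> \<phi>" "wf_fm (AllV x \<sigma> \<phi>)" using \<phi> gen by auto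
      ultimately have "raw.sat (e(v := Vr v)) (AllV x \<sigma> \<phi>)"
        using insert.IH[of "e(v := Vr v)"] by blast
      moreover have "e v \<in> tms \<sigma>" using e(1) v by (auto simp: raw.valid_def)
      ultimately have "raw.sat (e(v := Vr v, v := e v)) \<phi>" using v by auto
      then show "raw.sat e \<phi>" by simp
    qed
  qed
  define e' where "e' v = (if v \<in> fv \<phi> then e v else Vr v)" for v
  have fin: "finite (fv_tm t)" for t by (induction t) auto
  have "finite (fv \<phi>)" by (induction \<phi>) (auto simp: fin)
  moreover have "raw.valid e'" using assms(3) by (auto simp: raw.valid_def e'_def tms_def)
  ultimately have "raw.sat e' \<phi>" using *[of "fv \<phi>" e'] assms by (simp add: e'_def)
  moreover have "raw.sat e' \<phi> = raw.sat e \<phi>" by (rule raw.sat_cong) (simp add: e'_def)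
  ultimately show ?thesis by simp
qed

end

locale henkin_ext = henkin +
  assumes T_base: "RCA0_omega \<subseteq> T"
begin

interpretation raw: fo_structure tms App "\<lambda>t. t" "\<lambda>s t. Eq s t \<in> G" "\<lambda>s t. Less s t \<in> G" .

lemma raw_base:
  assumes "\<phi> \<in> RCA0_omega" "wf_fm \<phi>" "raw.valid e"
  shows "raw.sat e \<phi>"
  using raw_theorem[OF ax] assms T_base by blast

lemma Vr_valid: "raw.valid Vr"
  by (simp add: raw.valid_def tms_def)

lemma raw_ext:
  assumes "x \<in> tms \<rho>" "y \<in> tms \<rho>" "f \<in> tms (\<rho> \<Rrightarrow> \<tau>)" "raw.eqv \<rho> x y"
  shows "raw.eqv \<tau> (App f x) (App f y)"
proof -
  have "ext_axiom \<rho> \<tau> \<in> RCA0_omega" by (auto simp: RCA0_omega_def)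
  then show ?thesis
    using raw_base[OF _ wf_ext_axiom Vr_valid] assms by (simp add: raw.sat_ext_axiom)
qed

lemma raw_eq_refl: "a \<in> tms TyN \<Longrightarrow> Eq a a \<in> G"
  and raw_eq_sym: "a \<in> tms TyN \<Longrightarrow> b \<in> tms TyN \<Longrightarrow> Eq a b \<in> G \<Longrightarrow> Eq b a \<in> G"
  and raw_eq_trans: "a \<in> tms TyN \<Longrightarrow> b \<in> tms TyN \<Longrightarrow> c \<in> tms TyN \<Longrightarrow> Eq a b \<in> G \<Longrightarrow> Eq b c \<in> G \<Longrightarrow> Eq a c \<in> G"
  and raw_less_cong: "a \<in> tms TyN \<Longrightarrow> b \<in> tms TyN \<Longrightarrow> c \<in> tms TyN \<Longrightarrow> d \<in> tms TyN \<Longrightarrow>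
    Eq a b \<in> G \<Longrightarrow> Eq c d \<in> G \<Longrightarrow> Less a c \<in> G \<Longrightarrow> Less b d \<in> G"
proof -
  have arith: "raw.sat Vr \<phi>" if "\<phi> \<in> arith_axioms" "wf_fm \<phi>" for \<phi>
    by (rule raw_base[OF _ that(2) Vr_valid]) (use that(1) in \<open>simp add: RCA0_omega_def\<close>)
  have AX0: "(\<^bold>\<forall>\<^sub>0 a. a \<^bold>= a) \<in> arith_axioms"
    by (simp add: arith_axioms_def)
  have AX1: "(\<^bold>\<forall>\<^sub>0 a. \<^bold>\<forall>\<^sub>0 b. a \<^bold>= b \<^bold>\<longrightarrow> b \<^bold>= a) \<in> arith_axioms"
    by (simp add: arith_axioms_def)
  have AX2: "(\<^bold>\<forall>\<^sub>0 a. \<^bold>\<forall>\<^sub>0 b. \<^bold>\<forall>\<^sub>0 c. a \<^bold>= b \<^bold>\<longrightarrow> b \<^bold>= c \<^bold>\<longrightarrow> a \<^bold>= c) \<in> arith_axioms"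
    by (simp add: arith_axioms_def)
  have AX3: "(\<^bold>\<forall>\<^sub>0 a. \<^bold>\<forall>\<^sub>0 b. \<^bold>\<forall>\<^sub>0 c. \<^bold>\<forall>\<^sub>0 d. a \<^bold>= b \<^bold>\<longrightarrow> c \<^bold>= d \<^bold>\<longrightarrow> a \<^bold>< c \<^bold>\<longrightarrow> b \<^bold>< d) \<in> arith_axioms"
    by (simp add: arith_axioms_def)
  show "a \<in> tms TyN \<Longrightarrow> Eq a a \<in> G"
    using arith[OF AX0, simplified Forall_def, simplified] by blast
  show "a \<in> tms TyN \<Longrightarrow> b \<in> tms TyN \<Longrightarrow> Eq a b \<in> G \<Longrightarrow> Eq b a \<in> G"
    using arith[OF AX1, simplified Forall_def, simplified] by blast
  show "a \<in> tms TyN \<Longrightarrow> b \<in> tms TyN \<Longrightarrow> c \<in> tms TyN \<Longrightarrow> Eq a b \<in> G \<Longrightarrow> Eq b c \<in> G \<Longrightarrow> Eq a c \<in> G"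
    using arith[OF AX2, simplified Forall_def, simplified] by blast
  show "a \<in> tms TyN \<Longrightarrow> b \<in> tms TyN \<Longrightarrow> c \<in> tms TyN \<Longrightarrow> d \<in> tms TyN \<Longrightarrow>
    Eq a b \<in> G \<Longrightarrow> Eq c d \<in> G \<Longrightarrow> Less a c \<in> G \<Longrightarrow> Less b d \<in> G"
    using arith[OF AX3, simplified Forall_def, simplified] by blast
qed

lemma tms_App [intro]: "f \<in> tms (\<sigma> \<Rrightarrow> \<tau>) \<Longrightarrow> a \<in> tms \<sigma> \<Longrightarrow> App f a \<in> tms \<tau>"
  by (auto simp: tms_def)

lemma eqv_refl: "a \<in> tms \<sigma> \<Longrightarrow> raw.eqv \<sigma> a a"
  by (induction \<sigma> arbitrary: a) (auto intro: raw_eq_refl)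

lemma eqv_sym: "a \<in> tms \<sigma> \<Longrightarrow> b \<in> tms \<sigma> \<Longrightarrow> raw.eqv \<sigma> a b \<Longrightarrow> raw.eqv \<sigma> b a"
proof (induction \<sigma> arbitrary: a b)
  case (TyFun \<sigma> \<tau>)
  then show ?case unfolding raw.eqv.simps by (meson tms_App)
qed (auto intro: raw_eq_sym)

lemma eqv_trans: "a \<in> tms \<sigma> \<Longrightarrow> b \<in> tms \<sigma> \<Longrightarrow> c \<in> tms \<sigma> \<Longrightarrow> raw.eqv \<sigma> a b \<Longrightarrow> raw.eqv \<sigma> b c \<Longrightarrow> raw.eqv \<sigma> a c"
proof (induction \<sigma> arbitrary: a b c)
  case (TyFun \<sigma> \<tau>)
  then show ?case unfolding raw.eqv.simps by (meson tms_App)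
qed (auto intro: raw_eq_trans)

lemma eqv_App:
  assumes "f \<in> tms (\<sigma> \<Rrightarrow> \<tau>)" "g \<in> tms (\<sigma> \<Rrightarrow> \<tau>)" "a \<in> tms \<sigma>" "b \<in> tms \<sigma>"
    and "raw.eqv (\<sigma> \<Rrightarrow> \<tau>) f g" "raw.eqv \<sigma> a b"
  shows "raw.eqv \<tau> (App f a) (App g b)"
  using eqv_trans[of "App f a" \<tau> "App f b" "App g b"] raw_ext[of a \<sigma> b f \<tau>] assms by auto

text \<open>Chosen representatives take the place of equivalence classes, so the quotient again
  consists of terms. A fixed carrier type matters later, when the numbers of a countermodel are
  turned into a type.\<close>

definition nf :: "tm \<Rightarrow> tm" where
  "nf t = (SOME s. s \<in> tms (ty_of t) \<and> raw.eqv (ty_of t) s t)"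

lemma nf: "t \<in> tms \<sigma> \<Longrightarrow> nf t \<in> tms \<sigma> \<and> raw.eqv \<sigma> (nf t) t"
  using someI[of "\<lambda>s. s \<in> tms (ty_of t) \<and> raw.eqv (ty_of t) s t" t] eqv_refl[of t \<sigma>]
  by (auto simp: nf_def tms_def)

lemma nf_eq: "s \<in> tms \<sigma> \<Longrightarrow> t \<in> tms \<sigma> \<Longrightarrow> nf s = nf t \<longleftrightarrow> raw.eqv \<sigma> s t"
proof
  assume *: "s \<in> tms \<sigma>" "t \<in> tms \<sigma>" "nf s = nf t"
  then show "raw.eqv \<sigma> s t" using nf eqv_sym eqv_trans by metis
next
  assume *: "s \<in> tms \<sigma>" "t \<in> tms \<sigma>" "raw.eqv \<sigma> s t"
  then have "ty_of s = \<sigma>" "ty_of t = \<sigma>" by (auto simp: tms_def)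
  moreover have "(r \<in> tms \<sigma> \<and> raw.eqv \<sigma> r s) = (r \<in> tms \<sigma> \<and> raw.eqv \<sigma> r t)" for r
    using * eqv_sym eqv_trans by metis
  ultimately show "nf s = nf t" by (simp add: nf_def)
qed

abbreviation "D' \<sigma> \<equiv> nf ` tms \<sigma>"
abbreviation "ap' f a \<equiv> nf (App f a)"
abbreviation "le' s t \<equiv> Less s t \<in> G"

lemma D'_tms: "a \<in> D' \<sigma> \<Longrightarrow> a \<in> tms \<sigma> \<and> nf a = a"
proof -
  assume "a \<in> D' \<sigma>"
  then obtain t where t: "t \<in> tms \<sigma>" and a: "a = nf t" by blast
  show "a \<in> tms \<sigma> \<and> nf a = a" using nf[OF t] nf_eq[of "nf t" \<sigma> t] t a by simp
qed

interpretation quo: fo_structure D' ap' nf "(=)" le' .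

lemma quo_ev:
  assumes "quo.valid e" "raw.valid e'" "\<And>x \<sigma>. raw.eqv \<sigma> (e (x, \<sigma>)) (e' (x, \<sigma>))" "t \<in> tms \<sigma>"
  shows "quo.ev e t \<in> D' \<sigma> \<and> raw.ev e' t \<in> tms \<sigma> \<and> raw.eqv \<sigma> (quo.ev e t) (raw.ev e' t)"
  using assms(4)
proof (induction t arbitrary: \<sigma>)
  case (Var x \<tau>)
  then have "\<tau> = \<sigma>" by (simp add: tms_def)
  then show ?case using assms(1-3) by (simp add: quo.valid_def raw.valid_def)
next
  case (App f t)
  then obtain \<tau> where "f \<in> tms (\<tau> \<Rrightarrow> \<sigma>)" "t \<in> tms \<tau>" by (auto simp: tms_def)
  then have 1: "quo.ev e f \<in> D' (\<tau> \<Rrightarrow> \<sigma>)" "raw.ev e' f \<in> tms (\<tau> \<Rrightarrow> \<sigma>)"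
      "raw.eqv (\<tau> \<Rrightarrow> \<sigma>) (quo.ev e f) (raw.ev e' f)"
      "quo.ev e t \<in> D' \<tau>" "raw.ev e' t \<in> tms \<tau>" "raw.eqv \<tau> (quo.ev e t) (raw.ev e' t)"
    using App.IH(1)[of "\<tau> \<Rrightarrow> \<sigma>"] App.IH(2)[of \<tau>] by blast+
  then have 2: "raw.eqv \<sigma> (App (quo.ev e f) (quo.ev e t)) (App (raw.ev e' f) (raw.ev e' t))"
    using eqv_App D'_tms by blast
  have 3: "App (quo.ev e f) (quo.ev e t) \<in> tms \<sigma>" "App (raw.ev e' f) (raw.ev e' t) \<in> tms \<sigma>"
    using 1 D'_tms by blast+
  then have "raw.eqv \<sigma> (nf (App (quo.ev e f) (quo.ev e t))) (App (raw.ev e' f) (raw.ev e' t))"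
    using nf[of "App (quo.ev e f) (quo.ev e t)" \<sigma>] 2 eqv_trans by blast
  then show ?case using 3 by simp
qed (auto simp: nf tms_def[symmetric])

lemma quo_sat:
  assumes "wf_fm \<phi>" "quo.valid e" "raw.valid e'" "\<And>x \<sigma>. raw.eqv \<sigma> (e (x, \<sigma>)) (e' (x, \<sigma>))"
  shows "quo.sat e \<phi> \<longleftrightarrow> raw.sat e' \<phi>"
  using assms
proof (induction \<phi> arbitrary: e e')
  case (Eq s t)
  then have "s \<in> tms TyN" "t \<in> tms TyN" by (auto simp: tms_def)
  then have 1: "quo.ev e s \<in> D' TyN" "raw.ev e' s \<in> tms TyN" "raw.eqv TyN (quo.ev e s) (raw.ev e' s)"
      "quo.ev e t \<in> D' TyN" "raw.ev e' t \<in> tms TyN" "raw.eqv TyN (quo.ev e t) (raw.ev e' t)"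
    using quo_ev[OF Eq.prems(2-4)] by blast+
  then have "quo.ev e s = quo.ev e t \<longleftrightarrow> raw.eqv TyN (quo.ev e s) (quo.ev e t)"
    using nf_eq D'_tms by metis
  also have "\<dots> \<longleftrightarrow> raw.eqv TyN (raw.ev e' s) (raw.ev e' t)"
    using 1 D'_tms eqv_sym eqv_trans by metis
  finally show ?case by simp
next
  case (Less s t)
  then have "s \<in> tms TyN" "t \<in> tms TyN" by (auto simp: tms_def)
  then have 1: "quo.ev e s \<in> D' TyN" "raw.ev e' s \<in> tms TyN" "raw.eqv TyN (quo.ev e s) (raw.ev e' s)"
      "quo.ev e t \<in> D' TyN" "raw.ev e' t \<in> tms TyN" "raw.eqv TyN (quo.ev e t) (raw.ev e' t)"
    using quo_ev[OF Less.prems(2-4)] by blast+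
  then show ?case
    using D'_tms raw_less_cong raw_eq_sym by (metis quo.sat.simps(3) raw.sat.simps(3) raw.eqv.simps(1))
next
  case (Imp \<phi> \<psi>)
  then show ?case by simp
next
  case (AllV x \<sigma> \<phi>)
  have *: "quo.sat (e((x, \<sigma>) := nf d)) \<phi> \<longleftrightarrow> raw.sat (e'((x, \<sigma>) := d)) \<phi>" if d: "d \<in> tms \<sigma>" for d
  proof (rule AllV.IH)
    show "quo.valid (e((x, \<sigma>) := nf d))" "raw.valid (e'((x, \<sigma>) := d))"
      using AllV.prems d by auto
    show "raw.eqv \<tau> ((e((x, \<sigma>) := nf d)) (y, \<tau>)) ((e'((x, \<sigma>) := d)) (y, \<tau>))" for y \<tau>
      using AllV.prems(4) nf[OF d] by (cases "(y, \<tau>) = (x, \<sigma>)") auto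
  qed (use AllV.prems in simp)
  then show ?case by simp
qed simp

lemma quo_hmodel: "hmodel D' ap' nf le' T"
proof
  show "nf t \<in> D' (ty_of t)" if "wf_tm t" for t using that by (auto simp: tms_def)
  show "ap' f x \<in> D' \<tau>" if "f \<in> D' (\<sigma> \<Rrightarrow> \<tau>)" "x \<in> D' \<sigma>" for f \<sigma> \<tau> x using that D'_tms by blast
  show "f = g" if *: "f \<in> D' (\<sigma> \<Rrightarrow> \<tau>)" "g \<in> D' (\<sigma> \<Rrightarrow> \<tau>)" "\<And>x. x \<in> D' \<sigma> \<Longrightarrow> ap' f x = ap' g x" for f g \<sigma> \<tau>
  proof -
    have fg: "f \<in> tms (\<sigma> \<Rrightarrow> \<tau>)" "nf f = f" "g \<in> tms (\<sigma> \<Rrightarrow> \<tau>)" "nf g = g" using * D'_tms by blast+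
    \<comment> \<open>Agreement is known on representatives only; the extensionality axiom, applied
      to \<open>f\<close> and to \<open>g\<close>, carries it over to an arbitrary term
      \<open>c\<close>.\<close>
    have "raw.eqv \<tau> (App f c) (App g c)" if c: "c \<in> tms \<sigma>" for c
    proof -
      have n: "nf c \<in> tms \<sigma>" "raw.eqv \<sigma> (nf c) c" "raw.eqv \<sigma> c (nf c)" using nf[OF c] c eqv_sym by auto
      have "raw.eqv \<tau> (App f (nf c)) (App g (nf c))" using *(3)[of "nf c"] c n fg nf_eq by blast
      moreover have "raw.eqv \<tau> (App f c) (App f (nf c))" "raw.eqv \<tau> (App g (nf c)) (App g c)"
        using raw_ext fg n c by auto
      moreover have "App f c \<in> tms \<tau>" "App g c \<in> tms \<tau>" "App f (nf c) \<in> tms \<tau>" "App g (nf c) \<in> tms \<tau>"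
        using fg n c by auto
      ultimately show ?thesis using eqv_trans by meson
    qed
    then show ?thesis using fg nf_eq[of f "\<sigma> \<Rrightarrow> \<tau>" g] by simp
  qed
  have "Var 0 \<sigma> \<in> tms \<sigma>" for \<sigma> by (simp add: tms_def)
  then show "D' \<sigma> \<noteq> {}" for \<sigma> by blast
  show "quo.sat e \<phi>" if \<phi>: "\<phi> \<in> T" "wf_fm \<phi>" and e: "quo.valid e" for \<phi> e
  proof -
    have e': "raw.valid e" using e D'_tms unfolding quo.valid_def raw.valid_def by blast
    moreover have "raw.eqv \<sigma> (e (x, \<sigma>)) (e (x, \<sigma>))" for x \<sigma>
      using e' unfolding raw.valid_def by (intro eqv_refl) blast
    ultimately show ?thesis using quo_sat[OF \<phi>(2) e e'] raw_theorem[OF ax[OF \<phi>(1)] \<phi>(2) e'] by simp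
  qed
qed

lemma quo_refutes:
  assumes "FNeg \<chi> \<in> G" "wf_fm \<chi>"
  shows "\<exists>e. quo.valid e \<and> \<not> quo.sat e \<chi>"
proof (intro exI conjI)
  have 1: "Var x \<sigma> \<in> tms \<sigma>" for x \<sigma> by (simp add: tms_def)
  show v: "quo.valid (nf \<circ> Vr)" using 1 by (auto simp: quo.valid_def)
  have "\<not> raw.sat Vr \<chi>" using assms truth G_neg by blast
  moreover have "quo.sat (nf \<circ> Vr) \<chi> \<longleftrightarrow> raw.sat Vr \<chi>"
    by (rule quo_sat[OF assms(2) v Vr_valid]) (use nf[OF 1] in auto)
  ultimately show "\<not> quo.sat (nf \<circ> Vr) \<chi>" by simp
qed

end

theorem countermodel:
  assumes "RCA0_omega \<subseteq> T" "wf_fm \<chi>" "\<not> (T \<turnstile> \<chi>)"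
  shows "\<exists>D (ap :: tm \<Rightarrow> tm \<Rightarrow> tm) cn le. hmodel D ap cn le T \<and>
    (\<exists>e. fo_structure.valid D e \<and> \<not> fo_structure.sat D ap cn (=) le e \<chi>)"
proof -
  obtain G where "henkin T G" and neg: "FNeg \<chi> \<in> G" using henkin_exists assms by blast
  then interpret henkin_ext T G using assms by (simp add: henkin_ext_def henkin_ext_axioms_def)
  show ?thesis using quo_hmodel quo_refutes[OF neg assms(2)] by blast
qed

section \<open>The ring of differences of an ordered semiring\<close>

text \<open>The pair (a, b) stands for a - b. The numbers of a model form only a semiring; through
  differences and then fractions they come to lie in an ordered field, where linear arithmetic and
  division are available.\<close>

definition diff_rel :: "'a::linordered_semidom \<times> 'a \<Rightarrow> 'a \<times> 'a \<Rightarrow> bool" where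
  "diff_rel p q \<longleftrightarrow> fst p + snd q = fst q + snd p"

lemma diff_rel_trans: "diff_rel p q \<Longrightarrow> diff_rel q r \<Longrightarrow> diff_rel p r"
proof -
  assume "diff_rel p q" "diff_rel q r"
  then have *: "fst p + snd q = fst q + snd p" "fst q + snd r = fst r + snd q" by (auto simp: diff_rel_def)
  have "(fst p + snd r) + (fst q + snd q) = (fst p + snd q) + (fst q + snd r)" by (simp add: ac_simps)
  also have "\<dots> = (fst r + snd p) + (fst q + snd q)" unfolding * by (simp add: ac_simps)
  finally show ?thesis by (simp add: diff_rel_def)
qed

lemma diff_rel_plus:
  assumes "diff_rel (a, b) (a', b')" "diff_rel (c, d) (c', d')"
  shows "diff_rel (a + c, b + d) (a' + c', b' + d')"
proof -
  have *: "a + b' = a' + b" "c + d' = c' + d" using assms by (auto simp: diff_rel_def)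
  have "(a + c) + (b' + d') = (a + b') + (c + d')" by (simp add: ac_simps)
  also have "\<dots> = (a' + c') + (b + d)" unfolding * by (simp add: ac_simps)
  finally show ?thesis by (simp add: diff_rel_def)
qed

lemma diff_rel_swap: "diff_rel (a, b) (a', b') \<Longrightarrow> diff_rel (b, a) (b', a')"
  by (simp add: diff_rel_def ac_simps)

lemma equivp_diff_rel: "equivp diff_rel"
proof (rule equivpI)
  show "transp (diff_rel :: 'a \<times> 'a \<Rightarrow> _)" by (rule transpI) (rule diff_rel_trans)
qed (auto simp: reflp_def symp_def diff_rel_def)

quotient_type (overloaded) 'a differences = "'a::linordered_semidom \<times> 'a" / diff_rel
  morphisms rep_of_differences differences_of
  by (rule equivp_diff_rel)

text \<open>The factors are replaced one at a time, each replacement being linear, and the two steps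
  are joined by transitivity.\<close>

lemma diff_rel_times:
  assumes "diff_rel (x, y) (x', y')" "diff_rel (u, v) (u', v')"
  shows "diff_rel (x * u + y * v, x * v + y * u) (x' * u' + y' * v', x' * v' + y' * u')"
proof (rule diff_rel_trans)
  show "diff_rel (x * u + y * v, x * v + y * u) (x' * u + y' * v, x' * v + y' * u)"
  proof -
    have "(x + y') * u + (x' + y) * v = (x' + y) * u + (x + y') * v" using assms by (simp add: diff_rel_def)
    then show ?thesis by (simp add: diff_rel_def algebra_simps)
  qed
  show "diff_rel (x' * u + y' * v, x' * v + y' * u) (x' * u' + y' * v', x' * v' + y' * u')"
  proof -
    have "x' * (u + v') + y' * (u' + v) = x' * (u' + v) + y' * (u + v')" using assms by (simp add: diff_rel_def)
    then show ?thesis by (simp add: diff_rel_def algebra_simps)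
  qed
qed

text \<open>Adding b' + d' to both sides of the first inequality and b + d to both sides of the
  second makes them the same inequality.\<close>

lemma diff_less_cong:
  fixes a :: "'a::linordered_semidom"
  assumes "a + b' = a' + b" "c + d' = c' + d"
  shows "a + d < c + b \<longleftrightarrow> a' + d' < c' + b'"
proof -
  have "a + d < c + b \<longleftrightarrow> (a + d) + (b' + d') < (c + b) + (b' + d')" by simp
  also have "(a + d) + (b' + d') = (a + b') + (d + d')" by (simp add: algebra_simps)
  also have "\<dots> = (a' + d') + (b + d)" unfolding assms by (simp add: algebra_simps)
  also have "(c + b) + (b' + d') = (c + d') + (b + b')" by (simp add: algebra_simps)
  also have "\<dots> = (c' + b') + (b + d)" unfolding assms by (simp add: algebra_simps)
  finally show ?thesis by simp
qed

text \<open>This is (b - a) * (d - c) > 0 in a form without subtraction.\<close>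

lemma diff_mult_less:
  fixes a :: "'a::linordered_semidom"
  assumes "a < b" "c < d"
  shows "a * d + b * c < a * c + b * d"
proof -
  obtain k where "b = a + k" "0 < k" using assms(1)
    using le_add_diff_inverse2[of a b] by (metis add.commute add.right_neutral add_less_cancel_left less_imp_le)
  moreover have "k * c < k * d" using calculation assms(2) by (simp add: mult_strict_left_mono)
  ultimately show ?thesis by (simp add: algebra_simps)
qed

instantiation differences :: (linordered_semidom) linordered_idom
begin

lift_definition zero_differences :: "'a differences" is "(0, 0)" .
lift_definition one_differences :: "'a differences" is "(1, 0)" .
lift_definition plus_differences :: "'a differences \<Rightarrow> 'a differences \<Rightarrow> 'a differences"
  is "\<lambda>(a, b) (c, d). (a + c, b + d)" by (auto intro: diff_rel_plus)
lift_definition uminus_differences :: "'a differences \<Rightarrow> 'a differences"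
  is "\<lambda>(a, b). (b, a)" by (auto intro: diff_rel_swap)
lift_definition minus_differences :: "'a differences \<Rightarrow> 'a differences \<Rightarrow> 'a differences"
  is "\<lambda>(a, b) (c, d). (a + d, b + c)" by (auto intro: diff_rel_plus diff_rel_swap)
lift_definition times_differences :: "'a differences \<Rightarrow> 'a differences \<Rightarrow> 'a differences"
  is "\<lambda>(a, b) (c, d). (a * c + b * d, a * d + b * c)" by (clarsimp simp: diff_rel_times)
lift_definition less_differences :: "'a differences \<Rightarrow> 'a differences \<Rightarrow> bool"
  is "\<lambda>(a, b) (c, d). a + d < c + b" 
  unfolding diff_rel_def by clarify (simp only: fst_conv snd_conv, rule diff_less_cong)
lift_definition less_eq_differences :: "'a differences \<Rightarrow> 'a differences \<Rightarrow> bool"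
  is "\<lambda>(a, b) (c, d). a + d \<le> c + b"

  unfolding not_less[symmetric] diff_rel_def
  by clarify (simp only: fst_conv snd_conv, rule arg_cong[of _ _ Not], rule diff_less_cong)
definition abs_differences :: "'a differences \<Rightarrow> 'a differences" where
  "abs_differences a = (if a < 0 then - a else a)"
definition sgn_differences :: "'a differences \<Rightarrow> 'a differences" where
  "sgn_differences a = (if a = 0 then 0 else if 0 < a then 1 else - 1)"

instance
proof
  fix a b c :: "'a differences"
  show "a + b + c = a + (b + c)" by transfer (auto simp: diff_rel_def algebra_simps)
  show "a + b = b + a" by transfer (auto simp: diff_rel_def algebra_simps)
  show "0 + a = a" by transfer (auto simp: diff_rel_def)
  show "- a + a = 0" by transfer (auto simp: diff_rel_def algebra_simps)
  show "a - b = a + - b" by transfer (auto simp: diff_rel_def)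
  show "a + b - a = b" by transfer (auto simp: diff_rel_def algebra_simps)
  show "a - b - c = a - (b + c)" by transfer (auto simp: diff_rel_def algebra_simps)
  show "0 * a = 0" "a * 0 = 0" by (transfer; auto simp: diff_rel_def)+
  show "a * b * c = a * (b * c)" by transfer (auto simp: diff_rel_def algebra_simps)
  show "a * b = b * a" by transfer (auto simp: diff_rel_def algebra_simps)
  show "1 * a = a" by transfer (auto simp: diff_rel_def)
  show "(a + b) * c = a * c + b * c" by transfer (auto simp: diff_rel_def algebra_simps)
  show "(0 :: 'a differences) \<noteq> 1" by transfer (auto simp: diff_rel_def)
  show "(a < b) = (a \<le> b \<and> \<not> b \<le> a)" by transfer auto
  show "a \<le> a" by transfer auto
  show "a \<le> b \<Longrightarrow> b \<le> c \<Longrightarrow> a \<le> c"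
  proof (transfer, clarify)
    fix a b c d e f :: 'a
    assume "a + d \<le> c + b" "c + f \<le> e + d"
    then have "(a + f) + (c + d) \<le> (e + b) + (c + d)"
      using add_mono[of "a + d" "c + b" "c + f" "e + d"] by (simp add: algebra_simps)
    then show "a + f \<le> e + b" by simp
  qed
  show "a \<le> b \<Longrightarrow> b \<le> a \<Longrightarrow> a = b" by transfer (auto simp: diff_rel_def)
  show "a \<le> b \<or> b \<le> a" by transfer auto
  show "a \<le> b \<Longrightarrow> c + a \<le> c + b"
  proof (transfer, clarify)
    fix a b c d e f :: 'a
    assume "a + d \<le> c + b"
    then have "(e + f) + (a + d) \<le> (e + f) + (c + b)" by simp
    then show "e + a + (f + d) \<le> e + c + (f + b)" by (simp add: algebra_simps)
  qed
  show "a < b \<Longrightarrow> 0 < c \<Longrightarrow> c * a < c * b"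
  proof (transfer, clarify)
    fix a b c d e f :: 'a
    assume "a + d < c + b" and "0 + f < e + 0"
    then show "(e * a + f * b) + (e * d + f * c) < (e * c + f * d) + (e * b + f * a)"
      using diff_mult_less[of "a + d" "c + b" f e] by (simp add: algebra_simps)
  qed
  show "\<bar>a\<bar> = (if a < 0 then - a else a)" by (rule abs_differences_def)
  show "sgn a = (if a = 0 then 0 else if 0 < a then 1 else - 1)" by (rule sgn_differences_def)
qed

end

lift_definition of_semi :: "'a::linordered_semidom \<Rightarrow> 'a differences" is "\<lambda>a. (a, 0)" .

lemma of_semi_simps:
  "of_semi 0 = 0" "of_semi 1 = 1" "of_semi (a + b) = of_semi a + of_semi b"
  "of_semi (a * b) = of_semi a * of_semi b" "of_semi a < of_semi b \<longleftrightarrow> a < b" "of_semi a = of_semi b \<longleftrightarrow> a = b"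
  by (transfer; simp add: diff_rel_def)+

definition of_semi_fract :: "'a::linordered_semidom \<Rightarrow> 'a differences fract" where
  "of_semi_fract a = Fract (of_semi a) 1"

lemma of_semi_fract_simps:
  "of_semi_fract 0 = 0" "of_semi_fract 1 = 1" "of_semi_fract (a + b) = of_semi_fract a + of_semi_fract b"
  "of_semi_fract (a * b) = of_semi_fract a * of_semi_fract b"
  "of_semi_fract a < of_semi_fract b \<longleftrightarrow> a < b" "of_semi_fract a = of_semi_fract b \<longleftrightarrow> a = b"
  by (simp_all add: of_semi_fract_def of_semi_simps fract_collapse eq_fract)

section \<open>Abstraction terms\<close>


lemma fv_abs_tm [simp]: "fv_tm (abs_tm x \<sigma> t) = fv_tm t - {(x, \<sigma>)}"
  by (induction t) auto

lemma finite_fv_tm [simp]: "finite (fv_tm t)"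
  by (induction t) auto

text \<open>Bracket abstraction rewrites a term into combinators, but its free variables remain easy
  to compute. Expressing the index bound through them makes the index chosen by an outer
  \<open>Lam\<close> computable.\<close>

lemma vmax_tm_Max: "vmax_tm t = Max (insert 0 (fst ` fv_tm t))"
proof (induction t)
  case (App t u)
  have "insert 0 (fst ` fv_tm (App t u)) = insert 0 (fst ` fv_tm t) \<union> insert 0 (fst ` fv_tm u)" by auto
  moreover have "Max (insert 0 (fst ` fv_tm t) \<union> insert 0 (fst ` fv_tm u)) = max (vmax_tm t) (vmax_tm u)"
    unfolding App by (rule Max_Un) auto
  ultimately show ?case by (simp only: vmax_tm.simps)
qed auto

lemma vmax_abs_tm [simp]: "vmax_tm (abs_tm x \<sigma> t) = Max (insert 0 (fst ` (fv_tm t - {(x, \<sigma>)})))"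
  by (simp add: vmax_tm_Max del: Max_insert Max.insert)

lemma vmax_closed: "fv_tm t = {} \<Longrightarrow> vmax_tm t = 0"
  by (simp add: vmax_tm_Max)

lemma ty_abs_tm [simp]: "ty_of (abs_tm x \<sigma> t) = \<sigma> \<Rrightarrow> ty_of t"
  by (cases t) auto

lemma wf_abs_tm [simp]: "wf_tm t \<Longrightarrow> wf_tm (abs_tm x \<sigma> t)"
  by (induction t) auto

lemma sat_simps_defs:
  "fo_structure.sat D ap cn eq le e (FNeg \<phi>) \<longleftrightarrow> \<not> fo_structure.sat D ap cn eq le e \<phi>"
  "fo_structure.sat D ap cn eq le e (FOr \<phi> \<psi>) \<longleftrightarrow> fo_structure.sat D ap cn eq le e \<phi> \<or> fo_structure.sat D ap cn eq le e \<psi>"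
  "fo_structure.sat D ap cn eq le e (FAnd \<phi> \<psi>) \<longleftrightarrow> fo_structure.sat D ap cn eq le e \<phi> \<and> fo_structure.sat D ap cn eq le e \<psi>"
  "fo_structure.sat D ap cn eq le e (ExV x \<sigma> \<phi>) \<longleftrightarrow> (\<exists>d\<in>D \<sigma>. fo_structure.sat D ap cn eq le (e((x, \<sigma>) := d)) \<phi>)"
  by (auto simp: FNeg_def FOr_def FAnd_def ExV_def fo_structure.sat.simps)

lemma wf_simps_defs [simp]:
  "wf_fm (FOr \<phi> \<psi>) \<longleftrightarrow> wf_fm \<phi> \<and> wf_fm \<psi>" "wf_fm (FAnd \<phi> \<psi>) \<longleftrightarrow> wf_fm \<phi> \<and> wf_fm \<psi>"
  "wf_fm (ExV x \<sigma> \<phi>) \<longleftrightarrow> wf_fm \<phi>"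
  by (auto simp: FOr_def FAnd_def ExV_def)

lemma qfree_simps_defs [simp]:
  "qfree (FNeg \<phi>) \<longleftrightarrow> qfree \<phi>"
  "qfree (FOr \<phi> \<psi>) \<longleftrightarrow> qfree \<phi> \<and> qfree \<psi>" "qfree (FAnd \<phi> \<psi>) \<longleftrightarrow> qfree \<phi> \<and> qfree \<psi>"
  by (auto simp: FOr_def FAnd_def FNeg_def)

lemma vmax_simps_defs [simp]:
  "vmax (FNeg \<phi>) = vmax \<phi>"
  "vmax (FOr \<phi> \<psi>) = max (vmax \<phi>) (vmax \<psi>)" "vmax (FAnd \<phi> \<psi>) = max (vmax \<phi>) (vmax \<psi>)"
  "vmax (ExV x \<sigma> \<phi>) = max x (vmax \<phi>)"
  by (auto simp: FOr_def FAnd_def FNeg_def ExV_def)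

lemma qfree_free_for: "qfree \<phi> \<Longrightarrow> free_for s x \<sigma> \<phi>"
  by (induction \<phi>) auto

section \<open>Arithmetic in a model\<close>

lemma closed_tms [simp]:
  "fv_tm pred_tm = {}" "fv_tm monus_tm = {}"
  by (auto simp: pred_tm_def monus_tm_def Lam_def)

lemma typed_tms [simp]:
  "ty_of pred_tm = Ty1" "wf_tm pred_tm"
  "ty_of monus_tm = TyN \<Rrightarrow> Ty1" "wf_tm monus_tm"
  by (auto simp: pred_tm_def monus_tm_def Lam_def)

locale base_model = hmodel +
  assumes T_base: "RCA0_omega \<subseteq> T"
begin

lemmas [simp] = sat_simps_defs[of D ap cn "(=)" le]

abbreviation "N \<equiv> D TyN"
abbreviation "nz \<equiv> cn Zero"
abbreviation "nu \<equiv> cn One"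
definition "pl a b = ap (ap (cn Plus) a) b"
definition "tm a b = ap (ap (cn Times) a) b"

lemma base_sat: "\<phi> \<in> RCA0_omega \<Longrightarrow> wf_fm \<phi> \<Longrightarrow> valid e \<Longrightarrow> sat e \<phi>"
  using axioms_sat T_base by blast

lemma ev_in: "valid e \<Longrightarrow> wf_tm t \<Longrightarrow> ev e t \<in> D (ty_of t)"
proof (induction t)
  case (Var x \<sigma>)
  then show ?case by (simp add: valid_def)
next
  case (App t u)
  then show ?case by (auto intro: ap_in)
qed (use cn_in in \<open>force simp del: ty_of.simps\<close>)+

lemma ev_in' [simp]: "ty_of t = \<sigma> \<Longrightarrow> wf_tm t \<Longrightarrow> valid e \<Longrightarrow> ev e t \<in> D \<sigma>"
  using ev_in by blast

lemma valid_upd' [simp]: "valid e \<Longrightarrow> d \<in> D \<sigma> \<Longrightarrow> valid (e((x, \<sigma>) := d))"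
  by (rule valid_upd)

definition e0 :: "nat \<times> ty \<Rightarrow> 'a" where "e0 v = (SOME d. d \<in> D (snd v))"

lemma valid_e0 [simp]: "valid e0"
  using nonempty by (simp add: valid_def e0_def some_in_eq)

lemma eqv_eq: "a \<in> D \<sigma> \<Longrightarrow> b \<in> D \<sigma> \<Longrightarrow> eqv \<sigma> a b \<longleftrightarrow> a = b"
proof (induction \<sigma> arbitrary: a b)
  case (TyFun \<sigma> \<tau>)
  then have "eqv (\<sigma> \<Rrightarrow> \<tau>) a b \<longleftrightarrow> (\<forall>c\<in>D \<sigma>. ap a c = ap b c)" 
    using ap_in[OF TyFun.prems(1)] ap_in[OF TyFun.prems(2)] TyFun.IH(2) by simp
  then show ?case using extensional[OF TyFun.prems] by auto
qed simp

lemma K_eq: "x \<in> D \<rho> \<Longrightarrow> y \<in> D \<tau> \<Longrightarrow> ap (ap (cn (KK \<rho> \<tau>)) x) y = x"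
proof -
  assume xy: "x \<in> D \<rho>" "y \<in> D \<tau>"
  have "wf_fm (K_axiom \<rho> \<tau>)" unfolding K_axiom_def by (intro wf_Forall) (simp add: wf_EqT)
  moreover have "K_axiom \<rho> \<tau> \<in> RCA0_omega" unfolding RCA0_omega_def by blast
  ultimately have "sat e0 (K_axiom \<rho> \<tau>)" by (intro base_sat) auto
  moreover have "sat e0 (K_axiom \<rho> \<tau>) \<longleftrightarrow> (\<forall>x\<in>D \<rho>. \<forall>y\<in>D \<tau>. eqv \<rho> (ap (ap (cn (KK \<rho> \<tau>)) x) y) x)"
    unfolding K_axiom_def
    by (intro sat_Forall) (auto dest!: vmax_EqT_less simp: sat_EqT vmax_Forall_less)
  moreover have "ap (ap (cn (KK \<rho> \<tau>)) x) y \<in> D \<rho>"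
    using cn_in[of "KK \<rho> \<tau>"] xy by (auto intro: ap_in)
  ultimately show ?thesis using eqv_eq xy by blast
qed

lemma S_eq:
  assumes "x \<in> D (\<delta> \<Rrightarrow> \<rho> \<Rrightarrow> \<tau>)" "y \<in> D (\<delta> \<Rrightarrow> \<rho>)" "z \<in> D \<delta>"
  shows "ap (ap (ap (cn (SS \<delta> \<rho> \<tau>)) x) y) z = ap (ap x z) (ap y z)"
proof -
  have "wf_fm (S_axiom \<delta> \<rho> \<tau>)" unfolding S_axiom_def by (intro wf_Forall) (simp add: wf_EqT)
  moreover have "S_axiom \<delta> \<rho> \<tau> \<in> RCA0_omega" unfolding RCA0_omega_def by blast
  ultimately have "sat e0 (S_axiom \<delta> \<rho> \<tau>)" by (intro base_sat) auto
  moreover have "sat e0 (S_axiom \<delta> \<rho> \<tau>) \<longleftrightarrow> (\<forall>x\<in>D (\<delta> \<Rrightarrow> \<rho> \<Rrightarrow> \<tau>). \<forall>y\<in>D (\<delta> \<Rrightarrow> \<rho>). \<forall>z\<in>D \<delta>.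
      eqv \<tau> (ap (ap (ap (cn (SS \<delta> \<rho> \<tau>)) x) y) z) (ap (ap x z) (ap y z)))"
    unfolding S_axiom_def
    by (intro sat_Forall) (auto dest!: vmax_EqT_less simp: sat_EqT vmax_Forall_less)
  moreover have "ap (ap (ap (cn (SS \<delta> \<rho> \<tau>)) x) y) z \<in> D \<tau>" "ap (ap x z) (ap y z) \<in> D \<tau>"
    using cn_in[of "SS \<delta> \<rho> \<tau>"] assms by (auto intro: ap_in)
  ultimately show ?thesis using eqv_eq assms by blast
qed

text \<open>Beta conversion as an equation in the model: S handles applications, K the parts without
  the variable, and S K K the variable itself.\<close>

lemma ev_abs [simp]:
  assumes "wf_tm t" "valid e" "d \<in> D \<sigma>"
  shows "ap (ev e (abs_tm x \<sigma> t)) d = ev (e((x, \<sigma>) := d)) t"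
proof -
  have c: "wf_tm t \<Longrightarrow> ap (ap (cn (KK (ty_of t) \<sigma>)) (cn t)) d = cn t" for t
    by (rule K_eq[OF cn_in assms(3)])
  show ?thesis
    using assms(1)
  proof (induction t)
    case (Var y \<tau>)
    have s: "cn (KK \<sigma> \<sigma>) \<in> D (\<sigma> \<Rrightarrow> \<sigma> \<Rrightarrow> \<sigma>)" "cn (KK \<sigma> (\<sigma> \<Rrightarrow> \<sigma>)) \<in> D (\<sigma> \<Rrightarrow> (\<sigma> \<Rrightarrow> \<sigma>) \<Rrightarrow> \<sigma>)"
      using cn_in[of "KK \<sigma> \<sigma>"] cn_in[of "KK \<sigma> (\<sigma> \<Rrightarrow> \<sigma>)"] by auto
    have "e (y, \<tau>) \<in> D \<tau>" using assms(2) by (simp add: valid_def)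
    then show ?case using S_eq[OF s(2) s(1) assms(3)] K_eq[of d \<sigma> "ap (cn (KK \<sigma> \<sigma>)) d" "\<sigma> \<Rrightarrow> \<sigma>"] ap_in[OF s(1) assms(3)] assms(3)
      by (auto simp: K_eq fun_upd_apply)
  next
    case (App t u)
    show ?case
    proof (cases "(x, \<sigma>) \<in> fv_tm (App t u)")
      case False
      have "ev e (App t u) = ev (e((x, \<sigma>) := d)) (App t u)"
        by (rule ev_cong) (use False in \<open>auto simp: fun_upd_apply\<close>)
      moreover have "ev e (App t u) \<in> D (ty_of (App t u))" by (rule ev_in[OF assms(2) App.prems])
      ultimately show ?thesis using False K_eq[OF _ assms(3), of "ev e (App t u)"] by simp
    next
      case True
      obtain \<tau> where ty: "ty_of t = ty_of u \<Rrightarrow> \<tau>" "wf_tm t" "wf_tm u" using App.prems by auto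
      have "ev e (abs_tm x \<sigma> t) \<in> D (\<sigma> \<Rrightarrow> ty_of u \<Rrightarrow> \<tau>)" "ev e (abs_tm x \<sigma> u) \<in> D (\<sigma> \<Rrightarrow> ty_of u)"
        using ty assms(2) by auto
      then show ?thesis using True ty App.IH S_eq[OF _ _ assms(3)] by simp
    qed
  qed (auto simp: c[of Zero, simplified] c[of One, simplified] c[of Plus, simplified] c[of Times, simplified]
      c[of "KK \<rho> \<tau>" for \<rho> \<tau>, simplified] c[of "SS \<delta> \<rho> \<tau>" for \<delta> \<rho> \<tau>, simplified] c[of "Rec \<rho>" for \<rho>, simplified])
qed

declare abs_tm.simps [simp del]

lemma QF_induct:
  assumes "wf_fm \<phi>" "qfree \<phi>" "valid e" "sat (e((n, TyN) := nz)) \<phi>"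
    and step: "\<And>d. d \<in> N \<Longrightarrow> sat (e((n, TyN) := d)) \<phi> \<Longrightarrow> sat (e((n, TyN) := pl d nu)) \<phi>"
    and "d \<in> N"
  shows "sat (e((n, TyN) := d)) \<phi>"
proof -
  let ?ax = "subst_fm n TyN Zero \<phi> \<^bold>\<longrightarrow> AllV n TyN (\<phi> \<^bold>\<longrightarrow> subst_fm n TyN (Var n TyN \<^bold>+ One) \<phi>) \<^bold>\<longrightarrow> AllV n TyN \<phi>"
  have "?ax \<in> RCA0_omega" using assms by (auto simp: RCA0_omega_def QF_IND_def)
  moreover have "wf_fm ?ax" using assms by (auto intro: wf_subst_fm)
  ultimately have "sat e ?ax" using assms(3) by (rule base_sat)
  then show ?thesis using assms
    by (simp add: sat_subst[OF qfree_free_for] pl_def)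
qed

lemma arith_sat:
  assumes "\<phi> \<in> arith_axioms" "wf_fm \<phi>" shows "sat e0 \<phi>"
  by (rule base_sat) (use assms in \<open>auto simp: RCA0_omega_def\<close>)

lemma const_in [simp]: "nz \<in> N" "nu \<in> N"
  using cn_in[of Zero] cn_in[of One] by auto

lemma op_in [simp]: "a \<in> N \<Longrightarrow> b \<in> N \<Longrightarrow> pl a b \<in> N" "a \<in> N \<Longrightarrow> b \<in> N \<Longrightarrow> tm a b \<in> N"
  using cn_in[of Plus] cn_in[of Times] by (auto simp: pl_def tm_def intro: ap_in)

lemma ev_arith [simp]: "ap (ap (cn Plus) a) b = pl a b" "ap (ap (cn Times) a) b = tm a b"
  by (auto simp: pl_def tm_def)

lemma arith_facts:
  "\<forall>a\<in>N. \<forall>b\<in>N. \<forall>c\<in>N. pl (pl a b) c = pl a (pl b c)"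
  "\<forall>a\<in>N. \<forall>b\<in>N. pl a b = pl b a"
  "\<forall>a\<in>N. pl a nz = a"
  "\<forall>a\<in>N. \<forall>b\<in>N. \<forall>c\<in>N. tm (tm a b) c = tm a (tm b c)"
  "\<forall>a\<in>N. \<forall>b\<in>N. tm a b = tm b a"
  "\<forall>a\<in>N. tm a nu = a"
  "\<forall>a\<in>N. tm a nz = nz"
  "\<forall>a\<in>N. \<forall>b\<in>N. \<forall>c\<in>N. tm a (pl b c) = pl (tm a b) (tm a c)"
  "\<forall>a\<in>N. \<not> le a a"
  "\<forall>a\<in>N. \<forall>b\<in>N. \<forall>c\<in>N. le a b \<longrightarrow> le b c \<longrightarrow> le a c"
  "\<forall>a\<in>N. \<forall>b\<in>N. le a b \<or> a = b \<or> le b a"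
  "le nz nu"
  "\<forall>a\<in>N. \<forall>b\<in>N. \<forall>c\<in>N. le a b \<longrightarrow> le (pl a c) (pl b c)"
  "\<forall>a\<in>N. \<forall>b\<in>N. \<forall>c\<in>N. le nz c \<longrightarrow> le a b \<longrightarrow> le (tm a c) (tm b c)"
proof -
  have *: "\<phi> \<in> arith_axioms \<Longrightarrow> wf_fm \<phi> \<Longrightarrow> sat e0 \<phi> \<longleftrightarrow> P \<Longrightarrow> P" for \<phi> P using arith_sat by blast
  show "\<forall>a\<in>N. \<forall>b\<in>N. \<forall>c\<in>N. pl (pl a b) c = pl a (pl b c)"
    by (rule *[of "\<^bold>\<forall>\<^sub>0 a. \<^bold>\<forall>\<^sub>0 b. \<^bold>\<forall>\<^sub>0 c. (a \<^bold>+ b) \<^bold>+ c \<^bold>= a \<^bold>+ (b \<^bold>+ c)"]) (simp add: arith_axioms_def, simp_all add: Forall_def)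
  show "\<forall>a\<in>N. \<forall>b\<in>N. pl a b = pl b a"
    by (rule *[of "\<^bold>\<forall>\<^sub>0 a. \<^bold>\<forall>\<^sub>0 b. a \<^bold>+ b \<^bold>= b \<^bold>+ a"]) (simp add: arith_axioms_def, simp_all add: Forall_def)
  show "\<forall>a\<in>N. pl a nz = a"
    by (rule *[of "\<^bold>\<forall>\<^sub>0 a. a \<^bold>+ Zero \<^bold>= a"]) (simp add: arith_axioms_def, simp_all add: Forall_def)
  show "\<forall>a\<in>N. \<forall>b\<in>N. \<forall>c\<in>N. tm (tm a b) c = tm a (tm b c)"
    by (rule *[of "\<^bold>\<forall>\<^sub>0 a. \<^bold>\<forall>\<^sub>0 b. \<^bold>\<forall>\<^sub>0 c. (a \<^bold>* b) \<^bold>* c \<^bold>= a \<^bold>* (b \<^bold>* c)"]) (simp add: arith_axioms_def, simp_all add: Forall_def)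
  show "\<forall>a\<in>N. \<forall>b\<in>N. tm a b = tm b a"
    by (rule *[of "\<^bold>\<forall>\<^sub>0 a. \<^bold>\<forall>\<^sub>0 b. a \<^bold>* b \<^bold>= b \<^bold>* a"]) (simp add: arith_axioms_def, simp_all add: Forall_def)
  show "\<forall>a\<in>N. tm a nu = a"
    by (rule *[of "\<^bold>\<forall>\<^sub>0 a. a \<^bold>* One \<^bold>= a"]) (simp add: arith_axioms_def, simp_all add: Forall_def)
  show "\<forall>a\<in>N. tm a nz = nz"
    by (rule *[of "\<^bold>\<forall>\<^sub>0 a. a \<^bold>* Zero \<^bold>= Zero"]) (simp add: arith_axioms_def, simp_all add: Forall_def)
  show "\<forall>a\<in>N. \<forall>b\<in>N. \<forall>c\<in>N. tm a (pl b c) = pl (tm a b) (tm a c)"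
    by (rule *[of "\<^bold>\<forall>\<^sub>0 a. \<^bold>\<forall>\<^sub>0 b. \<^bold>\<forall>\<^sub>0 c. a \<^bold>* (b \<^bold>+ c) \<^bold>= a \<^bold>* b \<^bold>+ a \<^bold>* c"]) (simp add: arith_axioms_def, simp_all add: Forall_def)
  show "\<forall>a\<in>N. \<not> le a a"
    by (rule *[of "\<^bold>\<forall>\<^sub>0 a. \<^bold>\<not> (a \<^bold>< a)"]) (simp add: arith_axioms_def, simp_all add: Forall_def)
  show "\<forall>a\<in>N. \<forall>b\<in>N. \<forall>c\<in>N. le a b \<longrightarrow> le b c \<longrightarrow> le a c"
    by (rule *[of "\<^bold>\<forall>\<^sub>0 a. \<^bold>\<forall>\<^sub>0 b. \<^bold>\<forall>\<^sub>0 c. a \<^bold>< b \<^bold>\<longrightarrow> b \<^bold>< c \<^bold>\<longrightarrow> a \<^bold>< c"]) (simp add: arith_axioms_def, simp_all add: Forall_def)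
  show "\<forall>a\<in>N. \<forall>b\<in>N. le a b \<or> a = b \<or> le b a"
    by (rule *[of "\<^bold>\<forall>\<^sub>0 a. \<^bold>\<forall>\<^sub>0 b. a \<^bold>< b \<^bold>\<or> a \<^bold>= b \<^bold>\<or> b \<^bold>< a"]) (simp add: arith_axioms_def, simp add: Forall_def, auto simp: Forall_def)
  show "le nz nu" using *[of "Zero \<^bold>< One"] by (simp add: arith_axioms_def)
  show "\<forall>a\<in>N. \<forall>b\<in>N. \<forall>c\<in>N. le a b \<longrightarrow> le (pl a c) (pl b c)"
    by (rule *[of "\<^bold>\<forall>\<^sub>0 a. \<^bold>\<forall>\<^sub>0 b. \<^bold>\<forall>\<^sub>0 c. a \<^bold>< b \<^bold>\<longrightarrow> a \<^bold>+ c \<^bold>< b \<^bold>+ c"]) (simp add: arith_axioms_def, simp_all add: Forall_def)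
  show "\<forall>a\<in>N. \<forall>b\<in>N. \<forall>c\<in>N. le nz c \<longrightarrow> le a b \<longrightarrow> le (tm a c) (tm b c)"
    by (rule *[of "\<^bold>\<forall>\<^sub>0 a. \<^bold>\<forall>\<^sub>0 b. \<^bold>\<forall>\<^sub>0 c. Zero \<^bold>< c \<^bold>\<longrightarrow> a \<^bold>< b \<^bold>\<longrightarrow> a \<^bold>* c \<^bold>< b \<^bold>* c"]) (simp add: arith_axioms_def, simp_all add: Forall_def)
qed

lemma rec_facts:
  assumes "f \<in> D (TyN \<Rrightarrow> TyN \<Rrightarrow> TyN)" "m \<in> N"
  shows "ap (ap (ap (cn (Rec TyN)) f) m) nz = m"
    and "n \<in> N \<Longrightarrow> ap (ap (ap (cn (Rec TyN)) f) m) (pl n nu) = ap (ap f n) (ap (ap (ap (cn (Rec TyN)) f) m) n)"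
proof -
  have *: "\<phi> \<in> rec_axioms \<Longrightarrow> wf_fm \<phi> \<Longrightarrow> sat e0 \<phi> \<longleftrightarrow> P \<Longrightarrow> P" for \<phi> P
    using base_sat[of \<phi> e0] by (auto simp: RCA0_omega_def)
  have "\<forall>f\<in>D (TyN \<Rrightarrow> TyN \<Rrightarrow> TyN). \<forall>m\<in>N. ap (ap (ap (cn (Rec TyN)) f) m) nz = m"
    by (rule *[of "Forall (TyN \<Rrightarrow> TyN \<Rrightarrow> TyN) (\<lambda>f. \<^bold>\<forall>\<^sub>0 m. Rec TyN \<cdot> f \<cdot> m \<cdot> Zero \<^bold>= m)"]) (simp add: rec_axioms_def, simp_all add: Forall_def)
  then show "ap (ap (ap (cn (Rec TyN)) f) m) nz = m" using assms by blast
  have "\<forall>f\<in>D (TyN \<Rrightarrow> TyN \<Rrightarrow> TyN). \<forall>m\<in>N. \<forall>n\<in>N. ap (ap (ap (cn (Rec TyN)) f) m) (pl n nu) = ap (ap f n) (ap (ap (ap (cn (Rec TyN)) f) m) n)"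
    by (rule *[of "Forall (TyN \<Rrightarrow> TyN \<Rrightarrow> TyN) (\<lambda>f. \<^bold>\<forall>\<^sub>0 m. \<^bold>\<forall>\<^sub>0 n.
       Rec TyN \<cdot> f \<cdot> m \<cdot> (n \<^bold>+ One) \<^bold>= f \<cdot> n \<cdot> (Rec TyN \<cdot> f \<cdot> m \<cdot> n))"]) (simp add: rec_axioms_def, simp_all add: Forall_def)
  then show "n \<in> N \<Longrightarrow> ap (ap (ap (cn (Rec TyN)) f) m) (pl n nu) = ap (ap f n) (ap (ap (ap (cn (Rec TyN)) f) m) n)"
    using assms by blast
qed


section \<open>Predecessor, cut-off subtraction and the order of the numbers\<close>

definition "pd a = ap (ev e0 pred_tm) a"
definition "mn a b = ap (ap (ev e0 monus_tm) a) b"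

lemma ev_closed: "fv_tm t = {} \<Longrightarrow> ev e t = ev e0 t"
  by (rule ev_cong) simp

lemma ev_pd [simp]: "ap (ev e pred_tm) a = pd a"
  using ev_closed[of pred_tm e] by (simp add: pd_def)

lemma ev_mn [simp]: "ap (ap (ev e monus_tm) a) b = mn a b"
  using ev_closed[of monus_tm e] by (simp add: mn_def)

lemma pd_facts: "pd nz = nz" "n \<in> N \<Longrightarrow> pd (pl n nu) = n" "n \<in> N \<Longrightarrow> pd n \<in> N"
proof -
  have K: "cn (KK TyN TyN) \<in> D (TyN \<Rrightarrow> TyN \<Rrightarrow> TyN)" using cn_in[of "KK TyN TyN"] by simp
  show in_N: "n \<in> N \<Longrightarrow> pd n \<in> N" for n
    unfolding pd_def by (rule ap_in[of _ TyN]) simp_all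
  show "pd nz = nz" using rec_facts(1)[OF K, of nz] by (simp add: pd_def pred_tm_def)
  show "n \<in> N \<Longrightarrow> pd (pl n nu) = n"
    using rec_facts(2)[OF K, of nz n] in_N[of n] by (simp add: pd_def pred_tm_def K_eq)
qed

lemma mn_facts:
  assumes "a \<in> N"
  shows "mn a nz = a" "b \<in> N \<Longrightarrow> mn a (pl b nu) = pd (mn a b)" "b \<in> N \<Longrightarrow> mn a b \<in> N"
proof -
  let ?f = "ap (cn (KK Ty1 TyN)) (ev e0 pred_tm)"
  have f: "?f \<in> D (TyN \<Rrightarrow> TyN \<Rrightarrow> TyN)" using cn_in[of "KK Ty1 TyN"] by (auto intro: ap_in)
  have mn: "mn a b = ap (ap (ap (cn (Rec TyN)) ?f) a) b" if "b \<in> N" for b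
    using assms that ev_closed[of pred_tm "e0((Suc 0, TyN) := a)"] by (simp add: mn_def monus_tm_def Lam_def)
  show in_N: "b \<in> N \<Longrightarrow> mn a b \<in> N" for b
    unfolding mn_def using assms by (intro ap_in[of _ TyN]) simp_all
  show "mn a nz = a" using rec_facts(1)[OF f assms] by (simp add: mn)
  show "mn a (pl b nu) = pd (mn a b)" if "b \<in> N"
    using rec_facts(2)[OF f assms that] K_eq[of "ev e0 pred_tm" Ty1 b TyN] that
    by (simp add: mn)
qed

lemmas pl_assoc = arith_facts(1)[rule_format] and pl_comm = arith_facts(2)[rule_format]
  and pl_zero = arith_facts(3)[rule_format]
  and le_irrefl = arith_facts(9)[rule_format] and le_trans = arith_facts(10)[rule_format]
  and le_total = arith_facts(11)[rule_format] and zero_le_one = arith_facts(12)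
  and pl_mono = arith_facts(13)[rule_format]

lemma le_succ: "n \<in> N \<Longrightarrow> le n (pl n nu)"
  using pl_mono[of nz nu n] zero_le_one pl_comm[of n nz] pl_comm[of n nu] pl_zero[of n] by simp

lemma nonneg: "n \<in> N \<Longrightarrow> \<not> le n nz"
proof -
  let ?\<phi> = "FNeg (Less (Var 0 TyN) Zero)"
  assume n: "n \<in> N"
  have "sat (e0((0, TyN) := n)) ?\<phi>"
  proof (rule QF_induct[of ?\<phi>])
    show "sat (e0((0, TyN) := nz)) ?\<phi>" using le_irrefl[of nz] by simp
    show "sat (e0((0, TyN) := pl d nu)) ?\<phi>" if "d \<in> N" "sat (e0((0, TyN) := d)) ?\<phi>" for d
      using that le_succ[of d] le_trans[of d "pl d nu" nz] by auto
  qed (use n in auto)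
  then show ?thesis by simp
qed

lemma pd_succ: "n \<in> N \<Longrightarrow> n = nz \<or> pl (pd n) nu = n"
proof -
  let ?\<phi> = "FOr (Eq (Var 0 TyN) Zero) (Eq (pred_tm \<cdot> Var 0 TyN \<^bold>+ One) (Var 0 TyN))"
  assume n: "n \<in> N"
  have "sat (e0((0, TyN) := n)) ?\<phi>"
    by (rule QF_induct[of ?\<phi>]) (use n in \<open>auto simp: pd_facts\<close>)
  then show ?thesis by simp
qed

text \<open>The axioms give no differences, but recursion gives cut-off subtraction. This
  disjunction is quantifier-free and so accessible to the induction schema, unlike the existence of
  a difference, which follows from it in \<open>subtract\<close>.\<close>

lemma mn_cases: "a \<in> N \<Longrightarrow> b \<in> N \<Longrightarrow> pl (mn a b) b = a \<or> mn a b = nz \<and> le a b"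
proof -
  let ?e = "e0((1, TyN) := a)"
  let ?m = "monus_tm \<cdot> Var 1 TyN \<cdot> Var 0 TyN"
  let ?\<phi> = "FOr (Eq (?m \<^bold>+ Var 0 TyN) (Var 1 TyN)) (FAnd (Eq ?m Zero) (Less (Var 1 TyN) (Var 0 TyN)))"
  assume a: "a \<in> N" and b: "b \<in> N"
  have "sat (?e((0, TyN) := b)) ?\<phi>"
  proof (rule QF_induct[of ?\<phi>])
    show "sat (?e((0, TyN) := nz)) ?\<phi>" using a by (simp add: mn_facts pl_zero)
    fix d assume d: "d \<in> N" and "sat (?e((0, TyN) := d)) ?\<phi>"
    then have IH: "pl (mn a d) d = a \<or> mn a d = nz \<and> le a d" by simp
    have m: "mn a d \<in> N" "mn a (pl d nu) = pd (mn a d)" using mn_facts[OF a] d by auto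
    have "pl (mn a (pl d nu)) (pl d nu) = a \<or> mn a (pl d nu) = nz \<and> le a (pl d nu)"
    proof (cases "mn a d = nz")
      case True
      then have "a = d \<or> le a d" using IH pl_comm[of nz d] pl_zero[OF d] d by auto
      then have "le a (pl d nu)" using le_succ[OF d] le_trans[of a d "pl d nu"] a d by auto
      then show ?thesis using True m pd_facts by simp
    next
      case False
      then have "pl (pd (mn a d)) nu = mn a d" "pl (mn a d) d = a" using pd_succ m IH by auto
      moreover have "pl (pd (mn a d)) (pl d nu) = pl (pl (pd (mn a d)) nu) d"
        using pl_assoc pl_comm[of d nu] d pd_facts(3)[OF m(1)] by simp
      ultimately show ?thesis using m by simp
    qed
    then show "sat (?e((0, TyN) := pl d nu)) ?\<phi>" by simp
  qed (use a b in auto)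
  then show ?thesis by simp
qed

lemma subtract: "a \<in> N \<Longrightarrow> b \<in> N \<Longrightarrow> le a b \<Longrightarrow> \<exists>c\<in>N. b = pl a c"
proof -
  assume *: "a \<in> N" "b \<in> N" "le a b"
  have "\<not> le b a" using le_trans[of a b a] le_irrefl[of a] * by blast
  then have "pl (mn b a) a = b" using mn_cases[of b a] * by blast
  then show ?thesis using mn_facts(3)[of b a] pl_comm[of "mn b a" a] * by metis
qed

end

section \<open>The coding terms are closed and well typed\<close>

lemma vmax_pred_monus [simp]: "vmax_tm pred_tm = 0" "vmax_tm monus_tm = 0"
  by (simp_all add: vmax_closed)

lemma exp2_tm_typed [simp]:
  "fv_tm exp2_tm = {}" "vmax_tm exp2_tm = 0" "ty_of exp2_tm = Ty1" "wf_tm exp2_tm"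
proof -
  show "fv_tm exp2_tm = {}" by (auto simp: exp2_tm_def Lam_def)
  then show "vmax_tm exp2_tm = 0" by (rule vmax_closed)
qed (simp_all add: exp2_tm_def Lam_def)

lemma isqrt_tm_typed [simp]:
  "fv_tm isqrt_tm = {}" "vmax_tm isqrt_tm = 0" "ty_of isqrt_tm = Ty1" "wf_tm isqrt_tm"
proof -
  show "fv_tm isqrt_tm = {}" by (auto simp: isqrt_tm_def Lam_def)
  then show "vmax_tm isqrt_tm = 0" by (rule vmax_closed)
qed (simp_all add: isqrt_tm_def Lam_def)

lemma pair_tm_typed [simp]:
  "fv_tm pair_tm = {}" "vmax_tm pair_tm = 0" "ty_of pair_tm = TyN \<Rrightarrow> Ty1" "wf_tm pair_tm"
proof -
  show "fv_tm pair_tm = {}" by (auto simp: pair_tm_def Lam_def)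
  then show "vmax_tm pair_tm = 0" by (rule vmax_closed)
qed (simp_all add: pair_tm_def Lam_def)

lemma fst_tm_typed [simp]:
  "fv_tm fst_tm = {}" "vmax_tm fst_tm = 0" "ty_of fst_tm = Ty1" "wf_tm fst_tm"
proof -
  show "fv_tm fst_tm = {}" by (auto simp: fst_tm_def Lam_def)
  then show "vmax_tm fst_tm = 0" by (rule vmax_closed)
qed (simp_all add: fst_tm_def Lam_def)

lemma snd_tm_typed [simp]:
  "fv_tm snd_tm = {}" "vmax_tm snd_tm = 0" "ty_of snd_tm = Ty1" "wf_tm snd_tm"
proof -
  show "fv_tm snd_tm = {}" by (auto simp: snd_tm_def Lam_def)
  then show "vmax_tm snd_tm = 0" by (rule vmax_closed)
qed (simp_all add: snd_tm_def Lam_def)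

lemma rat_tm_typed [simp]:
  "fv_tm rat_tm = {}" "vmax_tm rat_tm = 0" "ty_of rat_tm = TyN \<Rrightarrow> TyN \<Rrightarrow> Ty1" "wf_tm rat_tm"
proof -
  show "fv_tm rat_tm = {}" by (auto simp: rat_tm_def Lam_def)
  then show "vmax_tm rat_tm = 0" by (rule vmax_closed)
qed (simp_all add: rat_tm_def Lam_def)

lemma pos_tm_typed [simp]:
  "fv_tm pos_tm = {}" "vmax_tm pos_tm = 0" "ty_of pos_tm = Ty1" "wf_tm pos_tm"
proof -
  show "fv_tm pos_tm = {}" by (auto simp: pos_tm_def Lam_def)
  then show "vmax_tm pos_tm = 0" by (rule vmax_closed)
qed (simp_all add: pos_tm_def Lam_def)

lemma neg_tm_typed [simp]:
  "fv_tm neg_tm = {}" "vmax_tm neg_tm = 0" "ty_of neg_tm = Ty1" "wf_tm neg_tm"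
proof -
  show "fv_tm neg_tm = {}" by (auto simp: neg_tm_def Lam_def)
  then show "vmax_tm neg_tm = 0" by (rule vmax_closed)
qed (simp_all add: neg_tm_def Lam_def)

lemma den_tm_typed [simp]:
  "fv_tm den_tm = {}" "vmax_tm den_tm = 0" "ty_of den_tm = Ty1" "wf_tm den_tm"
proof -
  show "fv_tm den_tm = {}" by (auto simp: den_tm_def Lam_def)
  then show "vmax_tm den_tm = 0" by (rule vmax_closed)
qed (simp_all add: den_tm_def Lam_def)

lemma cross_tm_typed [simp]:
  "fv_tm cross_tm = {}" "vmax_tm cross_tm = 0" "ty_of cross_tm = TyN \<Rrightarrow> Ty1" "wf_tm cross_tm"
proof -
  show "fv_tm cross_tm = {}" by (auto simp: cross_tm_def Lam_def)
  then show "vmax_tm cross_tm = 0" by (rule vmax_closed)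
qed (simp_all add: cross_tm_def Lam_def)

lemma qadd_tm_typed [simp]:
  "fv_tm qadd_tm = {}" "vmax_tm qadd_tm = 0" "ty_of qadd_tm = TyN \<Rrightarrow> Ty1" "wf_tm qadd_tm"
proof -
  show "fv_tm qadd_tm = {}" by (auto simp: qadd_tm_def Lam_def)
  then show "vmax_tm qadd_tm = 0" by (rule vmax_closed)
qed (simp_all add: qadd_tm_def Lam_def)

lemma qdist_tm_typed [simp]:
  "fv_tm qdist_tm = {}" "vmax_tm qdist_tm = 0" "ty_of qdist_tm = TyN \<Rrightarrow> Ty1" "wf_tm qdist_tm"
proof -
  show "fv_tm qdist_tm = {}" by (auto simp: qdist_tm_def Lam_def)
  then show "vmax_tm qdist_tm = 0" by (rule vmax_closed)
qed (simp_all add: qdist_tm_def Lam_def)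

lemma rdist_tm_typed [simp]:
  "fv_tm rdist_tm = {}" "vmax_tm rdist_tm = 0" "ty_of rdist_tm = Ty1 \<Rrightarrow> Ty1 \<Rrightarrow> Ty1" "wf_tm rdist_tm"
proof -
  show "fv_tm rdist_tm = {}" by (auto simp: rdist_tm_def Lam_def)
  then show "vmax_tm rdist_tm = 0" by (rule vmax_closed)
qed (simp_all add: rdist_tm_def Lam_def)

section \<open>Embedding the numbers of a model into an ordered field\<close>

text \<open>The field is kept abstract: the analysis rests on these laws of the embedding, and the
  field of fractions appears only when the final theorem instantiates the locale.\<close>

locale field_model = base_model +
  fixes \<iota> :: "'a \<Rightarrow> 'k::linordered_field"
  assumes i_zero [simp]: "\<iota> nz = 0" and i_one [simp]: "\<iota> nu = 1"
    and i_pl [simp]: "a \<in> N \<Longrightarrow> b \<in> N \<Longrightarrow> \<iota> (pl a b) = \<iota> a + \<iota> b"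
    and i_tm [simp]: "a \<in> N \<Longrightarrow> b \<in> N \<Longrightarrow> \<iota> (tm a b) = \<iota> a * \<iota> b"
    and i_le [simp]: "a \<in> N \<Longrightarrow> b \<in> N \<Longrightarrow> le a b \<longleftrightarrow> \<iota> a < \<iota> b"
    and i_inj: "a \<in> N \<Longrightarrow> b \<in> N \<Longrightarrow> a = b \<longleftrightarrow> \<iota> a = \<iota> b"
begin

lemma i_nonneg [simp]: "a \<in> N \<Longrightarrow> 0 \<le> \<iota> a"
  using nonneg[of a] by simp

lemma pd_in [simp]: "a \<in> N \<Longrightarrow> pd a \<in> N" by (rule pd_facts)
lemma mn_in [simp]: "a \<in> N \<Longrightarrow> b \<in> N \<Longrightarrow> mn a b \<in> N" by (rule mn_facts)

lemma i_pd: "a \<in> N \<Longrightarrow> \<iota> (pd a) = (if \<iota> a = 0 then 0 else \<iota> a - 1)"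
  using pd_succ[of a] pd_facts(1) i_inj[of a nz] i_pl[of "pd a" nu] by fastforce

lemma i_pos: "a \<in> N \<Longrightarrow> 0 < \<iota> a \<Longrightarrow> 1 \<le> \<iota> a"
  using i_pd[of a] i_nonneg[of "pd a"] by auto

text \<open>The field is dense; only images of numbers are discrete. A strict inequality between
  them is sharpened by 1 in this way before linear arithmetic takes over.\<close>

lemma i_discrete: "a \<in> N \<Longrightarrow> b \<in> N \<Longrightarrow> \<iota> a < \<iota> b \<longleftrightarrow> \<iota> a + 1 \<le> \<iota> b"
proof
  assume *: "a \<in> N" "b \<in> N" "\<iota> a < \<iota> b"
  then obtain c where "c \<in> N" "b = pl a c" using subtract[of a b] by auto
  then show "\<iota> a + 1 \<le> \<iota> b" using * i_pos[of c] by simp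
qed simp

lemma i_mn: "a \<in> N \<Longrightarrow> b \<in> N \<Longrightarrow> \<iota> (mn a b) = max 0 (\<iota> a - \<iota> b)"
proof -
  assume *: "a \<in> N" "b \<in> N"
  have m: "mn a b \<in> N" using * by simp
  consider "pl (mn a b) b = a" | "mn a b = nz" "\<iota> a < \<iota> b" using mn_cases[OF *] * by auto
  then show ?thesis
  proof cases
    case 1
    then have "\<iota> (mn a b) + \<iota> b = \<iota> a" using i_pl[OF m *(2)] by simp
    then show ?thesis using i_nonneg[OF m] by (simp add: max_def algebra_simps)
  qed simp
qed

lemma QF_ind:
  assumes "wf_fm \<phi>" "qfree \<phi>" "valid e" and sat: "\<And>d. d \<in> N \<Longrightarrow> sat (e((n, TyN) := d)) \<phi> \<longleftrightarrow> P d"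
    and "P nz" "\<And>d. d \<in> N \<Longrightarrow> P d \<Longrightarrow> P (pl d nu)" "d \<in> N"
  shows "P d"
  using QF_induct[OF assms(1-3), of n d] assms(4-7) by simp

section \<open>Powers of two, square roots, pairs and coded rationals\<close>

definition "ex2 n = ap (ev e0 exp2_tm) n"
definition "isq n = ap (ev e0 isqrt_tm) n"
definition "pr a b = ap (ap (ev e0 pair_tm) a) b"
definition "fs p = ap (ev e0 fst_tm) p"
definition "sn p = ap (ev e0 snd_tm) p"
definition "rt a b c = ap (ap (ap (ev e0 rat_tm) a) b) c"
definition "po p = ap (ev e0 pos_tm) p"
definition "ne p = ap (ev e0 neg_tm) p"
definition "de p = ap (ev e0 den_tm) p"
definition "cr p q = ap (ap (ev e0 cross_tm) p) q"
definition "qa p q = ap (ap (ev e0 qadd_tm) p) q"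
definition "qd p q = ap (ap (ev e0 qdist_tm) p) q"

lemma ev_coding [simp]:
  "ap (ev e exp2_tm) n = ex2 n"
  "ap (ev e isqrt_tm) n = isq n"
  "ap (ap (ev e pair_tm) a) b = pr a b"
  "ap (ev e fst_tm) p = fs p"
  "ap (ev e snd_tm) p = sn p"
  "ap (ap (ap (ev e rat_tm) a) b) c = rt a b c"
  "ap (ev e pos_tm) p = po p"
  "ap (ev e neg_tm) p = ne p"
  "ap (ev e den_tm) p = de p"
  "ap (ap (ev e cross_tm) p) q = cr p q"
  "ap (ap (ev e qadd_tm) p) q = qa p q"
  "ap (ap (ev e qdist_tm) p) q = qd p q"
  unfolding ex2_def isq_def pr_def fs_def sn_def rt_def po_def ne_def de_def cr_def qa_def qd_def
  by (simp_all add: ev_closed[of _ e])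

lemma ap1: "ty_of t = \<sigma> \<Rrightarrow> \<tau> \<Longrightarrow> wf_tm t \<Longrightarrow> a \<in> D \<sigma> \<Longrightarrow> ap (ev e0 t) a \<in> D \<tau>"
  by (rule ap_in[of _ \<sigma>]) auto

lemma ap2: "ty_of t = \<sigma> \<Rrightarrow> \<rho> \<Rrightarrow> \<tau> \<Longrightarrow> wf_tm t \<Longrightarrow> a \<in> D \<sigma> \<Longrightarrow> b \<in> D \<rho> \<Longrightarrow> ap (ap (ev e0 t) a) b \<in> D \<tau>"
  by (rule ap_in[OF ap1])

lemma ap3: "ty_of t = \<sigma> \<Rrightarrow> \<rho> \<Rrightarrow> \<upsilon> \<Rrightarrow> \<tau> \<Longrightarrow> wf_tm t \<Longrightarrow> a \<in> D \<sigma> \<Longrightarrow> b \<in> D \<rho> \<Longrightarrow> c \<in> D \<upsilon> \<Longrightarrow>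
    ap (ap (ap (ev e0 t) a) b) c \<in> D \<tau>"
  by (rule ap_in[OF ap2])

lemma coding_in [simp]:
  "n \<in> N \<Longrightarrow> ex2 n \<in> N" "n \<in> N \<Longrightarrow> isq n \<in> N" "n \<in> N \<Longrightarrow> fs n \<in> N" "n \<in> N \<Longrightarrow> sn n \<in> N"
  "n \<in> N \<Longrightarrow> po n \<in> N" "n \<in> N \<Longrightarrow> ne n \<in> N" "n \<in> N \<Longrightarrow> de n \<in> N"
  "n \<in> N \<Longrightarrow> m \<in> N \<Longrightarrow> pr n m \<in> N" "n \<in> N \<Longrightarrow> m \<in> N \<Longrightarrow> cr n m \<in> N" "n \<in> N \<Longrightarrow> m \<in> N \<Longrightarrow> qa n m \<in> N"
  "n \<in> N \<Longrightarrow> m \<in> N \<Longrightarrow> qd n m \<in> N" "n \<in> N \<Longrightarrow> m \<in> N \<Longrightarrow> l \<in> N \<Longrightarrow> rt n m l \<in> N"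
  unfolding ex2_def isq_def pr_def fs_def sn_def rt_def po_def ne_def de_def cr_def qa_def qd_def
  by (rule ap1[of _ TyN] ap2[of _ TyN TyN] ap3[of _ TyN TyN TyN]; simp)+

lemma Rec_simps:
  assumes "valid e" "wf_tm t" "ty_of t = TyN \<Rrightarrow> TyN \<Rrightarrow> TyN" "m \<in> N"
  shows "ap (ap (ap (cn (Rec TyN)) (ev e t)) m) nz = m"
    and "n \<in> N \<Longrightarrow> ap (ap (ap (cn (Rec TyN)) (ev e t)) m) (pl n nu) =
      ap (ap (ev e t) n) (ap (ap (ap (cn (Rec TyN)) (ev e t)) m) n)"
  using rec_facts[of "ev e t" m] assms by auto

lemma i_ex2: "\<iota> (ex2 nz) = 1" "n \<in> N \<Longrightarrow> \<iota> (ex2 (pl n nu)) = 2 * \<iota> (ex2 n)"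
proof -
  let ?t = "\<^bold>\<lambda>\<^sub>0 n. \<^bold>\<lambda>\<^sub>0 k. k \<^bold>+ k"
  have t: "wf_tm ?t" "ty_of ?t = TyN \<Rrightarrow> TyN \<Rrightarrow> TyN" by (simp_all add: Lam_def)
  have ex2: "ex2 n = ap (ap (ap (cn (Rec TyN)) (ev e0 ?t)) nu) n" for n
    by (simp add: ex2_def exp2_tm_def)
  show "\<iota> (ex2 nz) = 1" using Rec_simps(1)[OF valid_e0 t, of nu] by (simp add: ex2)
  assume n: "n \<in> N"
  have "ex2 (pl n nu) = ap (ap (ev e0 ?t) n) (ex2 n)"
    using Rec_simps(2)[OF valid_e0 t, of nu n] n by (simp add: ex2)
  also have "\<dots> = pl (ex2 n) (ex2 n)" using n by (simp add: Lam_def)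
  finally show "\<iota> (ex2 (pl n nu)) = 2 * \<iota> (ex2 n)" using n by simp
qed

lemma ex2_gt: "n \<in> N \<Longrightarrow> \<iota> n < \<iota> (ex2 n)"
  apply (rule QF_ind[of "Less (Var 0 TyN) (exp2_tm \<cdot> Var 0 TyN)" e0 0 "\<lambda>n. \<iota> n < \<iota> (ex2 n)"])
        apply (simp_all add: i_ex2)
  subgoal for d using i_discrete[of d "ex2 d"] i_nonneg[of d] coding_in(1)[of d] by linarith
  done

lemma ex2_pos [simp]: "n \<in> N \<Longrightarrow> 0 < \<iota> (ex2 n)" "n \<in> N \<Longrightarrow> \<iota> (ex2 n) \<noteq> 0"
proof -
  show "n \<in> N \<Longrightarrow> 0 < \<iota> (ex2 n)" using ex2_gt[of n] i_nonneg[of n] by linarith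
  then show "n \<in> N \<Longrightarrow> \<iota> (ex2 n) \<noteq> 0" by force
qed

lemma ex2_ge1: "n \<in> N \<Longrightarrow> 1 \<le> \<iota> (ex2 n)"
  using i_pos[of "ex2 n"] by simp

lemma ex2_add: "n \<in> N \<Longrightarrow> m \<in> N \<Longrightarrow> \<iota> (ex2 (pl n m)) = \<iota> (ex2 n) * \<iota> (ex2 m)"
proof -
  assume n: "n \<in> N" and m: "m \<in> N"
  have assoc: "pl n (pl d nu) = pl (pl n d) nu" if "d \<in> N" for d using n that by (simp add: i_inj)
  show ?thesis
    by (rule QF_ind[of "Eq (exp2_tm \<cdot> (Var 1 TyN \<^bold>+ Var 0 TyN)) ((exp2_tm \<cdot> Var 1 TyN) \<^bold>* (exp2_tm \<cdot> Var 0 TyN))"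
         "e0((1, TyN) := n)" 0 _ m])
       (use n m in \<open>simp_all add: i_inj i_ex2 assoc pl_zero\<close>)
qed

lemma ex2_mono: "n \<in> N \<Longrightarrow> m \<in> N \<Longrightarrow> \<iota> n \<le> \<iota> m \<Longrightarrow> \<iota> (ex2 n) \<le> \<iota> (ex2 m)"
proof -
  assume *: "n \<in> N" "m \<in> N" "\<iota> n \<le> \<iota> m"
  then have "m = n \<or> (\<exists>c\<in>N. m = pl n c)" using subtract[of n m] i_inj[of m n] by fastforce
  then show ?thesis using * ex2_ge1 by (auto simp: ex2_add)
qed

lemma i_isq:
  assumes "n \<in> N"
  shows "\<iota> (isq n) * \<iota> (isq n) \<le> \<iota> n \<and> \<iota> n < (\<iota> (isq n) + 1) * (\<iota> (isq n) + 1)"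
proof -
  let ?t = "\<^bold>\<lambda>\<^sub>0 n. \<^bold>\<lambda>\<^sub>0 k. k \<^bold>+ (One \<^bold>- ((k \<^bold>+ One) \<^bold>* (k \<^bold>+ One) \<^bold>- (n \<^bold>+ One)))"
  have t: "wf_tm ?t" "ty_of ?t = TyN \<Rrightarrow> TyN \<Rrightarrow> TyN" by (simp_all add: Lam_def)
  have isq: "isq n = ap (ap (ap (cn (Rec TyN)) (ev e0 ?t)) nz) n" for n
    by (simp add: isq_def isqrt_tm_def)
  have z: "isq nz = nz" using Rec_simps(1)[OF valid_e0 t, of nz] by (simp add: isq)
  have s: "\<iota> (isq (pl n nu)) = (if (\<iota> (isq n) + 1) * (\<iota> (isq n) + 1) \<le> \<iota> n + 1 then \<iota> (isq n) + 1 else \<iota> (isq n))"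
    if n: "n \<in> N" for n
  proof -
    let ?k = "isq n"
    have "isq (pl n nu) = ap (ap (ev e0 ?t) n) ?k"
      using Rec_simps(2)[OF valid_e0 t, of nz n] n by (simp add: isq)
    also have "\<dots> = pl ?k (mn nu (mn (tm (pl ?k nu) (pl ?k nu)) (pl n nu)))" using n by (simp add: Lam_def)
    finally have "\<iota> (isq (pl n nu)) = \<iota> ?k + max 0 (1 - max 0 ((\<iota> ?k + 1) * (\<iota> ?k + 1) - (\<iota> n + 1)))"
      using n by (simp add: i_mn)
    \<comment> \<open>The inner truncated difference is 0 or at least 1, so the outer one is exactly
      the increment 1 or 0.\<close>
    moreover have "\<iota> n + 1 < (\<iota> ?k + 1) * (\<iota> ?k + 1) \<Longrightarrow> 1 \<le> (\<iota> ?k + 1) * (\<iota> ?k + 1) - (\<iota> n + 1)"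
      using i_discrete[of "pl n nu" "tm (pl ?k nu) (pl ?k nu)"] n by simp
    ultimately show ?thesis by auto
  qed
  let ?i = "isqrt_tm \<cdot> Var 0 TyN"
  let ?\<phi> = "FAnd (FNeg (Less (Var 0 TyN) (?i \<^bold>* ?i))) (Less (Var 0 TyN) ((?i \<^bold>+ One) \<^bold>* (?i \<^bold>+ One)))"
  show ?thesis
  proof (rule QF_ind[of ?\<phi> e0 0 "\<lambda>n. \<iota> (isq n) * \<iota> (isq n) \<le> \<iota> n \<and> \<iota> n < (\<iota> (isq n) + 1) * (\<iota> (isq n) + 1)" n])
    fix d assume d: "d \<in> N" and IH: "\<iota> (isq d) * \<iota> (isq d) \<le> \<iota> d \<and> \<iota> d < (\<iota> (isq d) + 1) * (\<iota> (isq d) + 1)"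
    have "\<iota> d + 1 \<le> (\<iota> (isq d) + 1) * (\<iota> (isq d) + 1)"
      using i_discrete[of d "tm (pl (isq d) nu) (pl (isq d) nu)"] IH d by simp
    moreover have "0 \<le> \<iota> (isq d)" using d by simp
    ultimately show "\<iota> (isq (pl d nu)) * \<iota> (isq (pl d nu)) \<le> \<iota> (pl d nu) \<and>
        \<iota> (pl d nu) < (\<iota> (isq (pl d nu)) + 1) * (\<iota> (isq (pl d nu)) + 1)"
      using IH s[OF d] d by (auto simp: algebra_simps)
  qed (use assms in \<open>auto simp: z not_less\<close>)
qed

lemma isq_unique:
  assumes "n \<in> N" "k \<in> N" "\<iota> k * \<iota> k \<le> \<iota> n" "\<iota> n < (\<iota> k + 1) * (\<iota> k + 1)"
  shows "isq n = k"
proof -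
  have i: "isq n \<in> N" using assms by simp
  have "\<not> \<iota> (isq n) + 1 \<le> \<iota> k"
  proof
    assume "\<iota> (isq n) + 1 \<le> \<iota> k"
    then have "(\<iota> (isq n) + 1) * (\<iota> (isq n) + 1) \<le> \<iota> k * \<iota> k" using i assms by (intro mult_mono) auto
    then show False using i_isq[OF assms(1)] assms(3) by linarith
  qed
  moreover have "\<not> \<iota> k + 1 \<le> \<iota> (isq n)"
  proof
    assume "\<iota> k + 1 \<le> \<iota> (isq n)"
    then have "(\<iota> k + 1) * (\<iota> k + 1) \<le> \<iota> (isq n) * \<iota> (isq n)" using i assms by (intro mult_mono) auto
    then show False using i_isq[OF assms(1)] assms(4) by linarith
  qed
  ultimately show ?thesis using i_discrete i assms(2) i_inj by (metis linorder_neqE)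
qed

lemma pr_eq: "a \<in> N \<Longrightarrow> b \<in> N \<Longrightarrow> pr a b = pl (tm (pl a b) (pl a b)) a"
  by (simp add: pr_def pair_tm_def Lam_def)

lemma fs_eq: "p \<in> N \<Longrightarrow> fs p = mn p (tm (isq p) (isq p))"
  by (simp add: fs_def fst_tm_def Lam_def)

lemma sn_eq: "p \<in> N \<Longrightarrow> sn p = mn (isq p) (fs p)"
  by (simp add: sn_def snd_tm_def Lam_def)

text \<open>The code (a + b)^2 + a lies below (a + b + 1)^2, so its integer square root is a + b,
  and a is what remains after the square is removed.\<close>

lemma pairing [simp]:
  assumes "a \<in> N" "b \<in> N"
  shows "fs (pr a b) = a" "sn (pr a b) = b"
proof -
  have ab: "0 \<le> \<iota> a" "0 \<le> \<iota> b" using assms by auto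
  have pos: "0 < 1 + (\<iota> a + \<iota> b * 2)" using ab by linarith
  have i: "isq (pr a b) = pl a b"
    by (rule isq_unique) (use assms ab pos in \<open>auto simp: pr_eq algebra_simps\<close>)
  show f: "fs (pr a b) = a"
    using assms ab by (simp add: fs_eq i i_inj i_mn) (simp add: pr_eq)
  show "sn (pr a b) = b"
    using assms ab by (simp add: sn_eq i f i_inj i_mn)
qed

lemma rt_eq: "a \<in> N \<Longrightarrow> b \<in> N \<Longrightarrow> c \<in> N \<Longrightarrow> rt a b c = pr (pr a b) c"
  by (simp add: rt_def rat_tm_def Lam_def)

lemma pnd_eq:
  assumes "p \<in> N"
  shows "po p = fs (fs p)" "ne p = sn (fs p)" "de p = pl (sn p) nu"
  using assms by (simp_all add: po_def ne_def de_def pos_tm_def neg_tm_def den_tm_def Lam_def)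

definition val :: "'a \<Rightarrow> 'k" where "val p = (\<iota> (po p) - \<iota> (ne p)) / \<iota> (de p)"

lemma de_pos [simp]: "p \<in> N \<Longrightarrow> 0 < \<iota> (de p)" "p \<in> N \<Longrightarrow> \<iota> (de p) \<noteq> 0"
  using i_nonneg[of "sn p"] by (simp_all add: pnd_eq add_nonneg_pos add_nonneg_eq_0_iff)

lemma i_pd_pos: "a \<in> N \<Longrightarrow> 0 < \<iota> a \<Longrightarrow> \<iota> (pd a) + 1 = \<iota> a"
  by (simp add: i_pd)

lemma val_rt: "a \<in> N \<Longrightarrow> b \<in> N \<Longrightarrow> c \<in> N \<Longrightarrow> val (rt a b c) = (\<iota> a - \<iota> b) / (\<iota> c + 1)"
  by (simp add: val_def rt_eq pnd_eq)

lemma cr_eq: "p \<in> N \<Longrightarrow> q \<in> N \<Longrightarrow> cr p q = pl (tm (po p) (de q)) (tm (ne q) (de p))"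
  by (simp add: cr_def cross_tm_def Lam_def)

lemma cr_val: "p \<in> N \<Longrightarrow> q \<in> N \<Longrightarrow> \<iota> (cr p q) - \<iota> (cr q p) = (val p - val q) * (\<iota> (de p) * \<iota> (de q))"
  by (simp add: cr_eq val_def field_simps)

lemma cr_less: "p \<in> N \<Longrightarrow> q \<in> N \<Longrightarrow> \<iota> (cr p q) < \<iota> (cr q p) \<longleftrightarrow> val p < val q"
proof -
  assume *: "p \<in> N" "q \<in> N"
  have "0 < \<iota> (de p) * \<iota> (de q)" using * by simp
  then have "(val p - val q) * (\<iota> (de p) * \<iota> (de q)) < 0 \<longleftrightarrow> val p - val q < 0"
    by (meson mult_less_0_iff less_asym)
  then show ?thesis using cr_val[OF *] by (metis diff_less_0_iff_less)
qed

lemma cr_eq_iff: "p \<in> N \<Longrightarrow> q \<in> N \<Longrightarrow> cr p q = cr q p \<longleftrightarrow> val p = val q"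
  using cr_val[of p q] by (simp add: i_inj) (metis de_pos(2) mult_eq_0_iff right_minus_eq)

lemma val_qa: "p \<in> N \<Longrightarrow> q \<in> N \<Longrightarrow> val (qa p q) = val p + val q"
proof -
  assume *: "p \<in> N" "q \<in> N"
  have "qa p q = rt (pl (tm (po p) (de q)) (tm (po q) (de p))) (pl (tm (ne p) (de q)) (tm (ne q) (de p)))
      (pd (tm (de p) (de q)))" using * by (simp add: qa_def qadd_tm_def Lam_def)
  then show ?thesis using * i_pd_pos[of "tm (de p) (de q)"] by (simp add: val_rt) (simp add: val_def field_simps)
qed

lemma val_qd: "p \<in> N \<Longrightarrow> q \<in> N \<Longrightarrow> val (qd p q) = \<bar>val p - val q\<bar>"
proof -
  assume *: "p \<in> N" "q \<in> N"
  have "qd p q = rt (pl (mn (cr p q) (cr q p)) (mn (cr q p) (cr p q))) nz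
      (pd (tm (de p) (de q)))" using * by (simp add: qd_def qdist_tm_def Lam_def)
  then have "val (qd p q) = \<bar>\<iota> (cr p q) - \<iota> (cr q p)\<bar> / (\<iota> (de p) * \<iota> (de q))"
    using * i_pd_pos[of "tm (de p) (de q)"] by (simp add: val_rt i_mn max_def abs_if)
  then show ?thesis using * by (simp add: cr_val abs_mult)
qed

end

section \<open>The meaning of the coded analysis\<close>

text \<open>Freshness of an outer index is proved by peeling off binders: an index above a
  quantified formula is above its body at some variable, hence above every fixed term in that
  body.\<close>

lemma vmax_Forall_dest: "vmax (Forall \<sigma> F) < x \<Longrightarrow> \<exists>k. vmax (F (Var k \<sigma>)) < x"
  by (auto simp: Forall_def Let_def)

lemma vmax_Exists_dest: "vmax (Exists \<sigma> F) < x \<Longrightarrow> \<exists>k. vmax (F (Var k \<sigma>)) < x"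
  by (auto simp: Exists_def Let_def)

lemma vmax_q [simp]:
  "vmax (q_less p q) = max (vmax_tm p) (vmax_tm q)" "vmax (q_le p q) = max (vmax_tm p) (vmax_tm q)"
  by (auto simp: q_less_def q_le_def)

lemma vmax_tm_abbrevs [simp]: "vmax_tm (eps k) = vmax_tm k" "vmax_tm (eps2 k) = vmax_tm k" "vmax_tm (const_real k) = vmax_tm k"
  by (auto simp: eps_def eps2_def const_real_def)

lemma vmax_is_real: "vmax (is_real t) < x \<Longrightarrow> vmax_tm t < x"
  unfolding is_real_def by (auto dest!: vmax_Forall_dest)
lemma vmax_r_eq: "vmax (r_eq s t) < x \<Longrightarrow> vmax_tm s < x \<and> vmax_tm t < x"
  unfolding r_eq_def by (auto dest!: vmax_Forall_dest)
lemma vmax_r_less: "vmax (r_less s t) < x \<Longrightarrow> vmax_tm s < x \<and> vmax_tm t < x"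
  unfolding r_less_def by (auto dest!: vmax_Exists_dest)
lemma vmax_r_le: "vmax (r_le s t) < x \<Longrightarrow> vmax_tm s < x \<and> vmax_tm t < x"
  unfolding r_le_def by (auto dest!: vmax_r_less)
lemma vmax_dist_less: "vmax (dist_less k s t) < x \<Longrightarrow> vmax_tm k < x \<and> vmax_tm s < x \<and> vmax_tm t < x"
  unfolding dist_less_def by (auto dest!: vmax_r_less)
lemma vmax_in_unit: "vmax (in_unit t) < x \<Longrightarrow> vmax_tm t < x"
  unfolding in_unit_def by (auto dest!: vmax_is_real)
lemma vmax_forall_real: "vmax (forall_real F) < x \<Longrightarrow> \<exists>k. vmax (F (Var k Ty1)) < x"
  unfolding forall_real_def by (auto dest!: vmax_Forall_dest)
lemma vmax_exists_real: "vmax (exists_real F) < x \<Longrightarrow> \<exists>k. vmax (F (Var k Ty1)) < x"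
  unfolding exists_real_def by (auto dest!: vmax_Exists_dest)
lemma vmax_forall_unit: "vmax (forall_unit F) < x \<Longrightarrow> \<exists>k. vmax (F (Var k Ty1)) < x"
  unfolding forall_unit_def by (auto dest!: vmax_Forall_dest)
lemma vmax_exists_unit: "vmax (exists_unit F) < x \<Longrightarrow> \<exists>k. vmax (F (Var k Ty1)) < x"
  unfolding exists_unit_def by (auto dest!: vmax_Exists_dest)
lemma vmax_set_mem [simp]: "vmax (set_mem s t) = max (vmax_tm s) (vmax_tm t)"
  by (simp add: set_mem_def max.commute)

lemmas vmax_dests = vmax_Forall_dest vmax_Exists_dest vmax_is_real vmax_r_eq vmax_r_less vmax_r_le vmax_dist_less vmax_in_unit
  vmax_forall_real vmax_exists_real vmax_forall_unit vmax_exists_unit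

lemma vmax_sets:
  "vmax (fun_unit_nat t) < x \<Longrightarrow> vmax_tm t < x"
  "vmax (fun_unit_real t) < x \<Longrightarrow> vmax_tm t < x"
  "vmax (real_set t) < x \<Longrightarrow> vmax_tm t < x"
  "vmax (closed_set t) < x \<Longrightarrow> vmax_tm t < x"
  "vmax (no_isolated_points t) < x \<Longrightarrow> vmax_tm t < x"
  "vmax (nonempty_set t) < x \<Longrightarrow> vmax_tm t < x"
  unfolding fun_unit_nat_def fun_unit_real_def real_set_def closed_set_def no_isolated_points_def nonempty_set_def
  by (auto dest!: vmax_dests)

lemma vmax_perfect: "vmax (perfect_in_unit t) < x \<Longrightarrow> vmax_tm t < x"
  unfolding perfect_in_unit_def by (auto dest!: vmax_sets)

lemma vmax_functions:
  "vmax (baire1 t) < x \<Longrightarrow> vmax_tm t < x"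
  "vmax (continuous_unit t) < x \<Longrightarrow> vmax_tm t < x"
  unfolding baire1_def continuous_unit_def by (auto dest!: vmax_sets)

lemma vmax_converges: "vmax (converges s l) < x \<Longrightarrow> (\<exists>k. vmax_tm (s (Var k TyN)) < x) \<and> vmax_tm l < x"
  unfolding converges_def by (auto dest!: vmax_dests)

lemmas vmax_all = vmax_dests vmax_sets vmax_perfect vmax_functions vmax_converges

section \<open>Well-formedness of the coded statements\<close>

lemma wf_Exists: "(\<And>x. wf_fm (F (Var x \<sigma>))) \<Longrightarrow> wf_fm (Exists \<sigma> F)"
  by (simp add: Exists_def Let_def)

lemma typed_abbrevs [simp]:
  "ty_of (eps k) = TyN" "ty_of (eps2 k) = TyN" "ty_of (const_real k) = Ty1"
  "wf_tm k \<Longrightarrow> ty_of k = TyN \<Longrightarrow> wf_tm (eps k)" "wf_tm k \<Longrightarrow> ty_of k = TyN \<Longrightarrow> wf_tm (eps2 k)"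
  "wf_tm k \<Longrightarrow> ty_of k = TyN \<Longrightarrow> wf_tm (const_real k)"
  by (auto simp: eps_def eps2_def const_real_def)

lemma wf_q [simp]:
  "wf_tm p \<Longrightarrow> wf_tm q \<Longrightarrow> ty_of p = TyN \<Longrightarrow> ty_of q = TyN \<Longrightarrow> wf_fm (q_less p q) \<and> wf_fm (q_le p q)"
  by (simp add: q_less_def q_le_def)

lemma wf_is_real [simp]: "wf_tm t \<Longrightarrow> ty_of t = Ty1 \<Longrightarrow> wf_fm (is_real t)"
  unfolding is_real_def by (auto intro!: wf_Forall)

lemma wf_real_basics [simp]:
  assumes "wf_tm s" "wf_tm t" "ty_of s = Ty1" "ty_of t = Ty1"
  shows "wf_fm (r_eq s t)" "wf_fm (r_less s t)" "wf_fm (r_le s t)"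
  using assms unfolding r_eq_def r_less_def r_le_def FNeg_def
  by (auto intro!: wf_Forall wf_Exists)

lemma wf_dist_less [simp]:
  "wf_tm k \<Longrightarrow> ty_of k = TyN \<Longrightarrow> wf_tm s \<Longrightarrow> wf_tm t \<Longrightarrow> ty_of s = Ty1 \<Longrightarrow> ty_of t = Ty1 \<Longrightarrow> wf_fm (dist_less k s t)"
  unfolding dist_less_def by simp

lemma wf_in_unit [simp]: "wf_tm t \<Longrightarrow> ty_of t = Ty1 \<Longrightarrow> wf_fm (in_unit t)"
  unfolding in_unit_def by simp

lemma wf_real_binders:
  assumes "\<And>x. wf_fm (F (Var x Ty1))"
  shows "wf_fm (forall_real F)" "wf_fm (exists_real F)" "wf_fm (forall_unit F)" "wf_fm (exists_unit F)"
  unfolding forall_real_def exists_real_def forall_unit_def exists_unit_def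
  using assms by (auto intro!: wf_Forall wf_Exists)

lemma wf_set_mem [simp]: "wf_tm x \<Longrightarrow> wf_tm P \<Longrightarrow> ty_of P = Ty1 \<Rrightarrow> TyN \<Longrightarrow> ty_of x = Ty1 \<Longrightarrow> wf_fm (set_mem x P)"
  by (simp add: set_mem_def)

lemmas wf_binders = wf_Forall wf_Exists wf_real_binders

lemma wf_target: "wf_fm (Baire' \<^bold>\<longrightarrow> NIN)"
  unfolding Baire'_def NIN_def fun_unit_nat_def fun_unit_real_def baire1_def continuous_unit_def perfect_in_unit_def
    nonempty_set_def closed_set_def no_isolated_points_def real_set_def converges_def
  by (auto intro!: wf_binders)

context field_model
begin

section \<open>Coded reals, functions and sets read in the field\<close>

definition "RS x n = val (ap x n)"
definition "ri n = 1 / \<iota> (ex2 n)"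

definition "Real x \<longleftrightarrow> (\<forall>n\<in>N. \<forall>i\<in>N. \<bar>RS x n - RS x (pl n i)\<bar> < ri n)"
definition "Req x y \<longleftrightarrow> (\<forall>n\<in>N. \<bar>RS x n - RS y n\<bar> \<le> 2 * ri n)"
text \<open>The shift to n + 1 comes from \<open>rdist_tm\<close>, the summand
  \<open>2 * ri n\<close> from the strict order of coded reals.\<close>

definition "DL k x y \<longleftrightarrow> (\<exists>n\<in>N. \<bar>RS x (pl n nu) - RS y (pl n nu)\<bar> + 2 * ri n < ri k)"
text \<open>The bounds are negated strict comparisons with the constants 0 and 1, hence the slack
  \<open>2 * ri n\<close> at each index.\<close>

definition "Unit x \<longleftrightarrow> Real x \<and> (\<forall>n\<in>N. - (2 * ri n) \<le> RS x n) \<and> (\<forall>n\<in>N. RS x n \<le> 1 + 2 * ri n)"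
definition "RR = {x \<in> D Ty1. Real x}"
definition "UU = {x \<in> D Ty1. Unit x}"

lemma ap_N [simp]: "x \<in> D Ty1 \<Longrightarrow> n \<in> N \<Longrightarrow> ap x n \<in> N"
  by (rule ap_in)

lemma sat_q:
  assumes "ev e p \<in> N" "ev e q \<in> N"
  shows "sat e (q_less p q) \<longleftrightarrow> val (ev e p) < val (ev e q)" "sat e (q_le p q) \<longleftrightarrow> val (ev e p) \<le> val (ev e q)"
  using assms cr_less[of "ev e p" "ev e q"] cr_eq_iff[of "ev e p" "ev e q"] by (auto simp: q_less_def q_le_def)

lemma ev_eps:
  assumes "ev e k \<in> N"
  shows "ev e (eps k) \<in> N" "val (ev e (eps k)) = ri (ev e k)" "ev e (eps2 k) \<in> N" "val (ev e (eps2 k)) = 2 * ri (ev e k)"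
  using assms i_pd_pos[of "ex2 (ev e k)"] by (simp_all add: eps_def eps2_def val_rt ri_def)

lemma ap_const [simp]: "q \<in> N \<Longrightarrow> n \<in> N \<Longrightarrow> ap (ap (cn (KK TyN TyN)) q) n = q"
  by (rule K_eq)

lemma ap_rdist:
  assumes "x \<in> D Ty1" "y \<in> D Ty1" "n \<in> N"
  shows "ap (ap (ap (ev e rdist_tm) x) y) n = qd (ap x (pl n nu)) (ap y (pl n nu))"
proof -
  have "ev e rdist_tm = ev e0 rdist_tm" by (rule ev_closed) simp
  then show ?thesis using assms by (simp add: rdist_tm_def Lam_def)
qed

lemma sat_Exists:
  assumes "\<And>x d. vmax (F Zero) < x \<Longrightarrow> d \<in> D \<sigma> \<Longrightarrow> sat (e((x, \<sigma>) := d)) (F (Var x \<sigma>)) \<longleftrightarrow> P d"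
  shows "sat e (Exists \<sigma> F) \<longleftrightarrow> (\<exists>d\<in>D \<sigma>. P d)"
  using assms by (simp add: Exists_def Let_def)

lemma sat_is_real:
  assumes "ev e t \<in> D Ty1"
  shows "sat e (is_real t) \<longleftrightarrow> Real (ev e t)"
  unfolding is_real_def Real_def
  by (intro sat_Forall) (use assms in \<open>auto dest!: vmax_all simp: sat_q ev_eps RS_def val_qd\<close>)

lemma sat_r_eq:
  assumes "ev e s \<in> D Ty1" "ev e t \<in> D Ty1"
  shows "sat e (r_eq s t) \<longleftrightarrow> Req (ev e s) (ev e t)"
  unfolding r_eq_def Req_def
  by (intro sat_Forall) (use assms in \<open>auto dest!: vmax_all simp: sat_q ev_eps RS_def val_qd\<close>)

lemma sat_r_less:
  assumes "ev e s \<in> D Ty1" "ev e t \<in> D Ty1"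
  shows "sat e (r_less s t) \<longleftrightarrow> (\<exists>n\<in>N. RS (ev e s) n + 2 * ri n < RS (ev e t) n)"
  unfolding r_less_def
  by (intro sat_Exists) (use assms in \<open>auto dest!: vmax_all simp: sat_q ev_eps RS_def val_qa\<close>)

lemma ev_rdist_in: "ev e s \<in> D Ty1 \<Longrightarrow> ev e t \<in> D Ty1 \<Longrightarrow> ev e (rdist_tm \<cdot> s \<cdot> t) \<in> D Ty1"
  using ev_closed[of rdist_tm e] by (simp add: ap2[of _ Ty1 Ty1])

lemma ev_const_in: "ev e q \<in> N \<Longrightarrow> ev e (const_real q) \<in> D Ty1"
  using cn_in[of "KK TyN TyN"] by (auto simp: const_real_def intro: ap_in)

lemma sat_dist_less:
  assumes "ev e k \<in> N" "ev e s \<in> D Ty1" "ev e t \<in> D Ty1"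
  shows "sat e (dist_less k s t) \<longleftrightarrow> DL (ev e k) (ev e s) (ev e t)"
  unfolding dist_less_def DL_def using assms ev_rdist_in[OF assms(2,3)] ev_const_in[of e "eps k"]
  by (simp add: sat_r_less ev_eps RS_def ap_rdist const_real_def val_qd cong: bex_cong)

lemma sat_in_unit:
  assumes "ev e t \<in> D Ty1"
  shows "sat e (in_unit t) \<longleftrightarrow> Unit (ev e t)"
proof -
  have c: "ev e (const_real (rat_tm \<cdot> Zero \<cdot> Zero \<cdot> Zero)) \<in> D Ty1" "ev e (const_real (rat_tm \<cdot> One \<cdot> Zero \<cdot> Zero)) \<in> D Ty1"
    by (auto intro: ev_const_in)
  show ?thesis
    unfolding in_unit_def Unit_def r_le_def
    using assms c by (simp add: sat_r_less sat_is_real not_less)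
      (auto simp: RS_def const_real_def val_rt)
qed

lemma sat_forall_real:
  assumes "\<And>x d. vmax (F Zero) < x \<Longrightarrow> d \<in> RR \<Longrightarrow> sat (e((x, Ty1) := d)) (F (Var x Ty1)) \<longleftrightarrow> P d"
  shows "sat e (forall_real F) \<longleftrightarrow> (\<forall>d\<in>RR. P d)"
  using assms by (auto simp: forall_real_def Forall_def Let_def sat_is_real RR_def)

lemma sat_exists_real:
  assumes "\<And>x d. vmax (F Zero) < x \<Longrightarrow> d \<in> RR \<Longrightarrow> sat (e((x, Ty1) := d)) (F (Var x Ty1)) \<longleftrightarrow> P d"
  shows "sat e (exists_real F) \<longleftrightarrow> (\<exists>d\<in>RR. P d)"
  using assms by (auto simp: exists_real_def Exists_def Let_def sat_is_real RR_def)

lemma sat_forall_unit: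
  assumes "\<And>x d. vmax (F Zero) < x \<Longrightarrow> d \<in> UU \<Longrightarrow> sat (e((x, Ty1) := d)) (F (Var x Ty1)) \<longleftrightarrow> P d"
  shows "sat e (forall_unit F) \<longleftrightarrow> (\<forall>d\<in>UU. P d)"
  using assms by (auto simp: forall_unit_def Forall_def Let_def sat_in_unit UU_def)

lemma sat_exists_unit:
  assumes "\<And>x d. vmax (F Zero) < x \<Longrightarrow> d \<in> UU \<Longrightarrow> sat (e((x, Ty1) := d)) (F (Var x Ty1)) \<longleftrightarrow> P d"
  shows "sat e (exists_unit F) \<longleftrightarrow> (\<exists>d\<in>UU. P d)"
  using assms by (auto simp: exists_unit_def Exists_def Let_def sat_in_unit UU_def)

lemma RR_in [simp]: "x \<in> RR \<Longrightarrow> x \<in> D Ty1" and UU_in [simp]: "x \<in> UU \<Longrightarrow> x \<in> D Ty1"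
  and UU_RR: "x \<in> UU \<Longrightarrow> x \<in> RR"
  by (auto simp: RR_def UU_def Unit_def)

lemmas sat_intros = sat_Forall sat_Exists sat_forall_real sat_exists_real sat_forall_unit sat_exists_unit

definition "FunNat Y \<longleftrightarrow> (\<forall>x\<in>UU. \<forall>y\<in>UU. Req x y \<longrightarrow> ap Y x = ap Y y)"
definition "FunReal f \<longleftrightarrow> (\<forall>x\<in>UU. Real (ap f x)) \<and> (\<forall>x\<in>UU. \<forall>y\<in>UU. Req x y \<longrightarrow> Req (ap f x) (ap f y))"
definition "RealSet P \<longleftrightarrow> (\<forall>x\<in>RR. ap P x = nz \<or> ap P x = nu) \<and> (\<forall>x\<in>RR. \<forall>y\<in>RR. Req x y \<longrightarrow> ap P x = ap P y)"
definition "Closed P \<longleftrightarrow> (\<forall>x\<in>RR. ap P x \<noteq> nu \<longrightarrow> (\<exists>k\<in>N. \<forall>y\<in>RR. DL k x y \<longrightarrow> ap P y \<noteq> nu))"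
definition "NoIso P \<longleftrightarrow> (\<forall>x\<in>RR. ap P x = nu \<longrightarrow> (\<forall>k\<in>N. \<exists>y\<in>RR. ap P y = nu \<and> DL k x y \<and> \<not> Req x y))"
definition "Perfect P \<longleftrightarrow> RealSet P \<and> (\<forall>x\<in>RR. ap P x = nu \<longrightarrow> Unit x) \<and> Closed P \<and> NoIso P"
definition "Baire1 g \<longleftrightarrow> FunReal g \<and> (\<forall>P\<in>D (Ty1 \<Rrightarrow> TyN). Perfect P \<and> (\<exists>x\<in>RR. ap P x = nu) \<longrightarrow>
   (\<exists>x\<in>RR. ap P x = nu \<and> (\<forall>k\<in>N. \<exists>M\<in>N. \<forall>y\<in>RR. ap P y = nu \<longrightarrow> DL M x y \<longrightarrow> DL k (ap g x) (ap g y))))"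
definition "Cont g \<longleftrightarrow> FunReal g \<and> (\<forall>x\<in>UU. \<forall>k\<in>N. \<exists>M\<in>N. \<forall>y\<in>UU. DL M x y \<longrightarrow> DL k (ap g x) (ap g y))"
definition "Conv s l \<longleftrightarrow> (\<forall>k\<in>N. \<exists>M\<in>N. \<forall>n\<in>N. \<iota> M \<le> \<iota> n \<longrightarrow> DL k (s n) l)"

lemma ap_1N [simp]: "f \<in> D (Ty1 \<Rrightarrow> TyN) \<Longrightarrow> x \<in> D Ty1 \<Longrightarrow> ap f x \<in> N"
  and ap_11 [simp]: "f \<in> D (Ty1 \<Rrightarrow> Ty1) \<Longrightarrow> x \<in> D Ty1 \<Longrightarrow> ap f x \<in> D Ty1"
  by (rule ap_in; assumption)+

lemma sat_functions:
  "ev e Y \<in> D (Ty1 \<Rrightarrow> TyN) \<Longrightarrow> sat e (fun_unit_nat Y) \<longleftrightarrow> FunNat (ev e Y)"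
  "ev e f \<in> D (Ty1 \<Rrightarrow> Ty1) \<Longrightarrow> sat e (fun_unit_real f) \<longleftrightarrow> FunReal (ev e f)"
  "ev e P \<in> D (Ty1 \<Rrightarrow> TyN) \<Longrightarrow> sat e (real_set P) \<longleftrightarrow> RealSet (ev e P)"
  "ev e P \<in> D (Ty1 \<Rrightarrow> TyN) \<Longrightarrow> sat e (closed_set P) \<longleftrightarrow> Closed (ev e P)"
  "ev e P \<in> D (Ty1 \<Rrightarrow> TyN) \<Longrightarrow> sat e (no_isolated_points P) \<longleftrightarrow> NoIso (ev e P)"
  "ev e P \<in> D (Ty1 \<Rrightarrow> TyN) \<Longrightarrow> sat e (nonempty_set P) \<longleftrightarrow> (\<exists>x\<in>RR. ap (ev e P) x = nu)"
proof -
  assume "ev e Y \<in> D (Ty1 \<Rrightarrow> TyN)"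
  then show "sat e (fun_unit_nat Y) \<longleftrightarrow> FunNat (ev e Y)" unfolding fun_unit_nat_def FunNat_def
    by (intro sat_intros) (auto dest!: vmax_all simp: sat_r_eq)
next
  assume f: "ev e f \<in> D (Ty1 \<Rrightarrow> Ty1)"
  then have "sat e (\<^bold>\<forall>\<^sub>I x. is_real (f \<cdot> x)) \<longleftrightarrow> (\<forall>x\<in>UU. Real (ap (ev e f) x))"
    by (intro sat_intros) (auto dest!: vmax_all simp: sat_is_real)
  moreover have "sat e (\<^bold>\<forall>\<^sub>I x. \<^bold>\<forall>\<^sub>I y. x \<^bold>=\<^sub>R y \<^bold>\<longrightarrow> f \<cdot> x \<^bold>=\<^sub>R f \<cdot> y) \<longleftrightarrow>
    (\<forall>x\<in>UU. \<forall>y\<in>UU. Req x y \<longrightarrow> Req (ap (ev e f) x) (ap (ev e f) y))"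
    using f by (intro sat_intros) (auto dest!: vmax_all simp: sat_r_eq)
  ultimately show "sat e (fun_unit_real f) \<longleftrightarrow> FunReal (ev e f)" unfolding fun_unit_real_def FunReal_def
    by simp
next
  assume P: "ev e P \<in> D (Ty1 \<Rrightarrow> TyN)"
  then have "sat e (\<^bold>\<forall>\<^sub>R x. P \<cdot> x \<^bold>= Zero \<^bold>\<or> P \<cdot> x \<^bold>= One) \<longleftrightarrow> (\<forall>x\<in>RR. ap (ev e P) x = nz \<or> ap (ev e P) x = nu)"
    by (intro sat_intros) (auto dest!: vmax_all)
  moreover have "sat e (\<^bold>\<forall>\<^sub>R x. \<^bold>\<forall>\<^sub>R y. x \<^bold>=\<^sub>R y \<^bold>\<longrightarrow> P \<cdot> x \<^bold>= P \<cdot> y) \<longleftrightarrow>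
    (\<forall>x\<in>RR. \<forall>y\<in>RR. Req x y \<longrightarrow> ap (ev e P) x = ap (ev e P) y)"
    using P by (intro sat_intros) (auto dest!: vmax_all simp: sat_r_eq)
  ultimately show "sat e (real_set P) \<longleftrightarrow> RealSet (ev e P)" unfolding real_set_def RealSet_def by simp
  show "sat e (nonempty_set P) \<longleftrightarrow> (\<exists>x\<in>RR. ap (ev e P) x = nu)"
    unfolding nonempty_set_def by (intro sat_intros) (use P in \<open>auto dest!: vmax_all simp: set_mem_def\<close>)
  show "sat e (closed_set P) \<longleftrightarrow> Closed (ev e P)" unfolding closed_set_def Closed_def
    apply (rule sat_intros)
    subgoal for x d
      apply (subst sat.simps)
      apply (rule arg_cong2[of _ _ _ _ "(\<longrightarrow>)"])
      subgoal using P by (auto dest!: vmax_all simp: set_mem_def)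
      subgoal
        apply (intro sat_intros)
        using P by (auto dest!: vmax_all simp: set_mem_def sat_dist_less)
      done
    done
  show "sat e (no_isolated_points P) \<longleftrightarrow> NoIso (ev e P)" unfolding no_isolated_points_def NoIso_def
    apply (rule sat_intros)
    subgoal for x d
      apply (subst sat.simps)
      apply (rule arg_cong2[of _ _ _ _ "(\<longrightarrow>)"])
      subgoal using P by (auto dest!: vmax_all simp: set_mem_def)
      subgoal
        apply (intro sat_intros)
        using P by (auto dest!: vmax_all simp: set_mem_def sat_dist_less sat_r_eq)
      done
    done
qed


lemma sat_perfect:
  assumes "ev e P \<in> D (Ty1 \<Rrightarrow> TyN)"
  shows "sat e (perfect_in_unit P) \<longleftrightarrow> Perfect (ev e P)"
proof -
  have "sat e (\<^bold>\<forall>\<^sub>R x. x \<^bold>\<in> P \<^bold>\<longrightarrow> in_unit x) \<longleftrightarrow> (\<forall>x\<in>RR. ap (ev e P) x = nu \<longrightarrow> Unit x)"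
    by (intro sat_intros) (use assms in \<open>auto dest!: vmax_all simp: set_mem_def sat_in_unit\<close>)
  then show ?thesis unfolding perfect_in_unit_def Perfect_def
    using assms by (simp add: sat_functions)
qed

lemma sat_continuous:
  assumes "ev e g \<in> D (Ty1 \<Rrightarrow> Ty1)"
  shows "sat e (continuous_unit g) \<longleftrightarrow> Cont (ev e g)"
proof -
  have "sat e (\<^bold>\<forall>\<^sub>I x. \<^bold>\<forall>\<^sub>0 k. \<^bold>\<exists>\<^sub>0 N. \<^bold>\<forall>\<^sub>I y. dist_less N x y \<^bold>\<longrightarrow> dist_less k (g \<cdot> x) (g \<cdot> y)) \<longleftrightarrow>
    (\<forall>x\<in>UU. \<forall>k\<in>N. \<exists>M\<in>N. \<forall>y\<in>UU. DL M x y \<longrightarrow> DL k (ap (ev e g) x) (ap (ev e g) y))"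
    by (intro sat_intros) (use assms in \<open>auto dest!: vmax_all simp: sat_dist_less\<close>)
  then show ?thesis unfolding continuous_unit_def Cont_def
    using assms by (simp add: sat_functions)
qed

lemma sat_baire1:
  assumes "ev e g \<in> D (Ty1 \<Rrightarrow> Ty1)"
  shows "sat e (baire1 g) \<longleftrightarrow> Baire1 (ev e g)"
proof -
  have *: "sat e' (\<^bold>\<exists>\<^sub>R x. x \<^bold>\<in> P \<^bold>\<and>
           (\<^bold>\<forall>\<^sub>0 k. \<^bold>\<exists>\<^sub>0 N. \<^bold>\<forall>\<^sub>R y. y \<^bold>\<in> P \<^bold>\<longrightarrow> dist_less N x y \<^bold>\<longrightarrow> dist_less k (g \<cdot> x) (g \<cdot> y))) \<longleftrightarrow>
    (\<exists>x\<in>RR. ap (ev e' P) x = nu \<and> (\<forall>k\<in>N. \<exists>M\<in>N. \<forall>y\<in>RR. ap (ev e' P) y = nu \<longrightarrow> DL M x y \<longrightarrow>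
       DL k (ap (ev e' g) x) (ap (ev e' g) y)))"
    if "ev e' P \<in> D (Ty1 \<Rrightarrow> TyN)" "ev e' g \<in> D (Ty1 \<Rrightarrow> Ty1)" for e' P
    apply (rule sat_intros)
    subgoal for x d
      apply (subst sat_simps_defs)
      apply (rule arg_cong2[of _ _ _ _ "(\<and>)"])
      subgoal using that by (auto dest!: vmax_all simp: set_mem_def)
      subgoal
        apply (intro sat_intros)
        using that by (auto dest!: vmax_all simp: set_mem_def sat_dist_less)
      done
    done
  have "sat e (Forall (Ty1 \<Rrightarrow> TyN) (\<lambda>P. perfect_in_unit P \<^bold>\<and> nonempty_set P \<^bold>\<longrightarrow>
        (\<^bold>\<exists>\<^sub>R x. x \<^bold>\<in> P \<^bold>\<and>
           (\<^bold>\<forall>\<^sub>0 k. \<^bold>\<exists>\<^sub>0 N. \<^bold>\<forall>\<^sub>R y. y \<^bold>\<in> P \<^bold>\<longrightarrow> dist_less N x y \<^bold>\<longrightarrow> dist_less k (g \<cdot> x) (g \<cdot> y))))) \<longleftrightarrow>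
     (\<forall>P\<in>D (Ty1 \<Rrightarrow> TyN). Perfect P \<and> (\<exists>x\<in>RR. ap P x = nu) \<longrightarrow>
   (\<exists>x\<in>RR. ap P x = nu \<and> (\<forall>k\<in>N. \<exists>M\<in>N. \<forall>y\<in>RR. ap P y = nu \<longrightarrow> DL M x y \<longrightarrow> DL k (ap (ev e g) x) (ap (ev e g) y))))"
    apply (rule sat_Forall)
    subgoal for x d
      apply (subgoal_tac "vmax_tm g < x")
      subgoal using assms by (simp add: * sat_perfect sat_functions)
      subgoal by (auto dest!: vmax_all)
      done
    done
  then show ?thesis unfolding baire1_def Baire1_def
    using assms by (simp add: sat_functions)
qed

text \<open>The sequence is a context \<open>s\<close>, and its value is requested under the three
  updates that the binders of \<open>converges\<close> produce. The condition \<open>mono\<close>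
  turns freshness for the body, where a variable is plugged in, into freshness for the context
  itself.\<close>

lemma sat_converges:
  assumes l: "ev e l \<in> D Ty1"
    and S: "\<And>n. n \<in> N \<Longrightarrow> S n \<in> D Ty1"
    and s: "\<And>i j m k M n. vmax_tm (s Zero) < i \<Longrightarrow> vmax_tm (s Zero) < j \<Longrightarrow> vmax_tm (s Zero) < m \<Longrightarrow>
      k \<in> N \<Longrightarrow> M \<in> N \<Longrightarrow> n \<in> N \<Longrightarrow>
      ev (e((i, TyN) := k, (j, TyN) := M, (m, TyN) := n)) (s (Var m TyN)) = S n"
    and mono: "\<And>k. vmax_tm (s Zero) \<le> vmax_tm (s (Var k TyN))"
  shows "sat e (converges s l) \<longleftrightarrow> Conv S (ev e l)"
  unfolding converges_def Conv_def
proof (intro sat_Forall sat_Exists)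
  fix i k j M m n
  assume i: "vmax (Exists TyN (\<lambda>N. \<^bold>\<forall>\<^sub>0 n. N \<^bold>\<le> n \<^bold>\<longrightarrow> dist_less Zero (s n) l)) < i" and k: "k \<in> N"
    and j: "vmax (\<^bold>\<forall>\<^sub>0 n. Zero \<^bold>\<le> n \<^bold>\<longrightarrow> dist_less (Var i TyN) (s n) l) < j" and M: "M \<in> N"
    and m: "vmax (Var j TyN \<^bold>\<le> Zero \<^bold>\<longrightarrow> dist_less (Var i TyN) (s Zero) l) < m" and n: "n \<in> N"
  have i': "vmax_tm (s Zero) < i" "vmax_tm l < i"
    using i by (auto dest!: vmax_all intro: le_less_trans[OF mono])
  have j': "i < j" "vmax_tm (s Zero) < j" "vmax_tm l < j"
    using j by (auto dest!: vmax_all intro: le_less_trans[OF mono])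
  have m': "j < m" "i < m" "vmax_tm (s Zero) < m" "vmax_tm l < m"
    using m by (auto dest!: vmax_all)
  show "sat (e((i, TyN) := k, (j, TyN) := M, (m, TyN) := n)) (Var j TyN \<^bold>\<le> Var m TyN \<^bold>\<longrightarrow> dist_less (Var i TyN) (s (Var m TyN)) l)
     \<longleftrightarrow> (\<iota> M \<le> \<iota> n \<longrightarrow> DL k (S n) (ev e l))"
    using i' j' m' k M n S l s[OF i'(1) j'(2) m'(3) k M n] by (auto simp: sat_dist_less i_inj)
qed

lemma sat_ForallD:
  assumes "sat e (Forall \<sigma> F)" "d \<in> D \<sigma>"
  shows "\<exists>x. vmax (F Zero) < x \<and> sat (e((x, \<sigma>) := d)) (F (Var x \<sigma>))"
  using assms by (auto simp: Forall_def Let_def)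

lemma sat_ExistsD:
  assumes "sat e (Exists \<sigma> F)"
  shows "\<exists>x d. vmax (F Zero) < x \<and> d \<in> D \<sigma> \<and> sat (e((x, \<sigma>) := d)) (F (Var x \<sigma>))"
  using assms by (auto simp: Exists_def Let_def)

lemma sat_NIN:
  assumes "\<And>Y. Y \<in> D (Ty1 \<Rrightarrow> TyN) \<Longrightarrow> FunNat Y \<Longrightarrow> \<exists>x\<in>UU. \<exists>y\<in>UU. \<not> Req x y \<and> ap Y x = ap Y y"
  shows "sat e NIN"
proof -
  have "sat e NIN \<longleftrightarrow> (\<forall>Y\<in>D (Ty1 \<Rrightarrow> TyN). FunNat Y \<longrightarrow> (\<exists>x\<in>UU. \<exists>y\<in>UU. \<not> Req x y \<and> ap Y x = ap Y y))"
    unfolding NIN_def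
    apply (rule sat_Forall)
    subgoal for x d
      apply (subst sat.simps)
      apply (rule arg_cong2[of _ _ _ _ "(\<longrightarrow>)"])
      subgoal by (simp add: sat_functions)
      subgoal by (intro sat_intros) (auto dest!: vmax_all simp: sat_r_eq)
      done
    done
  then show ?thesis using assms by blast
qed

lemma sat_Baire':
  assumes "sat e Baire'" "f \<in> D (TyN \<Rrightarrow> Ty1 \<Rrightarrow> Ty1)" "h \<in> D (Ty1 \<Rrightarrow> Ty1)"
    and B: "\<And>n. n \<in> N \<Longrightarrow> Baire1 (ap f n)" and h: "FunReal h"
    and C: "\<And>x. x \<in> UU \<Longrightarrow> Conv (\<lambda>n. ap (ap f n) x) (ap h x)"
  shows "\<exists>g\<in>D (TyN \<Rrightarrow> TyN \<Rrightarrow> Ty1 \<Rrightarrow> Ty1). (\<forall>m\<in>N. \<forall>n\<in>N. Cont (ap (ap g m) n)) \<and>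
     (\<forall>n\<in>N. \<forall>x\<in>UU. Conv (\<lambda>m. ap (ap (ap g m) n) x) (ap (ap f n) x))"
proof -
  have fn: "ap f n \<in> D (Ty1 \<Rrightarrow> Ty1)" if "n \<in> N" for n by (rule ap_in[OF assms(2) that])
  obtain i j where ij: "sat (e((i, TyN \<Rrightarrow> Ty1 \<Rrightarrow> Ty1) := f, (j, Ty1 \<Rrightarrow> Ty1) := h))
       ((\<^bold>\<forall>\<^sub>0 n. baire1 (Var i (TyN \<Rrightarrow> Ty1 \<Rrightarrow> Ty1) \<cdot> n)) \<^bold>\<and> fun_unit_real (Var j (Ty1 \<Rrightarrow> Ty1)) \<^bold>\<and>
        (\<^bold>\<forall>\<^sub>I x. converges (\<lambda>n. Var i (TyN \<Rrightarrow> Ty1 \<Rrightarrow> Ty1) \<cdot> n \<cdot> x) (Var j (Ty1 \<Rrightarrow> Ty1) \<cdot> x)) \<^bold>\<longrightarrow>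
       Exists (TyN \<Rrightarrow> TyN \<Rrightarrow> Ty1 \<Rrightarrow> Ty1) (\<lambda>g.
         (\<^bold>\<forall>\<^sub>0 m. \<^bold>\<forall>\<^sub>0 n. continuous_unit (g \<cdot> m \<cdot> n)) \<^bold>\<and>
         (\<^bold>\<forall>\<^sub>0 n. \<^bold>\<forall>\<^sub>I x. converges (\<lambda>m. g \<cdot> m \<cdot> n \<cdot> x) (Var i (TyN \<Rrightarrow> Ty1 \<Rrightarrow> Ty1) \<cdot> n \<cdot> x)) \<^bold>\<and>
         (\<^bold>\<forall>\<^sub>I x. Exists (TyN \<Rrightarrow> Ty1) (\<lambda>L.
            (\<^bold>\<forall>\<^sub>0 n. is_real (L \<cdot> n) \<^bold>\<and> converges (\<lambda>m. g \<cdot> m \<cdot> n \<cdot> x) (L \<cdot> n)) \<^bold>\<and>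
            converges (\<lambda>n. L \<cdot> n) (Var j (Ty1 \<Rrightarrow> Ty1) \<cdot> x)))))"
    (is "sat ?e (?A \<^bold>\<and> ?B \<^bold>\<and> ?C \<^bold>\<longrightarrow> ?E)")
    using sat_ForallD[OF assms(1)[unfolded Baire'_def] assms(2)] sat_ForallD[OF _ assms(3)] by blast
  have "sat ?e ?A \<longleftrightarrow> (\<forall>n\<in>N. Baire1 (ap f n))"
    by (rule sat_Forall) (auto dest!: vmax_all simp: sat_baire1 fn)
  moreover have "sat ?e ?B \<longleftrightarrow> FunReal h" using assms(3) by (simp add: sat_functions)
  moreover have "sat ?e ?C \<longleftrightarrow> (\<forall>x\<in>UU. Conv (\<lambda>n. ap (ap f n) x) (ap h x))"
  proof (rule sat_forall_unit)
    fix k x assume "vmax (converges (\<lambda>n. Var i (TyN \<Rrightarrow> Ty1 \<Rrightarrow> Ty1) \<cdot> n \<cdot> Zero) (Var j (Ty1 \<Rrightarrow> Ty1) \<cdot> Zero)) < k" and x: "x \<in> UU"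
    show "sat (?e((k, Ty1) := x)) (converges (\<lambda>n. Var i (TyN \<Rrightarrow> Ty1 \<Rrightarrow> Ty1) \<cdot> n \<cdot> Var k Ty1) (Var j (Ty1 \<Rrightarrow> Ty1) \<cdot> Var k Ty1)) \<longleftrightarrow>
      Conv (\<lambda>n. ap (ap f n) x) (ap h x)"
      by (subst sat_converges[where S = "\<lambda>n. ap (ap f n) x"]) (use x assms(3) fn in auto)
  qed
  ultimately have "sat ?e ?E" using ij B h C by simp
  from sat_ExistsD[OF this] obtain k g where g: "g \<in> D (TyN \<Rrightarrow> TyN \<Rrightarrow> Ty1 \<Rrightarrow> Ty1)"
    and 1: "sat (?e((k, TyN \<Rrightarrow> TyN \<Rrightarrow> Ty1 \<Rrightarrow> Ty1) := g)) (\<^bold>\<forall>\<^sub>0 m. \<^bold>\<forall>\<^sub>0 n. continuous_unit (Var k (TyN \<Rrightarrow> TyN \<Rrightarrow> Ty1 \<Rrightarrow> Ty1) \<cdot> m \<cdot> n))"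
    and 2: "sat (?e((k, TyN \<Rrightarrow> TyN \<Rrightarrow> Ty1 \<Rrightarrow> Ty1) := g)) (\<^bold>\<forall>\<^sub>0 n. \<^bold>\<forall>\<^sub>I x. converges (\<lambda>m. Var k (TyN \<Rrightarrow> TyN \<Rrightarrow> Ty1 \<Rrightarrow> Ty1) \<cdot> m \<cdot> n \<cdot> x) (Var i (TyN \<Rrightarrow> Ty1 \<Rrightarrow> Ty1) \<cdot> n \<cdot> x))"
    by auto
  have gmn: "ap (ap g m) n \<in> D (Ty1 \<Rrightarrow> Ty1)" if "m \<in> N" "n \<in> N" for m n
    by (rule ap_in[OF ap_in[OF g that(1)] that(2)])
  let ?e' = "?e((k, TyN \<Rrightarrow> TyN \<Rrightarrow> Ty1 \<Rrightarrow> Ty1) := g)"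
  have "sat ?e' (\<^bold>\<forall>\<^sub>0 m. \<^bold>\<forall>\<^sub>0 n. continuous_unit (Var k (TyN \<Rrightarrow> TyN \<Rrightarrow> Ty1 \<Rrightarrow> Ty1) \<cdot> m \<cdot> n)) \<longleftrightarrow> (\<forall>m\<in>N. \<forall>n\<in>N. Cont (ap (ap g m) n))"
    by (intro sat_Forall) (auto dest!: vmax_all simp: sat_continuous gmn)
  moreover have "sat ?e' (\<^bold>\<forall>\<^sub>0 n. \<^bold>\<forall>\<^sub>I x. converges (\<lambda>m. Var k (TyN \<Rrightarrow> TyN \<Rrightarrow> Ty1 \<Rrightarrow> Ty1) \<cdot> m \<cdot> n \<cdot> x) (Var i (TyN \<Rrightarrow> Ty1 \<Rrightarrow> Ty1) \<cdot> n \<cdot> x)) \<longleftrightarrow>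
    (\<forall>n\<in>N. \<forall>x\<in>UU. Conv (\<lambda>m. ap (ap (ap g m) n) x) (ap (ap f n) x))"
  proof (intro sat_intros)
    fix a n b x
    assume n: "n \<in> N" and x: "x \<in> UU"
    show "sat (?e'((a, TyN) := n, (b, Ty1) := x)) (converges (\<lambda>m. Var k (TyN \<Rrightarrow> TyN \<Rrightarrow> Ty1 \<Rrightarrow> Ty1) \<cdot> m \<cdot> Var a TyN \<cdot> Var b Ty1)
        (Var i (TyN \<Rrightarrow> Ty1 \<Rrightarrow> Ty1) \<cdot> Var a TyN \<cdot> Var b Ty1)) \<longleftrightarrow> Conv (\<lambda>m. ap (ap (ap g m) n) x) (ap (ap f n) x)"
      by (subst sat_converges[where S = "\<lambda>m. ap (ap (ap g m) n) x"]) (use x n fn gmn in auto)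
  qed
  ultimately show ?thesis using g 1 2 by blast
qed

end

section \<open>Reals of a model\<close>

context field_model
begin

lemma le_iff: "a \<in> N \<Longrightarrow> b \<in> N \<Longrightarrow> \<iota> a < \<iota> b \<or> a = b \<longleftrightarrow> \<iota> a \<le> \<iota> b"
  by (auto simp: i_inj)

lemma ri_pos [simp]: "n \<in> N \<Longrightarrow> 0 < ri n"
  by (simp add: ri_def)

lemma ri_Suc: "n \<in> N \<Longrightarrow> ri (pl n nu) = ri n / 2"
  by (simp add: ri_def i_ex2)

lemma ri_mono: "n \<in> N \<Longrightarrow> m \<in> N \<Longrightarrow> \<iota> n \<le> \<iota> m \<Longrightarrow> ri m \<le> ri n"
  using ex2_mono[of n m] by (simp add: ri_def frac_le)

lemma ri_add: "n \<in> N \<Longrightarrow> m \<in> N \<Longrightarrow> ri (pl n m) = ri n * ri m"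
  by (simp add: ri_def ex2_add)

lemma ri_zero: "ri nz = 1"
  by (simp add: ri_def i_ex2)

lemma ri_le1: "n \<in> N \<Longrightarrow> ri n \<le> 1"
  using ri_mono[of nz n] by (simp add: ri_zero)

lemma i_decomp:
  assumes "n \<in> N" "m \<in> N" "\<iota> n \<le> \<iota> m"
  shows "\<exists>i\<in>N. m = pl n i"
proof (cases "n = m")
  case True
  then show ?thesis using assms by (intro bexI[of _ nz]) (auto simp: pl_zero)
next
  case False
  then show ?thesis using assms subtract[of n m] le_iff[of n m] by auto
qed

lemma Real_close: "x \<in> RR \<Longrightarrow> n \<in> N \<Longrightarrow> m \<in> N \<Longrightarrow> \<iota> n \<le> \<iota> m \<Longrightarrow> \<bar>RS x n - RS x m\<bar> < ri n"
proof -
  assume *: "x \<in> RR" "n \<in> N" "m \<in> N" "\<iota> n \<le> \<iota> m"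
  then obtain i where "i \<in> N" "m = pl n i" using i_decomp by blast
  then show ?thesis using * unfolding RR_def Real_def by blast
qed

text \<open>By definition closeness is tested at a single index. Here it holds at all late indices
  with a fixed margin, so that several distances can be compared at a common index.\<close>

lemma DL_iff:
  assumes "x \<in> RR" "y \<in> RR" "k \<in> N"
  shows "DL k x y \<longleftrightarrow> (\<exists>j\<in>N. \<forall>i\<in>N. \<iota> j \<le> \<iota> i \<longrightarrow> \<bar>RS x i - RS y i\<bar> < ri k - ri j)"
proof
  assume "DL k x y"
  then obtain n where n: "n \<in> N" "\<bar>RS x (pl n nu) - RS y (pl n nu)\<bar> + 2 * ri n < ri k" by (auto simp: DL_def)
  have "\<bar>RS x i - RS y i\<bar> < ri k - ri (pl n nu)" if i: "i \<in> N" "\<iota> (pl n nu) \<le> \<iota> i" for i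
    using Real_close[OF assms(1) _ i(1,2)] Real_close[OF assms(2) _ i(1,2)] n ri_Suc[OF n(1)] ri_pos[OF n(1)]
    by (simp add: abs_if split: if_splits)
  then show "\<exists>j\<in>N. \<forall>i\<in>N. \<iota> j \<le> \<iota> i \<longrightarrow> \<bar>RS x i - RS y i\<bar> < ri k - ri j"
    using n(1) by (intro bexI[of _ "pl n nu"]) auto
next
  assume "\<exists>j\<in>N. \<forall>i\<in>N. \<iota> j \<le> \<iota> i \<longrightarrow> \<bar>RS x i - RS y i\<bar> < ri k - ri j"
  then obtain j where j: "j \<in> N" "\<And>i. i \<in> N \<Longrightarrow> \<iota> j \<le> \<iota> i \<Longrightarrow> \<bar>RS x i - RS y i\<bar> < ri k - ri j" by blast
  moreover have "\<iota> j \<le> \<iota> (pl (pl j nu) nu)" using j(1) by simp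
  ultimately have "\<bar>RS x (pl (pl j nu) nu) - RS y (pl (pl j nu) nu)\<bar> < ri k - ri j" by simp
  \<comment> \<open>At n = j + 1 the margin \<open>2 * ri n\<close> demanded by \<open>DL\<close> is
    exactly \<open>ri j\<close>.\<close>
  then show "DL k x y" unfolding DL_def
    using j(1) by (intro bexI[of _ "pl j nu"]) (auto simp: ri_Suc)
qed

lemma DL_sym: "DL k x y \<Longrightarrow> DL k y x"
  by (simp add: DL_def abs_minus_commute)

lemma DL_trans:
  assumes "x \<in> RR" "y \<in> RR" "w \<in> RR" "k \<in> N" "DL (pl k nu) x y" "DL (pl k nu) y w"
  shows "DL k x w"
proof -
  obtain i where i: "i \<in> N" "\<And>l. l \<in> N \<Longrightarrow> \<iota> i \<le> \<iota> l \<Longrightarrow> \<bar>RS x l - RS y l\<bar> < ri (pl k nu) - ri i"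
    using assms DL_iff[of x y "pl k nu"] by auto
  obtain j where j: "j \<in> N" "\<And>l. l \<in> N \<Longrightarrow> \<iota> j \<le> \<iota> l \<Longrightarrow> \<bar>RS y l - RS w l\<bar> < ri (pl k nu) - ri j"
    using assms DL_iff[of y w "pl k nu"] by auto
  have "\<bar>RS x l - RS w l\<bar> < ri k - ri (pl i j)" if l: "l \<in> N" "\<iota> (pl i j) \<le> \<iota> l" for l
  proof -
    have "\<iota> i \<le> \<iota> l" "\<iota> j \<le> \<iota> l"
      using l(2) i_nonneg[OF i(1)] i_nonneg[OF j(1)] i_pl[OF i(1) j(1)] by linarith+
    then have "\<bar>RS x l - RS w l\<bar> < ri k - ri i - ri j"
      using i(2)[OF l(1)] j(2)[OF l(1)] assms(4) by (simp add: ri_Suc abs_if split: if_splits)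
    moreover have "ri (pl i j) \<le> ri i" using i j by (intro ri_mono) auto
    ultimately show ?thesis using ri_pos[OF j(1)] by simp
  qed
  then show ?thesis using DL_iff[OF assms(1,3,4)] i(1) j(1) op_in(1) by blast
qed

lemma Req_DL:
  assumes "x \<in> RR" "y \<in> RR" "k \<in> N" "Req x y"
  shows "DL k x y"
proof -
  \<comment> \<open>From index k + 2 on, equal reals differ by at most 2^-k / 2, which is below 2^-k
    - 2^-(k+2).\<close>
  let ?j = "pl (pl k nu) nu"
  have "\<bar>RS x i - RS y i\<bar> < ri k - ri ?j" if i: "i \<in> N" "\<iota> ?j \<le> \<iota> i" for i
  proof -
    have "\<bar>RS x i - RS y i\<bar> \<le> 2 * ri i" using assms i by (simp add: Req_def)
    moreover have "ri i \<le> ri ?j" using assms i by (intro ri_mono) auto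
    moreover have "ri ?j = ri k / 4" using assms by (simp add: ri_Suc)
    ultimately show ?thesis using ri_pos[OF assms(3)] by linarith
  qed
  then show ?thesis using DL_iff[OF assms(1,2,3)] assms(3) op_in(1) const_in(2) by blast
qed

lemma DL_refl: "x \<in> RR \<Longrightarrow> k \<in> N \<Longrightarrow> DL k x x"
  by (rule Req_DL) (auto simp: Req_def less_imp_le)

text \<open>The field is not assumed archimedean, but differences of coded rationals are bounded below
  by the reciprocal of a number of the model.\<close>

lemma ri_below:
  assumes p: "p \<in> N" and q: "q \<in> N" and m: "m \<in> N" and less: "2 * ri m < \<bar>val p - val q\<bar>"
  shows "\<exists>M\<in>N. ri M \<le> \<bar>val p - val q\<bar> - 2 * ri m"
proof -
  let ?d = "tm (de p) (de q)" let ?b = "tm ?d (ex2 m)"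
  have b: "?b \<in> N" "0 < \<iota> ?b" using p q m by auto
  define c where "c = pl (mn (cr p q) (cr q p)) (mn (cr q p) (cr p q))"
  have c: "c \<in> N" "\<iota> c = \<bar>val p - val q\<bar> * \<iota> ?d"
  proof -
    have "\<iota> c = \<bar>\<iota> (cr p q) - \<iota> (cr q p)\<bar>" using p q by (simp add: c_def i_mn max_def abs_if)
    then show "\<iota> c = \<bar>val p - val q\<bar> * \<iota> ?d" using p q by (simp add: cr_val abs_mult)
  qed (use p q in \<open>simp add: c_def\<close>)
  \<comment> \<open>After multiplication with the common denominator \<open>?b\<close> both sides
    are numbers, so the strict inequality leaves room for 1, that is, for 1 / b. Since b < 2^b, the
    exponent b itself can serve as M.\<close>
  have "2 * \<iota> ?d < \<iota> c * \<iota> (ex2 m)"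
    using less p q m c by (simp add: ri_def field_simps)
  then have "2 * \<iota> ?d + 1 \<le> \<iota> c * \<iota> (ex2 m)"
    using i_discrete[of "tm (pl nu nu) ?d" "tm c (ex2 m)"] p q m c(1) by simp
  then have "1 / \<iota> ?b \<le> \<bar>val p - val q\<bar> - 2 * ri m"
    using p q m c by (simp add: ri_def field_simps)
  moreover have "ri ?b \<le> 1 / \<iota> ?b"
    using ex2_gt[OF b(1)] b by (simp add: ri_def frac_le)
  ultimately show ?thesis using b(1) by (intro bexI[of _ ?b]) auto
qed

text \<open>The excess over \<open>2 * ri m\<close> at a violating index m survives at every later
  index, because each of the two reals moves by less than \<open>ri m\<close>.\<close>

lemma not_Req:
  assumes "x \<in> RR" "y \<in> RR" "\<not> Req x y"
  shows "\<exists>M\<in>N. \<not> DL M x y"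
proof -
  obtain m where m: "m \<in> N" "2 * ri m < \<bar>RS x m - RS y m\<bar>" using assms by (auto simp: Req_def not_le)
  then obtain M where M: "M \<in> N" "ri M \<le> \<bar>RS x m - RS y m\<bar> - 2 * ri m"
    using ri_below[of "ap x m" "ap y m" m] assms by (auto simp: RS_def)
  have "\<not> DL M x y"
  proof
    assume "DL M x y"
    then obtain j where j: "j \<in> N" "\<And>i. i \<in> N \<Longrightarrow> \<iota> j \<le> \<iota> i \<Longrightarrow> \<bar>RS x i - RS y i\<bar> < ri M - ri j"
      using DL_iff[OF assms(1,2) M(1)] by blast
    have i: "pl j m \<in> N" "\<iota> j \<le> \<iota> (pl j m)" "\<iota> m \<le> \<iota> (pl j m)" using j(1) m(1) by auto
    have "\<bar>RS x (pl j m) - RS y (pl j m)\<bar> < ri M - ri j" by (rule j(2)[OF i(1,2)])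
    moreover have "\<bar>RS x m - RS x (pl j m)\<bar> < ri m" "\<bar>RS y m - RS y (pl j m)\<bar> < ri m"
      using Real_close[OF assms(1) m(1) i(1,3)] Real_close[OF assms(2) m(1) i(1,3)] by auto
    ultimately show False using M(2) ri_pos[OF j(1)] by linarith
  qed
  then show ?thesis using M(1) by blast
qed

definition "cst q = ap (cn (KK TyN TyN)) q"

lemma RS_cst [simp]: "q \<in> N \<Longrightarrow> n \<in> N \<Longrightarrow> RS (cst q) n = val q"
  by (simp add: RS_def cst_def)

lemma ev_const_real [simp]: "ev e (const_real q) = cst (ev e q)"
  by (simp add: const_real_def cst_def)

lemma cst_RR [simp]: "q \<in> N \<Longrightarrow> cst q \<in> RR"
proof -
  assume q: "q \<in> N"
  then have "cst q \<in> D Ty1" using ap_in[of "cn (KK TyN TyN)" TyN Ty1 q] cn_in[of "KK TyN TyN"] by (simp add: cst_def)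
  then show ?thesis using q by (simp add: RR_def Real_def del: RR_in UU_in)
qed

lemma cst_UU: "q \<in> N \<Longrightarrow> 0 \<le> val q \<Longrightarrow> val q \<le> 1 \<Longrightarrow> cst q \<in> UU"
proof -
  assume q: "q \<in> N" "0 \<le> val q" "val q \<le> 1"
  have "- (2 * ri n) \<le> RS (cst q) n \<and> RS (cst q) n \<le> 1 + 2 * ri n" if "n \<in> N" for n
    using q ri_pos[OF that] RS_cst[OF q(1) that] by linarith
  then show ?thesis using cst_RR[OF q(1)] by (simp add: UU_def Unit_def RR_def del: RR_in UU_in)
qed

section \<open>The functional deciding number quantifiers\<close>

end

text \<open>Only quantifiers are restricted to type 0. Free variables may have any type, so the
  functions g of the main argument may occur as parameters.\<close>

fun arith :: "fm \<Rightarrow> bool" where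
  "arith (Imp \<phi> \<psi>) \<longleftrightarrow> arith \<phi> \<and> arith \<psi>"
| "arith (AllV x \<sigma> \<phi>) \<longleftrightarrow> \<sigma> = TyN \<and> arith \<phi>"
| "arith _ \<longleftrightarrow> True"

lemma arith_simps_defs [simp]:
  "arith (FNeg \<phi>) \<longleftrightarrow> arith \<phi>" "arith (FOr \<phi> \<psi>) \<longleftrightarrow> arith \<phi> \<and> arith \<psi>" "arith (FAnd \<phi> \<psi>) \<longleftrightarrow> arith \<phi> \<and> arith \<psi>"
  "arith (ExV x \<sigma> \<phi>) \<longleftrightarrow> \<sigma> = TyN \<and> arith \<phi>" "arith (r_less s t)" "arith (q_le s t)"
  by (auto simp: FNeg_def FOr_def FAnd_def ExV_def r_less_def Exists_def Let_def q_less_def q_le_def)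

context field_model
begin

lemma zero_or_pos: "a \<in> N \<Longrightarrow> a = nz \<or> 1 \<le> \<iota> a"
proof -
  assume a: "a \<in> N"
  have "\<iota> a = 0 \<or> 0 < \<iota> a" using i_nonneg[OF a] by linarith
  then show ?thesis using i_pos[OF a] i_inj[OF a, of nz] by auto
qed

text \<open>Here \<open>c n = n\<close> as long as no zero of \<open>f\<close> has been found, and \<open>c\<close> then stays at the first zero \<open>k\<close>.
  So \<open>z\<close> is \<open>2\<^sup>-\<^sup>k\<^sup>-\<^sup>1\<close> if there is a zero, and 0 otherwise.\<close>

lemma search_real:
  assumes f: "f \<in> D Ty1" and c: "c \<in> D Ty1" "ap c nz = nz"
    and step: "\<And>n. n \<in> N \<Longrightarrow> ap c (pl n nu) = pl (ap c n) (tm (mn nu (mn n (ap c n))) (mn nu (mn nu (ap f n))))"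
    and z: "z \<in> D Ty1" "\<And>n. n \<in> N \<Longrightarrow> RS z n = ri (pl (ap c n) nu)"
    and w: "w \<in> D Ty1" "\<And>n. n \<in> N \<Longrightarrow> RS w n = 0"
  shows "z \<in> UU" "Req z w \<longleftrightarrow> \<not> (\<exists>n\<in>N. ap f n = nz)"
proof -
  have cN: "ap c n \<in> N" "ap f n \<in> N" if "n \<in> N" for n using c f that by auto
  \<comment> \<open>\<open>mn nu a\<close> is the truth value of a = 0. The two factors thus test n
    \<le> c n and f n \<noteq> 0, and their product is the increment.\<close>
  have cond: "\<iota> (ap c (pl n nu)) = (if \<iota> n \<le> \<iota> (ap c n) \<and> ap f n \<noteq> nz then \<iota> (ap c n) + 1 else \<iota> (ap c n))"
    if n: "n \<in> N" for n
  proof -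
    have "\<iota> (ap c n) < \<iota> n \<Longrightarrow> 1 \<le> \<iota> n - \<iota> (ap c n)" using i_discrete[of "ap c n" n] n cN by auto
    moreover have "ap f n \<noteq> nz \<longleftrightarrow> 1 \<le> \<iota> (ap f n)" using zero_or_pos[OF cN(2)[OF n]] by auto
    moreover have "ap f n = nz \<longleftrightarrow> \<iota> (ap f n) = 0" using cN[OF n] i_inj[of "ap f n" nz] by simp
    ultimately show ?thesis using n cN[OF n] by (auto simp: step i_mn max_def)
  qed
  let ?e = "e0((0, Ty1) := c)"
  have e: "valid ?e" using c by simp
  have le: "\<iota> (ap c n) \<le> \<iota> n" if "n \<in> N" for n
    by (rule QF_ind[of "FNeg (Less (Var 1 TyN) (Var 0 Ty1 \<cdot> Var 1 TyN))" ?e 1])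
       (use e c cond cN that in \<open>auto simp: not_less\<close>)
  \<comment> \<open>A value of \<open>c\<close> below its argument means that the search has
    stopped, and from then on the first factor stays 0.\<close>
  have const: "ap c (pl n i) = ap c n" if n: "n \<in> N" and less: "\<iota> (ap c n) < \<iota> n" and i: "i \<in> N" for n i
  proof (rule QF_ind[of "Eq (Var 0 Ty1 \<cdot> (Var 2 TyN \<^bold>+ Var 1 TyN)) (Var 0 Ty1 \<cdot> Var 2 TyN)" "?e((2, TyN) := n)" 1 _ i])
    fix d assume d: "d \<in> N" and IH: "ap c (pl n d) = ap c n"
    have eq: "pl n (pl d nu) = pl (pl n d) nu" using n d by (simp add: i_inj)
    have "\<iota> (ap c (pl (pl n d) nu)) = \<iota> (ap c n)"
      using cond[of "pl n d"] IH less n d i_nonneg[OF d] by auto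
    then show "ap c (pl n (pl d nu)) = ap c n" unfolding eq using n d cN by (simp add: i_inj)
  qed (use e n i c in \<open>auto simp: pl_zero\<close>)
  have stop: "\<iota> (ap c n) \<le> \<iota> k" if k: "k \<in> N" and fk: "ap f k = nz" and n: "n \<in> N" for k n
  proof (cases "\<iota> n \<le> \<iota> k")
    case True
    then show ?thesis using le[OF n] by simp
  next
    case False
    then have "\<iota> (pl k nu) \<le> \<iota> n" using i_discrete[OF k n] k by simp
    then obtain i where i: "i \<in> N" "n = pl (pl k nu) i" using i_decomp[of "pl k nu" n] k n by auto
    have "\<iota> (ap c (pl k nu)) \<le> \<iota> k" using cond[OF k] le[OF k] fk by auto
    then show ?thesis using const[of "pl k nu" i] i k by simp
  qed
  have go: "ap c n = n" if nof: "\<not> (\<exists>n\<in>N. ap f n = nz)" and n: "n \<in> N" for n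
    by (rule QF_ind[of "Eq (Var 0 Ty1 \<cdot> Var 1 TyN) (Var 1 TyN)" ?e 1])
       (use e c cond cN n nof in \<open>auto simp: i_inj\<close>)
  have pos: "0 < RS z n" "RS z n \<le> 1" if "n \<in> N" for n
    using z(2)[OF that] cN[OF that] ri_pos[of "pl (ap c n) nu"] ri_le1[of "pl (ap c n) nu"] by auto
  have "\<bar>RS z n - RS z (pl n i)\<bar> < ri n" if n: "n \<in> N" and i: "i \<in> N" for n i
  proof (cases "\<iota> (ap c n) < \<iota> n")
    case True
    then show ?thesis using const[OF n True i] n i z by simp
  next
    case False
    then have cn: "ap c n = n" using le[OF n] cN n by (simp add: i_inj)
    have "\<iota> n \<le> \<iota> (ap c (pl n i))"
    proof (rule QF_ind[of "FNeg (Less (Var 0 Ty1 \<cdot> (Var 2 TyN \<^bold>+ Var 1 TyN)) (Var 2 TyN))" "?e((2, TyN) := n)" 1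
          "\<lambda>i. \<iota> n \<le> \<iota> (ap c (pl n i))" i])
      fix d assume d: "d \<in> N" and IH: "\<iota> n \<le> \<iota> (ap c (pl n d))"
      have eq: "pl n (pl d nu) = pl (pl n d) nu" using n d by (simp add: i_inj)
      have "\<iota> (ap c (pl n d)) \<le> \<iota> (ap c (pl (pl n d) nu))" using cond[of "pl n d"] n d by simp
      then show "\<iota> n \<le> \<iota> (ap c (pl n (pl d nu)))" unfolding eq using IH by linarith
    next
      show "\<iota> n \<le> \<iota> (ap c (pl n nz))" using n cn by (simp add: pl_zero)
    qed (use e n i c cN in \<open>auto simp: not_less\<close>)
    then have "ri (pl (ap c (pl n i)) nu) \<le> ri (pl n nu)" using n i cN[of "pl n i"] by (intro ri_mono) auto
    then have "RS z (pl n i) \<le> ri n / 2" "RS z n = ri n / 2" using z(2) n i cn by (simp_all add: ri_Suc)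
    then show ?thesis using pos(1)[of "pl n i"] ri_pos[OF n] n i by (simp add: abs_if)
  qed
  then have "Real z" unfolding Real_def by blast
  moreover have "- (2 * ri n) \<le> RS z n \<and> RS z n \<le> 1 + 2 * ri n" if "n \<in> N" for n
    using pos[OF that] ri_pos[OF that] by linarith
  ultimately show "z \<in> UU" using z(1) unfolding UU_def Unit_def by blast
  show "Req z w \<longleftrightarrow> \<not> (\<exists>n\<in>N. ap f n = nz)"
  proof
    assume R: "Req z w"
    show "\<not> (\<exists>n\<in>N. ap f n = nz)"
    proof
      assume "\<exists>n\<in>N. ap f n = nz"
      then obtain k where k: "k \<in> N" "ap f k = nz" by blast
      \<comment> \<open>With a zero at k all approximations of z are at least 2^-(k+1), whereas
        equality with 0 would allow only 2^-(k+2) at index k + 3.\<close>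
      let ?n = "pl (pl (pl k nu) nu) nu"
      have n: "?n \<in> N" using k by simp
      have "ri (pl k nu) \<le> ri (pl (ap c ?n) nu)" using stop[OF k n] k cN[OF n] by (intro ri_mono) auto
      moreover have "\<bar>RS z ?n - RS w ?n\<bar> \<le> 2 * ri ?n" using R n by (auto simp: Req_def)
      ultimately show False using z(2)[OF n] w(2)[OF n] k ri_pos[OF k(1)] pos(1)[OF n] by (simp add: ri_Suc)
    qed
  next
    assume nof: "\<not> (\<exists>n\<in>N. ap f n = nz)"
    have "\<bar>RS z n - RS w n\<bar> \<le> 2 * ri n" if "n \<in> N" for n
    proof -
      have "RS z n = ri n / 2" using z(2)[OF that] go[OF nof that] that by (simp add: ri_Suc)
      then show ?thesis using w(2)[OF that] ri_pos[OF that] by simp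
    qed
    then show "Req z w" by (simp add: Req_def)
  qed
qed

definition "zero_real = cst (rt nz nz nz)"

lemma zero_real: "zero_real \<in> UU" "n \<in> N \<Longrightarrow> RS zero_real n = 0"
  by (simp_all add: zero_real_def val_rt cst_UU)

definition "quantifier E \<longleftrightarrow> E \<in> D (Ty1 \<Rrightarrow> TyN) \<and> (\<forall>f\<in>D Ty1. ap E f = nz \<longleftrightarrow> (\<exists>n\<in>N. ap f n = nz))"

lemma mn_test: "a \<in> N \<Longrightarrow> b \<in> N \<Longrightarrow> mn nu (pl (mn a b) (mn b a)) = nz \<longleftrightarrow> a \<noteq> b"
  using i_discrete[of a b] i_discrete[of b a] by (auto simp: i_inj i_mn max_def)

text \<open>Y takes different values at z and 0 exactly if z is a nonzero real: one direction is
  extensionality of Y, the other injectivity. Since z is given by a term in f, comparing the two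
  values is a functional of the model.\<close>

lemma quantifier_exists:
  assumes Y: "Y \<in> D (Ty1 \<Rrightarrow> TyN)" "FunNat Y"
    and inj: "\<And>x y. x \<in> UU \<Longrightarrow> y \<in> UU \<Longrightarrow> ap Y x = ap Y y \<Longrightarrow> Req x y"
  shows "\<exists>E. quantifier E"
proof -
  let ?e = "e0((0, Ty1 \<Rrightarrow> TyN) := Y)"
  let ?t = "abs_tm 4 TyN (abs_tm 5 TyN (Var 5 TyN \<^bold>+ (One \<^bold>- (Var 4 TyN \<^bold>- Var 5 TyN)) \<^bold>* (One \<^bold>- (One \<^bold>- Var 1 Ty1 \<cdot> Var 4 TyN))))"
  let ?c = "Rec TyN \<cdot> ?t \<cdot> Zero"
  let ?z = "abs_tm 6 TyN (eps (?c \<cdot> Var 6 TyN \<^bold>+ One))"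
  let ?o = "const_real (rat_tm \<cdot> Zero \<cdot> Zero \<cdot> Zero)"
  let ?Y = "Var 0 (Ty1 \<Rrightarrow> TyN)"
  let ?E = "abs_tm 1 Ty1 (One \<^bold>- ((?Y \<cdot> ?z \<^bold>- ?Y \<cdot> ?o) \<^bold>+ (?Y \<cdot> ?o \<^bold>- ?Y \<cdot> ?z)))"
  have e: "valid ?e" using Y by simp
  have wt: "wf_tm ?t" "ty_of ?t = TyN \<Rrightarrow> TyN \<Rrightarrow> TyN" by auto
  have wz: "wf_tm ?z" "ty_of ?z = Ty1" by auto
  have wb: "wf_tm (One \<^bold>- ((?Y \<cdot> ?z \<^bold>- ?Y \<cdot> ?o) \<^bold>+ (?Y \<cdot> ?o \<^bold>- ?Y \<cdot> ?z)))" using wz by auto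
  have "ap (ev ?e ?E) f = nz \<longleftrightarrow> (\<exists>n\<in>N. ap f n = nz)" if f: "f \<in> D Ty1" for f
  proof -
    let ?e' = "?e((1, Ty1) := f)"
    have e': "valid ?e'" using e f by simp
    let ?C = "ev ?e' ?c" let ?Z = "ev ?e' ?z"
    have C: "?C \<in> D Ty1" using e' wt by (intro ev_in') auto
    have Z: "?Z \<in> D Ty1" using e' wz by (intro ev_in') auto
    have C0: "ap ?C nz = nz" using Rec_simps(1)[OF e' wt, of nz] by simp
    have CS: "ap ?C (pl n nu) = pl (ap ?C n) (tm (mn nu (mn n (ap ?C n))) (mn nu (mn nu (ap f n))))" if n: "n \<in> N" for n
    proof -
      have "ap ?C (pl n nu) = ap (ap (ev ?e' ?t) n) (ap ?C n)" using Rec_simps(2)[OF e' wt, of nz n] n by simp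
      also have "\<dots> = pl (ap ?C n) (tm (mn nu (mn n (ap ?C n))) (mn nu (mn nu (ap f n))))"
        using n C e' ap_N[OF C n] by (simp del: ev.simps(2)) (simp add: n)
      finally show ?thesis .
    qed
    have ZS: "RS ?Z n = ri (pl (ap ?C n) nu)" if n: "n \<in> N" for n
    proof -
      have cev: "ev (?e'((6, TyN) := n)) ?c = ?C" by (rule ev_cong) auto
      have "wf_tm (eps (?c \<cdot> Var 6 TyN \<^bold>+ One))" using wt by auto
      then have "ap ?Z n = ev (?e'((6, TyN) := n)) (eps (?c \<cdot> Var 6 TyN \<^bold>+ One))" using e' n by (intro ev_abs) auto
      moreover have "ev (?e'((6, TyN) := n)) (?c \<cdot> Var 6 TyN \<^bold>+ One) = pl (ap ?C n) nu"
        using cev by simp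
      moreover have "pl (ap ?C n) nu \<in> N" using ap_N[OF C n] by simp
      ultimately show ?thesis unfolding RS_def by (simp only: ev_eps(2))
    qed
    have zo: "zero_real \<in> D Ty1" using zero_real(1) by simp
    note sr = search_real[OF f C C0 CS Z ZS zo zero_real(2)]
    have oe: "ev ?e' ?o = zero_real" by (simp add: zero_real_def)
    have YN: "ap Y ?Z \<in> N" "ap Y zero_real \<in> N" using Y Z zo by auto
    have "ap (ev ?e ?E) f = ev ?e' (One \<^bold>- ((?Y \<cdot> ?z \<^bold>- ?Y \<cdot> ?o) \<^bold>+ (?Y \<cdot> ?o \<^bold>- ?Y \<cdot> ?z)))"
      using wb e f by (rule ev_abs)
    also have "\<dots> = mn nu (pl (mn (ap Y ?Z) (ap Y zero_real)) (mn (ap Y zero_real) (ap Y ?Z)))"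
      using oe by simp
    finally have "ap (ev ?e ?E) f = nz \<longleftrightarrow> ap Y ?Z \<noteq> ap Y zero_real"
      by (simp only: mn_test[OF YN])
    also have "\<dots> \<longleftrightarrow> \<not> Req ?Z zero_real"
    proof -
      have "Req ?Z zero_real" if "ap Y ?Z = ap Y zero_real"
        using inj[OF sr(1) zero_real(1)] that by (simp only:)
      moreover have "ap Y ?Z = ap Y zero_real" if "Req ?Z zero_real"
        using Y(2) sr(1) zero_real(1) that unfolding FunNat_def by (simp only:)
      ultimately show ?thesis by (simp only: iff_conv_conj_imp) iprover
    qed
    also have "\<dots> \<longleftrightarrow> (\<exists>n\<in>N. ap f n = nz)" by (simp only: sr(2) not_not)
    finally show ?thesis .
  qed
  moreover have "ev ?e ?E \<in> D (Ty1 \<Rrightarrow> TyN)" using e wb by (intro ev_in') auto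
  ultimately show ?thesis unfolding quantifier_def by blast
qed

section \<open>Arithmetical comprehension\<close>

text \<open>Truth is coded by the value 0. The variable that holds E has a function type and is
  never bound by a number quantifier, so the induction hypothesis applies under all updates of
  number variables.\<close>

lemma arith_term:
  assumes E: "quantifier E"
  shows "arith \<phi> \<Longrightarrow> wf_fm \<phi> \<Longrightarrow> \<exists>t. wf_tm t \<and> ty_of t = TyN \<and>
    (\<forall>e. valid e \<longrightarrow> e (0, Ty1 \<Rrightarrow> TyN) = E \<longrightarrow> (ev e t = nz \<longleftrightarrow> sat e \<phi>))"
proof (induction \<phi>)
  case Fls
  have "nu \<noteq> nz" by (simp add: i_inj)
  then show ?case by (intro exI[of _ One]) auto
next
  case (Eq s t)
  have "ev e ((s \<^bold>- t) \<^bold>+ (t \<^bold>- s)) = nz \<longleftrightarrow> sat e (Eq s t)" if "valid e" for e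
    using Eq that by (auto simp: i_inj i_mn max_def)
  then show ?case using Eq by (intro exI[of _ "(s \<^bold>- t) \<^bold>+ (t \<^bold>- s)"]) auto
next
  case (Less s t)
  have "ev e (One \<^bold>- (t \<^bold>- s)) = nz \<longleftrightarrow> sat e (Less s t)" if "valid e" for e
  proof -
    have N: "ev e s \<in> N" "ev e t \<in> N" using Less that by auto
    show ?thesis using N i_discrete[OF N] by (auto simp: i_inj i_mn max_def)
  qed
  then show ?case using Less by (intro exI[of _ "One \<^bold>- (t \<^bold>- s)"]) auto
next
  case (Imp \<phi> \<psi>)
  then obtain s t where s: "wf_tm s" "ty_of s = TyN" "\<And>e. valid e \<Longrightarrow> e (0, Ty1 \<Rrightarrow> TyN) = E \<Longrightarrow> (ev e s = nz \<longleftrightarrow> sat e \<phi>)"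
    and t: "wf_tm t" "ty_of t = TyN" "\<And>e. valid e \<Longrightarrow> e (0, Ty1 \<Rrightarrow> TyN) = E \<Longrightarrow> (ev e t = nz \<longleftrightarrow> sat e \<psi>)"
    by auto
  have "ev e ((One \<^bold>- s) \<^bold>* t) = nz \<longleftrightarrow> sat e (Imp \<phi> \<psi>)" if "valid e" "e (0, Ty1 \<Rrightarrow> TyN) = E" for e
  proof -
    have N: "ev e s \<in> N" "ev e t \<in> N" using s t that by auto
    have "ev e s = nz \<or> 1 \<le> \<iota> (ev e s)" by (rule zero_or_pos[OF N(1)])
    then have "ev e ((One \<^bold>- s) \<^bold>* t) = nz \<longleftrightarrow> (ev e s = nz \<longrightarrow> ev e t = nz)" using N by (auto simp: i_inj i_mn max_def)
    then show ?thesis using s(3) t(3) that by simp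
  qed
  then show ?case using s t by (intro exI[of _ "(One \<^bold>- s) \<^bold>* t"]) auto
next
  case (AllV x \<sigma> \<phi>)
  then obtain t where [simp]: "\<sigma> = TyN" and t: "wf_tm t" "ty_of t = TyN"
      "\<And>e. valid e \<Longrightarrow> e (0, Ty1 \<Rrightarrow> TyN) = E \<Longrightarrow> (ev e t = nz \<longleftrightarrow> sat e \<phi>)"
    by auto
  \<comment> \<open>\<open>?b\<close> vanishes exactly at the counterexamples, so E applied to it is
    0 if there is one, and the outer subtraction negates this.\<close>
  let ?b = "abs_tm x TyN (One \<^bold>- t)"
  let ?t = "One \<^bold>- Var 0 (Ty1 \<Rrightarrow> TyN) \<cdot> ?b"
  have w: "wf_tm (One \<^bold>- t)" "wf_tm ?t" using t by auto
  have "ev e ?t = nz \<longleftrightarrow> sat e (AllV x \<sigma> \<phi>)" if e: "valid e" "e (0, Ty1 \<Rrightarrow> TyN) = E" for e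
  proof -
    have b: "ev e ?b \<in> D Ty1" using e w t by (intro ev_in') auto
    have "ap (ev e ?b) n = nz \<longleftrightarrow> \<not> sat (e((x, TyN) := n)) \<phi>" if n: "n \<in> N" for n
    proof -
      have N: "ev (e((x, TyN) := n)) t \<in> N" using t e n by auto
      have "ap (ev e ?b) n = mn nu (ev (e((x, TyN) := n)) t)" using ev_abs[OF w(1) e(1) n] by simp
      moreover have "ev (e((x, TyN) := n)) t = nz \<or> 1 \<le> \<iota> (ev (e((x, TyN) := n)) t)"
        by (rule zero_or_pos[OF N])
      ultimately have "ap (ev e ?b) n = nz \<longleftrightarrow> ev (e((x, TyN) := n)) t \<noteq> nz" using N by (auto simp: i_inj i_mn max_def)
      then show ?thesis using t(3) e n by simp
    qed
    then have 1: "ap E (ev e ?b) = nz \<longleftrightarrow> \<not> sat e (AllV x \<sigma> \<phi>)" using E b unfolding quantifier_def by auto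
    have N: "ap E (ev e ?b) \<in> N" using E b unfolding quantifier_def by auto
    have "ap E (ev e ?b) = nz \<or> 1 \<le> \<iota> (ap E (ev e ?b))" by (rule zero_or_pos[OF N])
    then have "ev e ?t = nz \<longleftrightarrow> ap E (ev e ?b) \<noteq> nz" using N e by (auto simp: i_inj i_mn max_def)
    then show ?thesis using 1 by simp
  qed
  then show ?case using w by (intro exI[of _ ?t]) auto
qed

lemma arith_ind:
  assumes E: "quantifier E" and \<phi>: "arith \<phi>" "wf_fm \<phi>" and e: "valid e" "e (0, Ty1 \<Rrightarrow> TyN) = E"
    and sat: "\<And>d. d \<in> N \<Longrightarrow> sat (e((n, TyN) := d)) \<phi> \<longleftrightarrow> P d"
    and "P nz" "\<And>d. d \<in> N \<Longrightarrow> P d \<Longrightarrow> P (pl d nu)" "d \<in> N"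
  shows "P d"
proof -
  obtain t where t: "wf_tm t" "ty_of t = TyN" "\<And>e. valid e \<Longrightarrow> e (0, Ty1 \<Rrightarrow> TyN) = E \<Longrightarrow> (ev e t = nz \<longleftrightarrow> sat e \<phi>)"
    using arith_term[OF E \<phi>] by blast
  show ?thesis
    by (rule QF_ind[of "Eq t Zero" e n P d]) (use t e assms in auto)
qed

lemma arith_comprehension:
  assumes E: "quantifier E" and \<phi>: "arith \<phi>" "wf_fm \<phi>" and e: "valid e" "e (0, Ty1 \<Rrightarrow> TyN) = E"
  shows "\<exists>X\<in>D (TyN \<Rrightarrow> TyN \<Rrightarrow> TyN). \<forall>k\<in>N. \<forall>a\<in>N. ap (ap X k) a = (if sat (e((10, TyN) := k, (11, TyN) := a)) \<phi> then nz else nu)"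
proof -
  obtain t where t: "wf_tm t" "ty_of t = TyN" "\<And>e. valid e \<Longrightarrow> e (0, Ty1 \<Rrightarrow> TyN) = E \<Longrightarrow> (ev e t = nz \<longleftrightarrow> sat e \<phi>)"
    using arith_term[OF E \<phi>] by blast
  \<comment> \<open>The double subtraction maps every nonzero value of \<open>t\<close> to 1, which
    makes the result a characteristic function.\<close>
  let ?b = "One \<^bold>- (One \<^bold>- t)"
  let ?X = "ev e (abs_tm 10 TyN (abs_tm 11 TyN ?b))"
  have w: "wf_tm ?b" "wf_tm (abs_tm 11 TyN ?b)" using t by auto
  have X: "?X \<in> D (TyN \<Rrightarrow> TyN \<Rrightarrow> TyN)" using e w by (intro ev_in') auto
  have "ap (ap ?X k) a = (if sat (e((10, TyN) := k, (11, TyN) := a)) \<phi> then nz else nu)" if k: "k \<in> N" and a: "a \<in> N" for k a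
  proof -
    let ?e = "e((10, TyN) := k, (11, TyN) := a)"
    have N: "ev ?e t \<in> N" using t e k a by auto
    have "ap ?X k = ev (e((10, TyN) := k)) (abs_tm 11 TyN ?b)" by (rule ev_abs) (use w e k in auto)
    then have "ap (ap ?X k) a = ev ?e ?b" using ev_abs[OF w(1), of "e((10, TyN) := k)" a TyN 11] e k a by simp
    then have "ap (ap ?X k) a = mn nu (mn nu (ev ?e t))" by simp
    moreover have "ev ?e t = nz \<or> 1 \<le> \<iota> (ev ?e t)" by (rule zero_or_pos[OF N])
    ultimately have "ap (ap ?X k) a = (if ev ?e t = nz then nz else nu)" using N by (auto simp: i_inj i_mn max_def)
    then show ?thesis using t(3)[of ?e] e k a by simp
  qed
  then show ?thesis using X by blast
qed

end

section \<open>Paths of nested intervals\<close>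

context field_model
begin

text \<open>Variables 4 and 5 of \<open>t\<close> hold the index and the previous value; all other
  variables are parameters taken from e.\<close>

lemma prim_rec:
  assumes e: "valid e" and t: "wf_tm t" "ty_of t = TyN" and m: "m \<in> N"
  shows "\<exists>p\<in>D Ty1. ap p nz = m \<and> (\<forall>n\<in>N. ap p (pl n nu) = ev (e((4, TyN) := n, (5, TyN) := ap p n)) t)"
proof -
  let ?b = "abs_tm 5 TyN t" let ?t = "abs_tm 4 TyN ?b"
  have w: "wf_tm ?b" "wf_tm ?t" "ty_of ?t = TyN \<Rrightarrow> TyN \<Rrightarrow> TyN" using t by auto
  define p where "p = ap (ap (cn (Rec TyN)) (ev e ?t)) m"
  have R: "cn (Rec TyN) \<in> D ((TyN \<Rrightarrow> TyN \<Rrightarrow> TyN) \<Rrightarrow> TyN \<Rrightarrow> Ty1)" using cn_in[of "Rec TyN"] by simp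
  have p: "p \<in> D Ty1" unfolding p_def
    by (rule ap_in[OF ap_in[OF R] m]) (use e w in \<open>intro ev_in', auto\<close>)
  have "ap p nz = m" unfolding p_def by (rule Rec_simps(1)[OF e w(2,3) m])
  moreover have "ap p (pl n nu) = ev (e((4, TyN) := n, (5, TyN) := ap p n)) t" if n: "n \<in> N" for n
  proof -
    have pn: "ap p n \<in> N" by (rule ap_N[OF p n])
    have "ap p (pl n nu) = ap (ap (ev e ?t) n) (ap p n)" unfolding p_def by (rule Rec_simps(2)[OF e w(2,3) m n])
    also have "ap (ev e ?t) n = ev (e((4, TyN) := n)) ?b" by (rule ev_abs[OF w(1) e n])
    also have "ap \<dots> (ap p n) = ev (e((4, TyN) := n, (5, TyN) := ap p n)) t"
      by (rule ev_abs[OF t(1) _ pn]) (use e n in simp)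
    finally show ?thesis .
  qed
  ultimately show ?thesis using p by blast
qed

lemma lam_exists:
  assumes e: "valid e" and t: "wf_tm t" "ty_of t = TyN"
  shows "\<exists>p\<in>D Ty1. \<forall>n\<in>N. ap p n = ev (e((4, TyN) := n)) t"
proof -
  have "ev e (abs_tm 4 TyN t) \<in> D Ty1" using assms by (intro ev_in') auto
  then show ?thesis using ev_abs[OF t(1) e] by blast
qed

text \<open>The interval with number a at level k is [a / 4^k, (a + 1) / 4^k]; the numbers of its
  four parts at the next level start at \<open>q4 a\<close>.\<close>

definition "q4 a = tm (pl (pl nu nu) (pl nu nu)) a"

lemma q4 [simp]: "a \<in> N \<Longrightarrow> q4 a \<in> N" "a \<in> N \<Longrightarrow> \<iota> (q4 a) = 4 * \<iota> a"
  by (simp_all add: q4_def)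

definition "P4 k = \<iota> (ex2 k) * \<iota> (ex2 k)"

lemma P4_pos [simp]: "k \<in> N \<Longrightarrow> 0 < P4 k" "k \<in> N \<Longrightarrow> P4 k \<noteq> 0"
  by (auto simp: P4_def)

lemma P4_Suc: "k \<in> N \<Longrightarrow> P4 (pl k nu) = 4 * P4 k"
  by (simp add: P4_def i_ex2)

lemma P4_zero: "P4 nz = 1"
  by (simp add: P4_def i_ex2)

lemma P4_add: "k \<in> N \<Longrightarrow> j \<in> N \<Longrightarrow> P4 (pl k j) = P4 k * P4 j"
  by (simp add: P4_def ex2_add)

lemma P4_ge: "k \<in> N \<Longrightarrow> 1 / P4 k \<le> ri k"
  using ex2_ge1[of k] by (simp add: P4_def ri_def field_simps)

text \<open>A path through the intervals with property Q is found by always moving to the first good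
  quarter. The recursion can only test Q through a function of the model, which is why Q has to come
  with X.\<close>

lemma path:
  assumes X: "X \<in> D (TyN \<Rrightarrow> TyN \<Rrightarrow> TyN)" "\<And>k a. k \<in> N \<Longrightarrow> a \<in> N \<Longrightarrow> ap (ap X k) a = (if Q k a then nz else nu)"
    and k: "k \<in> N" and a: "a \<in> N" and Q: "Q k a"
    and step: "\<And>k a. k \<in> N \<Longrightarrow> a \<in> N \<Longrightarrow> Q k a \<Longrightarrow> Q (pl k nu) (q4 a) \<or> Q (pl k nu) (pl (q4 a) nu) \<or>
       Q (pl k nu) (pl (pl (q4 a) nu) nu) \<or> Q (pl k nu) (pl (pl (pl (q4 a) nu) nu) nu)"
  shows "\<exists>p\<in>D Ty1. ap p nz = a \<and> (\<forall>j\<in>N. Q (pl k j) (ap p j) \<and>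
    4 * \<iota> (ap p j) \<le> \<iota> (ap p (pl j nu)) \<and> \<iota> (ap p (pl j nu)) \<le> 4 * \<iota> (ap p j) + 3)"
proof -
  let ?e = "e0((2, TyN \<Rrightarrow> TyN \<Rrightarrow> TyN) := X, (3, TyN) := k)"
  let ?b = "((One \<^bold>+ One) \<^bold>+ (One \<^bold>+ One)) \<^bold>* Var 5 TyN"
  let ?X = "\<lambda>t. Var 2 (TyN \<Rrightarrow> TyN \<Rrightarrow> TyN) \<cdot> (Var 3 TyN \<^bold>+ (Var 4 TyN \<^bold>+ One)) \<cdot> t"
  \<comment> \<open>X is 0 at a good quarter and 1 otherwise, so the nested products count the bad
    quarters before the first good one. The fourth quarter is not tested: it is taken if the other
    three are bad.\<close>
  let ?t = "?b \<^bold>+ ?X ?b \<^bold>* (One \<^bold>+ ?X (?b \<^bold>+ One) \<^bold>* (One \<^bold>+ ?X (?b \<^bold>+ One \<^bold>+ One)))"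
  have e: "valid ?e" using X k by simp
  obtain p where p: "p \<in> D Ty1" "ap p nz = a" and ps: "\<And>n. n \<in> N \<Longrightarrow> ap p (pl n nu) = ev (?e((4, TyN) := n, (5, TyN) := ap p n)) ?t"
    using prim_rec[OF e, of ?t a] a by auto
  define x where "x n t = ap (ap X (pl k (pl n nu))) t" for n t
  have x: "x n t = (if Q (pl k (pl n nu)) t then nz else nu)" if "n \<in> N" "t \<in> N" for n t
    using X(2) k that by (simp add: x_def)
  have ps': "ap p (pl n nu) = pl (q4 (ap p n)) (tm (x n (q4 (ap p n))) (pl nu (tm (x n (pl (q4 (ap p n)) nu)) (pl nu (x n (pl (pl (q4 (ap p n)) nu) nu))))))"
    if "n \<in> N" for n
    using ps[OF that] by (simp add: q4_def x_def)
  have 4: "pl (pl b nu) nu \<in> N" "pl (pl (pl b nu) nu) nu \<in> N" "pl b nu \<in> N" if "b \<in> N" for b using that by auto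
  have cases: "\<exists>c. ap p (pl n nu) = c \<and> c \<in> N \<and> 4 * \<iota> (ap p n) \<le> \<iota> c \<and> \<iota> c \<le> 4 * \<iota> (ap p n) + 3 \<and>
      (Q (pl k n) (ap p n) \<longrightarrow> Q (pl k (pl n nu)) c)" if n: "n \<in> N" for n
  proof -
    have pn: "ap p n \<in> N" by (rule ap_N[OF p(1) n])
    define b where "b = q4 (ap p n)"
    have b: "b \<in> N" "\<iota> b = 4 * \<iota> (ap p n)" using pn by (simp_all add: b_def)
    have kk: "pl k (pl n nu) = pl (pl k n) nu" using k n by (simp add: i_inj)
    have pp: "ap p (pl n nu) = pl b (tm (x n b) (pl nu (tm (x n (pl b nu)) (pl nu (x n (pl (pl b nu) nu))))))"
      unfolding b_def by (rule ps'[OF n])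
    have "ap p (pl n nu) = (if Q (pl k (pl n nu)) b then b else if Q (pl k (pl n nu)) (pl b nu) then pl b nu
        else if Q (pl k (pl n nu)) (pl (pl b nu) nu) then pl (pl b nu) nu else pl (pl (pl b nu) nu) nu)"
      unfolding pp x[OF n b(1)] x[OF n 4(3)[OF b(1)]] x[OF n 4(1)[OF b(1)]] using b(1) by (auto simp: i_inj)
    moreover have "Q (pl k n) (ap p n) \<Longrightarrow> Q (pl k (pl n nu)) b \<or> Q (pl k (pl n nu)) (pl b nu) \<or>
       Q (pl k (pl n nu)) (pl (pl b nu) nu) \<or> Q (pl k (pl n nu)) (pl (pl (pl b nu) nu) nu)"
      unfolding kk b_def using step[of "pl k n" "ap p n"] k n pn by simp
    ultimately show ?thesis using b by auto
  qed
  have "Q (pl k j) (ap p j)" if j: "j \<in> N" for j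
  proof -
    let ?\<phi> = "Eq (Var 2 (TyN \<Rrightarrow> TyN \<Rrightarrow> TyN) \<cdot> (Var 3 TyN \<^bold>+ Var 6 TyN) \<cdot> (Var 7 Ty1 \<cdot> Var 6 TyN)) Zero"
    have nn: "nu \<noteq> nz" by (simp add: i_inj)
    show ?thesis
    proof (rule QF_ind[of ?\<phi> "?e((7, Ty1) := p)" 6 "\<lambda>j. Q (pl k j) (ap p j)" j])
      fix d assume d: "d \<in> N"
      have "pl k d \<in> N" "ap p d \<in> N" using k d p by auto
      then have "ap (ap X (pl k d)) (ap p d) = nz \<longleftrightarrow> Q (pl k d) (ap p d)" using X(2) nn by auto
      then show "sat (?e((7, Ty1) := p, (6, TyN) := d)) ?\<phi> \<longleftrightarrow> Q (pl k d) (ap p d)" by simp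
    next
      show "Q (pl k nz) (ap p nz)" using p(2) Q k by (simp add: pl_zero)
    next
      fix d assume "d \<in> N" "Q (pl k d) (ap p d)"
      then show "Q (pl k (pl d nu)) (ap p (pl d nu))" using cases[of d] by auto
    qed (use e p j in auto)
  qed
  moreover have "4 * \<iota> (ap p j) \<le> \<iota> (ap p (pl j nu)) \<and> \<iota> (ap p (pl j nu)) \<le> 4 * \<iota> (ap p j) + 3" if "j \<in> N" for j
    using cases[OF that] by auto
  ultimately show ?thesis using p by blast
qed

text \<open>Induction on the number i of further steps. The upper bound speaks of the right endpoint
  because that form is preserved: (4 p + 3) + 1 = 4 (p + 1).\<close>

lemma path_nested:
  assumes p: "p \<in> D Ty1" and step: "\<And>j. j \<in> N \<Longrightarrow> 4 * \<iota> (ap p j) \<le> \<iota> (ap p (pl j nu)) \<and> \<iota> (ap p (pl j nu)) \<le> 4 * \<iota> (ap p j) + 3"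
    and n: "n \<in> N" and i: "i \<in> N"
  shows "P4 i * \<iota> (ap p n) \<le> \<iota> (ap p (pl n i)) \<and> \<iota> (ap p (pl n i)) + 1 \<le> P4 i * (\<iota> (ap p n) + 1)"
proof -
  let ?p = "\<lambda>t. Var 7 Ty1 \<cdot> t" let ?q = "exp2_tm \<cdot> Var 6 TyN \<^bold>* (exp2_tm \<cdot> Var 6 TyN)"
  let ?\<phi> = "FAnd (FNeg (Less (?p (Var 5 TyN \<^bold>+ Var 6 TyN)) (?q \<^bold>* ?p (Var 5 TyN))))
      (Less (?p (Var 5 TyN \<^bold>+ Var 6 TyN)) (?q \<^bold>* (?p (Var 5 TyN) \<^bold>+ One)))"
  have pn: "ap p n \<in> N" using p n by simp
  show ?thesis
  proof (rule QF_ind[of ?\<phi> "e0((7, Ty1) := p, (5, TyN) := n)" 6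
      "\<lambda>i. P4 i * \<iota> (ap p n) \<le> \<iota> (ap p (pl n i)) \<and> \<iota> (ap p (pl n i)) + 1 \<le> P4 i * (\<iota> (ap p n) + 1)" i])
    fix d assume d: "d \<in> N"
    have "ap p (pl n d) \<in> N" "tm (tm (ex2 d) (ex2 d)) (pl (ap p n) nu) \<in> N" using p n d by auto
    from i_discrete[OF this] show "sat (e0((7, Ty1) := p, (5, TyN) := n, (6, TyN) := d)) ?\<phi> \<longleftrightarrow>
      P4 d * \<iota> (ap p n) \<le> \<iota> (ap p (pl n d)) \<and> \<iota> (ap p (pl n d)) + 1 \<le> P4 d * (\<iota> (ap p n) + 1)"
      using p n d by (auto simp: P4_def not_less)
  next
    show "P4 nz * \<iota> (ap p n) \<le> \<iota> (ap p (pl n nz)) \<and> \<iota> (ap p (pl n nz)) + 1 \<le> P4 nz * (\<iota> (ap p n) + 1)"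
      using n by (simp add: pl_zero P4_zero)
  next
    fix d assume d: "d \<in> N" and IH: "P4 d * \<iota> (ap p n) \<le> \<iota> (ap p (pl n d)) \<and> \<iota> (ap p (pl n d)) + 1 \<le> P4 d * (\<iota> (ap p n) + 1)"
    have eq: "pl n (pl d nu) = pl (pl n d) nu" using n d by (simp add: i_inj)
    have "pl n d \<in> N" using n d by simp
    from step[OF this] IH show "P4 (pl d nu) * \<iota> (ap p n) \<le> \<iota> (ap p (pl n (pl d nu))) \<and>
        \<iota> (ap p (pl n (pl d nu))) + 1 \<le> P4 (pl d nu) * (\<iota> (ap p n) + 1)"
      unfolding eq P4_Suc[OF d] mult.assoc by linarith
  qed (use p n i in auto)
qed

definition "Inside k a v \<longleftrightarrow> \<iota> a / P4 k \<le> v \<and> v \<le> (\<iota> a + 1) / P4 k"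

text \<open>The real consists of the left endpoints along the path. All later ones stay in the
  interval reached at stage n, whose length is at most 2^-n; the condition on the start keeps
  everything in the unit interval.\<close>

lemma path_real:
  assumes p: "p \<in> D Ty1" and step: "\<And>j. j \<in> N \<Longrightarrow> 4 * \<iota> (ap p j) \<le> \<iota> (ap p (pl j nu)) \<and> \<iota> (ap p (pl j nu)) \<le> 4 * \<iota> (ap p j) + 3"
    and k: "k \<in> N" and start: "\<iota> (ap p nz) + 1 \<le> P4 k"
  shows "\<exists>x\<in>UU. \<forall>n\<in>N. \<forall>i\<in>N. \<iota> n \<le> \<iota> i \<longrightarrow> Inside (pl k n) (ap p n) (RS x i)"
proof -
  let ?e = "e0((7, Ty1) := p, (3, TyN) := k)"
  let ?q = "exp2_tm \<cdot> (Var 3 TyN \<^bold>+ Var 4 TyN)"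
  let ?t = "rat_tm \<cdot> (Var 7 Ty1 \<cdot> Var 4 TyN) \<cdot> Zero \<cdot> (pred_tm \<cdot> (?q \<^bold>* ?q))"
  have e: "valid ?e" using p k by simp
  obtain x where x: "x \<in> D Ty1" "\<And>n. n \<in> N \<Longrightarrow> ap x n = ev (?e((4, TyN) := n)) ?t"
    using lam_exists[OF e, of ?t] by auto
  have RS: "RS x n = \<iota> (ap p n) / P4 (pl k n)" if n: "n \<in> N" for n
  proof -
    have N: "ap p n \<in> N" "pl k n \<in> N" using p k n by auto
    have "ap x n = rt (ap p n) nz (pd (tm (ex2 (pl k n)) (ex2 (pl k n))))" using x(2)[OF n] by simp
    moreover have "\<iota> (pd (tm (ex2 (pl k n)) (ex2 (pl k n)))) + 1 = P4 (pl k n)"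
      using i_pd_pos[of "tm (ex2 (pl k n)) (ex2 (pl k n))"] N by (simp add: P4_def)
    ultimately show ?thesis using N unfolding RS_def by (simp add: val_rt)
  qed
  \<comment> \<open>The second inequality is strict because the later interval lies in the earlier
    one together with its right endpoint. The definition of a coded real demands strictness.\<close>
  have near: "RS x n \<le> RS x (pl n i) \<and> RS x (pl n i) < RS x n + 1 / P4 (pl k n)" if n: "n \<in> N" and i: "i \<in> N" for n i
  proof -
    have kn: "pl k n \<in> N" and eq: "pl k (pl n i) = pl (pl k n) i" using k n i by (simp_all add: i_inj)
    have pos: "0 < P4 (pl k n)" "0 < P4 i" using kn i by simp_all
    have R1: "RS x (pl n i) = \<iota> (ap p (pl n i)) / (P4 (pl k n) * P4 i)"
      using RS[of "pl n i"] n i unfolding eq P4_add[OF kn i] by simp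
    show ?thesis unfolding R1 RS[OF n]
      using path_nested[OF p step n i] pos by (simp add: field_simps)
  qed
  have "Real x" unfolding Real_def
  proof (intro ballI)
    fix n i assume n: "n \<in> N" and i: "i \<in> N"
    have "1 / P4 (pl k n) \<le> ri (pl k n)" using k n by (intro P4_ge) simp
    also have "\<dots> \<le> ri n" using k n by (intro ri_mono) auto
    finally show "\<bar>RS x n - RS x (pl n i)\<bar> < ri n" using near[OF n i] by linarith
  qed
  moreover have "- (2 * ri n) \<le> RS x n \<and> RS x n \<le> 1 + 2 * ri n" if n: "n \<in> N" for n
  proof -
    have "0 \<le> \<iota> (ap p nz) / P4 k" using k p by (intro divide_nonneg_pos) auto
    moreover have "pl nz n = n" "pl k nz = k" using n k by (simp_all add: i_inj)
    ultimately have "0 \<le> RS x nz" "RS x nz \<le> RS x n" "RS x n < RS x nz + 1 / P4 k" "RS x nz = \<iota> (ap p nz) / P4 k"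
      using near[of nz n] n RS[of nz] k p by simp_all
    moreover have "\<iota> (ap p nz) / P4 k + 1 / P4 k \<le> 1" using start k by (simp add: field_simps)
    ultimately show ?thesis using ri_pos[OF n] by linarith
  qed
  ultimately have "x \<in> UU" using x(1) unfolding UU_def Unit_def by blast
  moreover have "Inside (pl k n) (ap p n) (RS x i)" if n: "n \<in> N" and i: "i \<in> N" and le: "\<iota> n \<le> \<iota> i" for n i
  proof -
    obtain j where j: "j \<in> N" "i = pl n j" using i_decomp[OF n i le] by blast
    show ?thesis using near[OF n j(1)] RS[OF n] j(2) unfolding Inside_def by (simp add: add_divide_distrib)
  qed
  ultimately show ?thesis by blast
qed

end

section \<open>The diagonal argument\<close>

context field_model
begin

definition "one_real = cst (rt nu nz nz)"

lemma one_real: "one_real \<in> UU" "n \<in> N \<Longrightarrow> RS one_real n = 1"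
  by (simp_all add: one_real_def val_rt cst_UU)

text \<open>The coded strict order 1/2 < y written out: only numbers are quantified, so statements
  built on it stay arithmetical.\<close>

definition "Big y \<longleftrightarrow> (\<exists>j\<in>N. 1 / 2 + 2 * ri j < RS y j)"

lemma ri_one: "ri nu = 1 / 2"
proof -
  have "pl nz nu = nu" by (simp add: i_inj)
  then show ?thesis using ri_Suc[of nz] by (simp add: ri_zero)
qed

lemma Big_not_small:
  assumes y: "y \<in> RR" and D: "DL nu y zero_real"
  shows "\<not> Big y"
proof
  assume "Big y"
  then obtain j where j: "j \<in> N" "1 / 2 + 2 * ri j < RS y j" by (auto simp: Big_def)
  obtain l where l: "l \<in> N" "\<And>i. i \<in> N \<Longrightarrow> \<iota> l \<le> \<iota> i \<Longrightarrow> \<bar>RS y i - RS zero_real i\<bar> < ri nu - ri l"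
    using D DL_iff[OF y UU_RR[OF zero_real(1)] const_in(2)] by blast
  have i: "pl j l \<in> N" "\<iota> j \<le> \<iota> (pl j l)" "\<iota> l \<le> \<iota> (pl j l)" using j(1) l(1) by auto
  show False
    using l(2)[OF i(1,3)] Real_close[OF y j(1) i(1,2)] j(2) zero_real(2)[OF i(1)] ri_pos[OF l(1)] ri_pos[OF j(1)] ri_one
    by linarith
qed

lemma close_one_Big:
  assumes y: "y \<in> RR" and D: "DL nu y one_real"
  shows "Big y"
proof -
  obtain l where l: "l \<in> N" "\<And>i. i \<in> N \<Longrightarrow> \<iota> l \<le> \<iota> i \<Longrightarrow> \<bar>RS y i - RS one_real i\<bar> < ri nu - ri l"
    using D DL_iff[OF y UU_RR[OF one_real(1)] const_in(2)] by blast
  have i: "pl l nu \<in> N" "\<iota> l \<le> \<iota> (pl l nu)" using l(1) by auto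
  have "1 / 2 + 2 * ri (pl l nu) < RS y (pl l nu)"
    using l(2)[OF i] one_real(2)[OF i(1)] ri_Suc[OF l(1)] ri_one by linarith
  then show ?thesis using i(1) unfolding Big_def by blast
qed

lemma close_cst:
  assumes x: "x \<in> RR" and r: "r \<in> N" and M: "M \<in> N" and j: "j \<in> N"
    and le: "\<And>i. i \<in> N \<Longrightarrow> \<iota> j \<le> \<iota> i \<Longrightarrow> \<bar>RS x i - val r\<bar> \<le> ri M / 2"
  shows "DL M x (cst r)"
proof -
  \<comment> \<open>\<open>ri ?M\<close> is a quarter of \<open>ri M\<close>, which fits into the
    gap between the assumed bound \<open>ri M / 2\<close> and \<open>ri M\<close>.\<close>
  let ?M = "pl (pl M nu) nu"
  have J: "pl j ?M \<in> N" using j M by simp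
  have "ri (pl j ?M) \<le> ri ?M" using j M by (intro ri_mono) auto
  moreover have "ri ?M = ri M / 4" using M by (simp add: ri_Suc)
  ultimately have rJ: "ri (pl j ?M) < ri M / 2" using ri_pos[OF M] by linarith
  have "\<bar>RS x i - RS (cst r) i\<bar> < ri M - ri (pl j ?M)" if i: "i \<in> N" "\<iota> (pl j ?M) \<le> \<iota> i" for i
  proof -
    have MN: "?M \<in> N" using M by simp
    have "\<iota> j \<le> \<iota> i" using i(2) i_pl[OF j MN] i_nonneg[OF MN] by linarith
    then show ?thesis using le[OF i(1)] rJ RS_cst[OF r i(1)] by simp
  qed
  then show ?thesis using DL_iff[OF x cst_RR[OF r] M] J by blast
qed

end

section \<open>Rational witnesses and intervals hit by a number\<close>

locale separated = field_model +
  fixes Y E g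
  assumes Y: "Y \<in> D (Ty1 \<Rrightarrow> TyN)"
    and inj: "\<And>x y. x \<in> UU \<Longrightarrow> y \<in> UU \<Longrightarrow> ap Y x = ap Y y \<Longrightarrow> Req x y"
    and E: "quantifier E"
    and g: "g \<in> D (TyN \<Rrightarrow> TyN \<Rrightarrow> Ty1 \<Rrightarrow> Ty1)"
    and cont: "\<And>m n. m \<in> N \<Longrightarrow> n \<in> N \<Longrightarrow> Cont (ap (ap g m) n)"
    and conv: "\<And>n x. n \<in> N \<Longrightarrow> x \<in> UU \<Longrightarrow>
      Conv (\<lambda>m. ap (ap (ap g m) n) x) (if ap Y x = n then one_real else zero_real)"
begin

abbreviation "G m n x \<equiv> ap (ap (ap g m) n) x"

lemma G_in: "m \<in> N \<Longrightarrow> n \<in> N \<Longrightarrow> x \<in> D Ty1 \<Longrightarrow> G m n x \<in> D Ty1"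
  by (rule ap_in[OF ap_in[OF ap_in[OF g]]])

lemma G_RR: "m \<in> N \<Longrightarrow> n \<in> N \<Longrightarrow> x \<in> UU \<Longrightarrow> G m n x \<in> RR"
proof -
  assume *: "m \<in> N" "n \<in> N" "x \<in> UU"
  then have "Real (G m n x)" using cont[OF *(1,2)] unfolding Cont_def FunReal_def by blast
  then show ?thesis using G_in[OF *(1,2) UU_in[OF *(3)]] unfolding RR_def by blast
qed

abbreviation "n2 \<equiv> pl nu nu"

text \<open>Two errors below 1/4 add up to one below 1/2, the threshold at which limits 0 and 1 are
  told apart by \<open>Big\<close>.\<close>

lemma close_to:
  assumes x: "x \<in> UU" and m: "m \<in> N" and n: "n \<in> N" and w: "w \<in> RR" and D: "DL n2 (G m n x) w"
  shows "\<exists>M\<in>N. \<forall>y\<in>UU. DL M x y \<longrightarrow> DL nu (G m n y) w"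
proof -
  have "n2 \<in> N" by simp
  then obtain M where M: "M \<in> N" "\<forall>y\<in>UU. DL M x y \<longrightarrow> DL n2 (G m n x) (G m n y)"
    using cont[OF m n] x unfolding Cont_def by blast
  have "DL nu (G m n y) w" if y: "y \<in> UU" "DL M x y" for y
    by (rule DL_trans[OF G_RR[OF m n y(1)] G_RR[OF m n x] w const_in(2)]) (use M y D DL_sym in blast)+
  then show ?thesis using M(1) by blast
qed

text \<open>The rational r may depend on M. One r for all M would be too much to ask, because at a
  rational in the unit interval to which Y does not assign n the values tend to 0. The bound B, in
  contrast, is fixed, which ties the witnesses for different M together.\<close>

definition "Seq n B k a \<longleftrightarrow> (\<forall>M\<in>N. \<exists>r\<in>N. Inside k a (val r) \<and>
   (\<forall>m\<in>N. \<iota> B \<le> \<iota> m \<longrightarrow> \<iota> m \<le> \<iota> M \<longrightarrow> Big (G m n (cst r))))"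

text \<open>Fixed variables: 10 and 11 hold k and a, as \<open>arith_comprehension\<close> expects,
  12 to 14 hold M, r and m, and 20 to 22 hold g, n and B.\<close>

abbreviation "bound_fm t \<equiv> rat_tm \<cdot> t \<cdot> Zero \<cdot> (pred_tm \<cdot> (exp2_tm \<cdot> Var 10 TyN \<^bold>* (exp2_tm \<cdot> Var 10 TyN)))"
abbreviation "big_fm t \<equiv> r_less (const_real (rat_tm \<cdot> One \<cdot> Zero \<cdot> One)) (Var 20 (TyN \<Rrightarrow> TyN \<Rrightarrow> Ty1 \<Rrightarrow> Ty1) \<cdot> Var 14 TyN \<cdot> Var 21 TyN \<cdot> const_real t)"
abbreviation "seq_fm \<equiv> AllV 12 TyN (ExV 13 TyN (FAnd (FAnd (q_le (bound_fm (Var 11 TyN)) (Var 13 TyN)) (q_le (Var 13 TyN) (bound_fm (Var 11 TyN \<^bold>+ One))))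
   (AllV 14 TyN (Var 22 TyN \<^bold>\<le> Var 14 TyN \<^bold>\<longrightarrow> Var 14 TyN \<^bold>\<le> Var 12 TyN \<^bold>\<longrightarrow> big_fm (Var 13 TyN)))))"

lemma val_bound:
  assumes "k \<in> N" "a \<in> N"
  shows "val (rt a nz (pd (tm (ex2 k) (ex2 k)))) = \<iota> a / P4 k"
  using assms i_pd_pos[of "tm (ex2 k) (ex2 k)"] by (simp add: val_rt P4_def)

lemma sat_big:
  assumes "e (20, TyN \<Rrightarrow> TyN \<Rrightarrow> Ty1 \<Rrightarrow> Ty1) = g" "e (14, TyN) \<in> N" "e (21, TyN) \<in> N" "ev e t \<in> N"
  shows "sat e (big_fm t) \<longleftrightarrow> Big (G (e (14, TyN)) (e (21, TyN)) (cst (ev e t)))"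
proof -
  have c: "cst (ev e t) \<in> D Ty1" "cst (rt nu nz nu) \<in> D Ty1" using assms by (auto intro: RR_in)
  then have "G (e (14, TyN)) (e (21, TyN)) (cst (ev e t)) \<in> D Ty1" using assms by (intro G_in)
  then show ?thesis using c assms by (subst sat_r_less) (simp_all add: Big_def val_rt)
qed

lemma sat_seq:
  assumes e: "e (20, TyN \<Rrightarrow> TyN \<Rrightarrow> Ty1 \<Rrightarrow> Ty1) = g" and N: "e (21, TyN) \<in> N" "e (22, TyN) \<in> N" "e (10, TyN) \<in> N" "e (11, TyN) \<in> N"
  shows "sat e seq_fm \<longleftrightarrow> Seq (e (21, TyN)) (e (22, TyN)) (e (10, TyN)) (e (11, TyN))"
proof -
  have "sat (e((12, TyN) := M, (13, TyN) := r)) (FAnd (FAnd (q_le (bound_fm (Var 11 TyN)) (Var 13 TyN)) (q_le (Var 13 TyN) (bound_fm (Var 11 TyN \<^bold>+ One))))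
     (AllV 14 TyN (Var 22 TyN \<^bold>\<le> Var 14 TyN \<^bold>\<longrightarrow> Var 14 TyN \<^bold>\<le> Var 12 TyN \<^bold>\<longrightarrow> big_fm (Var 13 TyN)))) \<longleftrightarrow>
     Inside (e (10, TyN)) (e (11, TyN)) (val r) \<and> (\<forall>m\<in>N. \<iota> (e (22, TyN)) \<le> \<iota> m \<longrightarrow> \<iota> m \<le> \<iota> M \<longrightarrow> Big (G m (e (21, TyN)) (cst r)))"
    if M: "M \<in> N" and r: "r \<in> N" for M r
  proof -
    have "sat (e((12, TyN) := M, (13, TyN) := r, (14, TyN) := m)) (Var 22 TyN \<^bold>\<le> Var 14 TyN \<^bold>\<longrightarrow> Var 14 TyN \<^bold>\<le> Var 12 TyN \<^bold>\<longrightarrow> big_fm (Var 13 TyN))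
      \<longleftrightarrow> (\<iota> (e (22, TyN)) \<le> \<iota> m \<longrightarrow> \<iota> m \<le> \<iota> M \<longrightarrow> Big (G m (e (21, TyN)) (cst r)))" if m: "m \<in> N" for m
      using e N M r m by (simp add: sat_big le_iff)
    then show ?thesis using N M r by (simp add: sat_q val_bound Inside_def)
  qed
  then show ?thesis unfolding Seq_def by simp
qed

lemma arith_seq [simp]: "arith seq_fm"
  by simp

lemma cst_Inside: "k \<in> N \<Longrightarrow> a \<in> N \<Longrightarrow> \<iota> a + 1 \<le> P4 k \<Longrightarrow> r \<in> N \<Longrightarrow> Inside k a (val r) \<Longrightarrow> cst r \<in> UU"
proof -
  assume *: "k \<in> N" "a \<in> N" "\<iota> a + 1 \<le> P4 k" "r \<in> N" "Inside k a (val r)"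
  have "0 \<le> \<iota> a / P4 k" using * by (intro divide_nonneg_pos) auto
  moreover have "(\<iota> a + 1) / P4 k \<le> 1" using * by simp
  ultimately have "0 \<le> val r" "val r \<le> 1" using *(5) unfolding Inside_def by linarith+
  then show ?thesis by (rule cst_UU[OF *(4)])
qed

lemma Inside_split:
  assumes "k \<in> N" "a \<in> N" "Inside k a v"
  shows "Inside (pl k nu) (q4 a) v \<or> Inside (pl k nu) (pl (q4 a) nu) v \<or>
       Inside (pl k nu) (pl (pl (q4 a) nu) nu) v \<or> Inside (pl k nu) (pl (pl (pl (q4 a) nu) nu) nu) v"
proof -
  have P: "0 < P4 k" using assms by simp
  define w where "w = v * P4 k * 4"
  have I: "Inside (pl k nu) b v \<longleftrightarrow> \<iota> b \<le> w \<and> w \<le> \<iota> b + 1" for b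
    using P assms(1) unfolding Inside_def w_def by (simp add: P4_Suc field_simps)
  have "4 * \<iota> a \<le> w" "w \<le> 4 * \<iota> a + 4"
    using assms(3) P unfolding Inside_def w_def by (simp_all add: field_simps)
  then show ?thesis unfolding I using assms(2) by simp linarith
qed

definition "refuted n B k a M \<longleftrightarrow> (\<forall>r\<in>N. Inside k a (val r) \<longrightarrow>
   (\<exists>m\<in>N. \<iota> B \<le> \<iota> m \<and> \<iota> m \<le> \<iota> M \<and> \<not> Big (G m n (cst r))))"

lemma not_Seq: "\<not> Seq n B k a \<Longrightarrow> \<exists>M\<in>N. refuted n B k a M"
  unfolding Seq_def refuted_def by blast

text \<open>If each quarter failed at some bound, a witness of the whole interval for a bound above
  all four would lie in one of the quarters and contradict its failure. This works because r is
  chosen after M and B is shared.\<close>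

lemma Seq_split:
  assumes n: "n \<in> N" and B: "B \<in> N" and k: "k \<in> N" and a: "a \<in> N" and S: "Seq n B k a"
  shows "Seq n B (pl k nu) (q4 a) \<or> Seq n B (pl k nu) (pl (q4 a) nu) \<or>
       Seq n B (pl k nu) (pl (pl (q4 a) nu) nu) \<or> Seq n B (pl k nu) (pl (pl (pl (q4 a) nu) nu) nu)"
proof (rule ccontr)
  let ?k = "pl k nu"
  assume "\<not> ?thesis"
  then have no: "\<not> Seq n B ?k (q4 a)" "\<not> Seq n B ?k (pl (q4 a) nu)" "\<not> Seq n B ?k (pl (pl (q4 a) nu) nu)"
    "\<not> Seq n B ?k (pl (pl (pl (q4 a) nu) nu) nu)" by simp_all
  obtain M1 where 1: "M1 \<in> N" "refuted n B ?k (q4 a) M1" using not_Seq[OF no(1)] by (elim bexE)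
  obtain M2 where 2: "M2 \<in> N" "refuted n B ?k (pl (q4 a) nu) M2" using not_Seq[OF no(2)] by (elim bexE)
  obtain M3 where 3: "M3 \<in> N" "refuted n B ?k (pl (pl (q4 a) nu) nu) M3" using not_Seq[OF no(3)] by (elim bexE)
  obtain M4 where 4: "M4 \<in> N" "refuted n B ?k (pl (pl (pl (q4 a) nu) nu) nu) M4" using not_Seq[OF no(4)] by (elim bexE)
  define M where "M = pl (pl M1 M2) (pl M3 M4)"
  have MN: "M \<in> N" using 1 2 3 4 by (simp add: M_def)
  have le: "\<iota> M1 \<le> \<iota> M" "\<iota> M2 \<le> \<iota> M" "\<iota> M3 \<le> \<iota> M" "\<iota> M4 \<le> \<iota> M"
    using 1(1) 2(1) 3(1) 4(1) i_nonneg[OF 1(1)] i_nonneg[OF 2(1)] i_nonneg[OF 3(1)] i_nonneg[OF 4(1)]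
    by (simp_all add: M_def)
  obtain r where r: "r \<in> N" "Inside k a (val r)" "\<And>m. m \<in> N \<Longrightarrow> \<iota> B \<le> \<iota> m \<Longrightarrow> \<iota> m \<le> \<iota> M \<Longrightarrow> Big (G m n (cst r))"
    using S[unfolded Seq_def, rule_format, OF MN] by (elim bexE conjE) simp
  have bad: "\<not> Inside ?k b (val r)" if "refuted n B ?k b M'" "\<iota> M' \<le> \<iota> M" for b M'
  proof
    assume I: "Inside ?k b (val r)"
    from that(1)[unfolded refuted_def, rule_format, OF r(1) I]
    obtain m where "m \<in> N" "\<iota> B \<le> \<iota> m" "\<iota> m \<le> \<iota> M'" "\<not> Big (G m n (cst r))" by (elim bexE conjE)
    then show False using r(3)[of m] that(2) by simp
  qed
  from Inside_split[OF k a r(2)] bad[OF 1(2) le(1)] bad[OF 2(2) le(2)] bad[OF 3(2) le(3)] bad[OF 4(2) le(4)]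
  show False by blast
qed

lemma Inside_close:
  assumes "k \<in> N" "Inside k a v" "Inside k a w"
  shows "\<bar>v - w\<bar> \<le> 1 / P4 k"
  using assms unfolding Inside_def add_divide_distrib by linarith

text \<open>Quarters with the same B lead to a point x. If Y x were not n, some function with m
  \<ge> B would be near 0 at x and, by continuity, below 1/2 close to x; but small intervals around
  x contain rationals where this very function exceeds 1/2.\<close>

lemma Seq_point:
  assumes n: "n \<in> N" and B: "B \<in> N" and k: "k \<in> N" and a: "a \<in> N" and bd: "\<iota> a + 1 \<le> P4 k" and S: "Seq n B k a"
  shows "\<exists>x\<in>UU. ap Y x = n \<and> (\<forall>i\<in>N. Inside k a (RS x i))"
proof -
  let ?e = "e0((0, Ty1 \<Rrightarrow> TyN) := E, (20, TyN \<Rrightarrow> TyN \<Rrightarrow> Ty1 \<Rrightarrow> Ty1) := g, (21, TyN) := n, (22, TyN) := B)"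
  let ?\<phi> = "FAnd (Less (Var 11 TyN) (exp2_tm \<cdot> Var 10 TyN \<^bold>* (exp2_tm \<cdot> Var 10 TyN))) seq_fm"
  \<comment> \<open>The bound on a is carried along so that every rational in the interval is a
    point of the unit interval.\<close>
  define Q where "Q k a \<longleftrightarrow> \<iota> a + 1 \<le> P4 k \<and> Seq n B k a" for k a
  have EN: "E \<in> D (Ty1 \<Rrightarrow> TyN)" using E unfolding quantifier_def by blast
  have e: "valid ?e" "?e (0, Ty1 \<Rrightarrow> TyN) = E" using EN g n B by simp_all
  have satQ: "sat (?e((10, TyN) := k, (11, TyN) := a)) ?\<phi> \<longleftrightarrow> Q k a" if ka: "k \<in> N" "a \<in> N" for k a
  proof -
    have "sat (?e((10, TyN) := k, (11, TyN) := a)) seq_fm \<longleftrightarrow> Seq n B k a"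
      by (subst sat_seq) (use ka n B in simp_all)
    moreover have "\<iota> a < P4 k \<longleftrightarrow> \<iota> a + 1 \<le> P4 k" using i_discrete[of a "tm (ex2 k) (ex2 k)"] ka by (simp add: P4_def)
    ultimately show ?thesis using ka unfolding Q_def sat_simps_defs by (simp add: P4_def)
  qed
  have "arith ?\<phi>" "wf_fm ?\<phi>" by simp_all
  from arith_comprehension[OF E this e] obtain X where X: "X \<in> D (TyN \<Rrightarrow> TyN \<Rrightarrow> TyN)"
      "\<And>k a. k \<in> N \<Longrightarrow> a \<in> N \<Longrightarrow> ap (ap X k) a = (if Q k a then nz else nu)"
    using satQ by auto
  have step: "Q (pl k nu) (q4 a) \<or> Q (pl k nu) (pl (q4 a) nu) \<or>
       Q (pl k nu) (pl (pl (q4 a) nu) nu) \<or> Q (pl k nu) (pl (pl (pl (q4 a) nu) nu) nu)"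
    if ka: "k \<in> N" "a \<in> N" and q: "Q k a" for k a
  proof -
    have "\<iota> a + 1 \<le> P4 k" using q unfolding Q_def by blast
    then show ?thesis using Seq_split[OF n B ka] q ka unfolding Q_def by (simp add: P4_Suc)
  qed
  have "Q k a" using bd S by (simp add: Q_def)
  from path[OF X k a this step] obtain p where p: "p \<in> D Ty1" "ap p nz = a"
    and pQ: "\<And>j. j \<in> N \<Longrightarrow> Q (pl k j) (ap p j)"
    and ps: "\<And>j. j \<in> N \<Longrightarrow> 4 * \<iota> (ap p j) \<le> \<iota> (ap p (pl j nu)) \<and> \<iota> (ap p (pl j nu)) \<le> 4 * \<iota> (ap p j) + 3" by blast
  obtain x where x: "x \<in> UU" and xI: "\<And>n i. n \<in> N \<Longrightarrow> i \<in> N \<Longrightarrow> \<iota> n \<le> \<iota> i \<Longrightarrow> Inside (pl k n) (ap p n) (RS x i)"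
    using path_real[OF p(1) ps k] bd p(2) by blast
  have "ap Y x = n"
  proof (rule ccontr)
    assume "ap Y x \<noteq> n"
    then have "Conv (\<lambda>m. G m n x) zero_real" using conv[OF n x] by simp
    moreover have "n2 \<in> N" by simp
    ultimately obtain M where M: "M \<in> N" "\<And>m. m \<in> N \<Longrightarrow> \<iota> M \<le> \<iota> m \<Longrightarrow> DL n2 (G m n x) zero_real"
      unfolding Conv_def by blast
    \<comment> \<open>Being at least M puts the value at x near 0, and being at least B makes
      \<open>Seq\<close> with bound m speak about this m.\<close>
    define m where "m = pl B M"
    have m: "m \<in> N" "\<iota> M \<le> \<iota> m" "\<iota> B \<le> \<iota> m" using B M(1) by (auto simp: m_def)
    obtain L where L: "L \<in> N" "\<And>y. y \<in> UU \<Longrightarrow> DL L x y \<Longrightarrow> DL nu (G m n y) zero_real"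
      using close_to[OF x m(1) n UU_RR[OF zero_real(1)] M(2)[OF m(1,2)]] by blast
    \<comment> \<open>One more step than L: the interval at stage j has length at most 2^-L / 2, as
      \<open>close_cst\<close> requires.\<close>
    define j where "j = pl L nu"
    have j: "j \<in> N" "ri j = ri L / 2" using L(1) by (simp_all add: j_def ri_Suc)
    have kj: "pl k j \<in> N" "ap p j \<in> N" using k j p(1) by auto
    obtain r where r: "r \<in> N" "Inside (pl k j) (ap p j) (val r)" "Big (G m n (cst r))"
      using pQ[OF j(1)] m unfolding Q_def Seq_def by blast
    have rU: "cst r \<in> UU" using cst_Inside[OF kj _ r(1,2)] pQ[OF j(1)] unfolding Q_def by blast
    have "1 / P4 (pl k j) \<le> ri (pl k j)" by (rule P4_ge[OF kj(1)])
    also have "\<dots> \<le> ri j" using k j by (intro ri_mono) auto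
    finally have P: "1 / P4 (pl k j) \<le> ri L / 2" using j(2) by simp
    have "DL L x (cst r)"
    proof (rule close_cst[OF UU_RR[OF x] r(1) L(1) j(1)])
      fix i assume "i \<in> N" "\<iota> j \<le> \<iota> i"
      then show "\<bar>RS x i - val r\<bar> \<le> ri L / 2"
        using Inside_close[OF kj(1) xI[OF j(1)] r(2)] P by (meson order_trans)
    qed
    then show False using L(2)[OF rU] Big_not_small[OF G_RR[OF m(1) n rU]] r(3) by blast
  qed
  moreover have "Inside k a (RS x i)" if i: "i \<in> N" for i
    using xI[of nz i] i p(2) k by (simp add: pl_zero)
  ultimately show ?thesis using x by blast
qed

definition "Hit n k a \<longleftrightarrow> (\<exists>B\<in>N. Seq n B k a)"

text \<open>Each of two hit intervals would contain a point that Y sends to n. By injectivity these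
  points are equal reals, but the outer quarters are two of their own lengths apart.\<close>

lemma Hit_unique:
  assumes n: "n \<in> N" and k: "k \<in> N" and a: "a \<in> N" and bd: "\<iota> a + 1 \<le> P4 k"
  shows "\<not> (Hit n (pl k nu) (q4 a) \<and> Hit n (pl k nu) (pl (pl (pl (q4 a) nu) nu) nu))"
proof
  let ?k = "pl k nu" let ?a = "q4 a" let ?b = "pl (pl (pl (q4 a) nu) nu) nu"
  assume "Hit n ?k ?a \<and> Hit n ?k ?b"
  then obtain B B' where B: "B \<in> N" "Seq n B ?k ?a" and B': "B' \<in> N" "Seq n B' ?k ?b" unfolding Hit_def by blast
  have kN: "?k \<in> N" "?a \<in> N" "?b \<in> N" using k a by auto
  have bd': "\<iota> ?a + 1 \<le> P4 ?k" "\<iota> ?b + 1 \<le> P4 ?k" using bd a k by (simp_all add: P4_Suc)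
  obtain x where x: "x \<in> UU" "ap Y x = n" "\<And>i. i \<in> N \<Longrightarrow> Inside ?k ?a (RS x i)"
    using Seq_point[OF n B(1) kN(1,2) bd'(1) B(2)] by blast
  obtain y where y: "y \<in> UU" "ap Y y = n" "\<And>i. i \<in> N \<Longrightarrow> Inside ?k ?b (RS y i)"
    using Seq_point[OF n B'(1) kN(1,3) bd'(2) B'(2)] by blast
  have R: "Req x y" using inj[OF x(1) y(1)] x(2) y(2) by simp
  \<comment> \<open>The index is chosen so that 2 * 2^-i is the length of one quarter; equal reals
    then differ there by at most one length.\<close>
  define i where "i = pl (pl ?k ?k) nu"
  have i: "i \<in> N" "ri i = 1 / P4 ?k / 2"
    using kN(1) ri_add[OF kN(1) kN(1)] by (simp_all add: i_def ri_Suc P4_def) (simp add: ri_def)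
  have "\<bar>RS x i - RS y i\<bar> \<le> 1 / P4 ?k" using R i unfolding Req_def by auto
  moreover have "RS x i \<le> \<iota> ?a / P4 ?k + 1 / P4 ?k" "\<iota> ?a / P4 ?k + 3 / P4 ?k \<le> RS y i"
    using x(3)[OF i(1)] y(3)[OF i(1)] a unfolding Inside_def by (simp_all add: add_divide_distrib)
  moreover have "0 < 1 / P4 ?k" "3 / P4 ?k = 3 * (1 / P4 ?k)" using kN(1) P4_pos(1)[of ?k] by (simp_all del: P4_pos)
  ultimately show False by linarith
qed

end

section \<open>A nested sequence that leaves no value for Y\<close>

context separated
begin

text \<open>Level l + 1 deals with the number l alone, and level 0 with none. The limit point lies
  in every interval of the path, so it is enough to treat each number once.\<close>

definition "Avoids k a \<longleftrightarrow> \<iota> a + 1 \<le> P4 k \<and> (\<forall>l\<in>N. pl l nu = k \<longrightarrow> \<not> Hit l k a)"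

text \<open>At level k + 1 the number to be avoided is k, and it cannot hit both outer
  quarters.\<close>

lemma Avoids_step:
  assumes k: "k \<in> N" and a: "a \<in> N" and A: "Avoids k a"
  shows "Avoids (pl k nu) (q4 a) \<or> Avoids (pl k nu) (pl (pl (pl (q4 a) nu) nu) nu)"
proof -
  have bd: "\<iota> a + 1 \<le> P4 k" using A unfolding Avoids_def by blast
  have l: "l = k" if "l \<in> N" "pl l nu = pl k nu" for l
  proof -
    have "\<iota> (pl l nu) = \<iota> (pl k nu)" using that(2) by (rule arg_cong)
    then show ?thesis using that(1) k i_inj[of l k] by simp
  qed
  have "\<iota> (q4 a) + 1 \<le> P4 (pl k nu)" "\<iota> (pl (pl (pl (q4 a) nu) nu) nu) + 1 \<le> P4 (pl k nu)"
    using bd a k by (simp_all add: P4_Suc)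
  then show ?thesis using Hit_unique[OF k k a bd] l unfolding Avoids_def by blast
qed

lemma Avoids_path: "\<exists>p\<in>D Ty1. ap p nz = nz \<and> (\<forall>j\<in>N. Avoids (pl nz j) (ap p j) \<and>
    4 * \<iota> (ap p j) \<le> \<iota> (ap p (pl j nu)) \<and> \<iota> (ap p (pl j nu)) \<le> 4 * \<iota> (ap p j) + 3)"
proof -
  let ?e = "e0((0, Ty1 \<Rrightarrow> TyN) := E, (20, TyN \<Rrightarrow> TyN \<Rrightarrow> Ty1 \<Rrightarrow> Ty1) := g)"
  let ?\<psi> = "AllV 21 TyN (Var 21 TyN \<^bold>+ One \<^bold>= Var 10 TyN \<^bold>\<longrightarrow> FNeg (ExV 22 TyN seq_fm))"
  let ?\<phi> = "FAnd (Less (Var 11 TyN) (exp2_tm \<cdot> Var 10 TyN \<^bold>* (exp2_tm \<cdot> Var 10 TyN))) ?\<psi>"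
  have EN: "E \<in> D (Ty1 \<Rrightarrow> TyN)" using E unfolding quantifier_def by blast
  have e: "valid ?e" "?e (0, Ty1 \<Rrightarrow> TyN) = E" using EN g by simp_all
  have sat: "sat (?e((10, TyN) := k, (11, TyN) := a)) ?\<phi> \<longleftrightarrow> Avoids k a" if ka: "k \<in> N" "a \<in> N" for k a
  proof -
    have s: "sat (?e((10, TyN) := k, (11, TyN) := a, (21, TyN) := l, (22, TyN) := B)) seq_fm \<longleftrightarrow> Seq l B k a"
      if "l \<in> N" "B \<in> N" for l B
      by (subst sat_seq) (use ka that in simp_all)
    have "sat (?e((10, TyN) := k, (11, TyN) := a)) ?\<psi> \<longleftrightarrow> (\<forall>l\<in>N. pl l nu = k \<longrightarrow> \<not> Hit l k a)"
      unfolding Hit_def using s by (simp del: sat.simps(3) cong: ball_cong bex_cong)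
    moreover have "\<iota> a < P4 k \<longleftrightarrow> \<iota> a + 1 \<le> P4 k" using i_discrete[of a "tm (ex2 k) (ex2 k)"] ka by (simp add: P4_def)
    ultimately show ?thesis using ka unfolding Avoids_def sat_simps_defs by (simp add: P4_def)
  qed
  have "arith ?\<phi>" "wf_fm ?\<phi>" by simp_all
  from arith_comprehension[OF E this e] obtain X where X: "X \<in> D (TyN \<Rrightarrow> TyN \<Rrightarrow> TyN)"
      "\<And>k a. k \<in> N \<Longrightarrow> a \<in> N \<Longrightarrow> ap (ap X k) a = (if Avoids k a then nz else nu)"
    using sat by auto
  have "pl l nu \<noteq> nz" if "l \<in> N" for l
  proof
    assume "pl l nu = nz"
    then have "\<iota> (pl l nu) = \<iota> nz" by (rule arg_cong)
    then show False using that i_nonneg[OF that] by simp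
  qed
  then have "Avoids nz nz" unfolding Avoids_def by (simp add: P4_zero)
  from path[OF X const_in(1) const_in(1) this] Avoids_step show ?thesis by blast
qed

text \<open>Let z be the common point and n = Y z. The functions with second index n tend to 1 at z,
  so by continuity they exceed 1/2 at late rational approximations of z. These lie in the interval
  of level n + 1 and show that n hits it.\<close>

lemma contradiction: False
proof -
  obtain p where p: "p \<in> D Ty1" "ap p nz = nz" and pA: "\<And>j. j \<in> N \<Longrightarrow> Avoids (pl nz j) (ap p j)"
    and ps: "\<And>j. j \<in> N \<Longrightarrow> 4 * \<iota> (ap p j) \<le> \<iota> (ap p (pl j nu)) \<and> \<iota> (ap p (pl j nu)) \<le> 4 * \<iota> (ap p j) + 3"
    using Avoids_path by blast
  have start: "\<iota> (ap p nz) + 1 \<le> P4 nz" by (simp add: p(2) P4_zero)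
  obtain z where z: "z \<in> UU" and zI': "\<And>n i. n \<in> N \<Longrightarrow> i \<in> N \<Longrightarrow> \<iota> n \<le> \<iota> i \<Longrightarrow> Inside (pl nz n) (ap p n) (RS z i)"
    using path_real[OF p(1) ps const_in(1) start] by blast
  have nz_pl: "pl nz j = j" if "j \<in> N" for j using that by (simp add: i_inj)
  have zI: "Inside n (ap p n) (val (ap z i))" if "n \<in> N" "i \<in> N" "\<iota> n \<le> \<iota> i" for n i
    using zI'[OF that] nz_pl[OF that(1)] by (simp add: RS_def)
  have zN: "ap z i \<in> N" if "i \<in> N" for i using UU_in[OF z] that by (rule ap_N)
  have zU: "cst (ap z i) \<in> UU" if i: "i \<in> N" for i
    by (rule cst_Inside[of nz nz]) (use zI[of nz i] i zN p(2) in \<open>simp_all add: P4_zero\<close>)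
  define n where "n = ap Y z"
  have n: "n \<in> N" unfolding n_def using Y UU_in[OF z] by (rule ap_1N)
  have "Conv (\<lambda>m. G m n z) one_real" using conv[OF n z] by (simp add: n_def)
  moreover have "n2 \<in> N" by simp
  ultimately obtain B where B: "B \<in> N" "\<And>m. m \<in> N \<Longrightarrow> \<iota> B \<le> \<iota> m \<Longrightarrow> DL n2 (G m n z) one_real"
    unfolding Conv_def by blast
  have single: "\<exists>i0\<in>N. \<forall>i\<in>N. \<iota> i0 \<le> \<iota> i \<longrightarrow> Big (G m n (cst (ap z i)))" if m: "m \<in> N" "\<iota> B \<le> \<iota> m" for m
  proof -
    obtain M where M: "M \<in> N" "\<And>y. y \<in> UU \<Longrightarrow> DL M z y \<Longrightarrow> DL nu (G m n y) one_real"
      using close_to[OF z m(1) n UU_RR[OF one_real(1)] B(2)[OF m]] by blast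
    have "Big (G m n (cst (ap z i)))" if i: "i \<in> N" "\<iota> (pl M nu) \<le> \<iota> i" for i
    proof -
      have ri: "ri i \<le> ri M / 2" using ri_mono[of "pl M nu" i] M(1) i by (simp add: ri_Suc)
      have "DL M z (cst (ap z i))"
      proof (rule close_cst[OF UU_RR[OF z] zN[OF i(1)] M(1) i(1)])
        fix j assume "j \<in> N" "\<iota> i \<le> \<iota> j"
        then show "\<bar>RS z j - val (ap z i)\<bar> \<le> ri M / 2"
          using Real_close[OF UU_RR[OF z] i(1)] ri by (fastforce simp: RS_def abs_minus_commute)
      qed
      then show ?thesis using close_one_Big[OF G_RR[OF m(1) n zU[OF i(1)]]] M(2)[OF zU[OF i(1)]] by blast
    qed
    then show ?thesis using M(1) by (intro bexI[of _ "pl M nu"]) auto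
  qed
  \<comment> \<open>For each single m there is a stage from which the approximations work. A common
    stage for all m up to M is found by induction on M, which has to be the model's induction for an
    arithmetical formula since M may be nonstandard.\<close>
  define S where "S M \<longleftrightarrow> (\<exists>i0\<in>N. \<forall>i\<in>N. \<iota> i0 \<le> \<iota> i \<longrightarrow> (\<forall>m\<in>N. \<iota> B \<le> \<iota> m \<longrightarrow> \<iota> m \<le> \<iota> M \<longrightarrow> Big (G m n (cst (ap z i)))))" for M
  have S: "S M" if M: "M \<in> N" for M
  proof -
    let ?e = "e0((0, Ty1 \<Rrightarrow> TyN) := E, (20, TyN \<Rrightarrow> TyN \<Rrightarrow> Ty1 \<Rrightarrow> Ty1) := g, (21, TyN) := n, (22, TyN) := B, (15, Ty1) := z)"
    let ?\<phi> = "ExV 16 TyN (AllV 17 TyN (Var 16 TyN \<^bold>\<le> Var 17 TyN \<^bold>\<longrightarrow> AllV 14 TyN (Var 22 TyN \<^bold>\<le> Var 14 TyN \<^bold>\<longrightarrow>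
       Var 14 TyN \<^bold>\<le> Var 12 TyN \<^bold>\<longrightarrow> big_fm (Var 15 Ty1 \<cdot> Var 17 TyN))))"
    have EN: "E \<in> D (Ty1 \<Rrightarrow> TyN)" using E unfolding quantifier_def by blast
    have e: "valid ?e" "?e (0, Ty1 \<Rrightarrow> TyN) = E" using EN g n B(1) UU_in[OF z] by simp_all
    have wf: "arith ?\<phi>" "wf_fm ?\<phi>" by simp_all
    show ?thesis
    proof (rule arith_ind[OF E wf e, of 12 S M])
      fix d assume d: "d \<in> N"
      have "sat (?e((12, TyN) := d, (16, TyN) := i0, (17, TyN) := i, (14, TyN) := m)) (Var 22 TyN \<^bold>\<le> Var 14 TyN \<^bold>\<longrightarrow>
         Var 14 TyN \<^bold>\<le> Var 12 TyN \<^bold>\<longrightarrow> big_fm (Var 15 Ty1 \<cdot> Var 17 TyN)) \<longleftrightarrow>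
         (\<iota> B \<le> \<iota> m \<longrightarrow> \<iota> m \<le> \<iota> d \<longrightarrow> Big (G m n (cst (ap z i))))" if "i0 \<in> N" "i \<in> N" "m \<in> N" for i0 i m
        using that d n B(1) zN by (simp add: sat_big le_iff)
      then show "sat (?e((12, TyN) := d)) ?\<phi> \<longleftrightarrow> S d" unfolding S_def by (simp add: le_iff)
    next
      show "S nz"
      proof (cases "\<iota> B \<le> \<iota> nz")
        case True
        obtain i0 where i0: "i0 \<in> N" "\<forall>i\<in>N. \<iota> i0 \<le> \<iota> i \<longrightarrow> Big (G nz n (cst (ap z i)))"
          using single[OF const_in(1) True] by blast
        have "m = nz" if "m \<in> N" "\<iota> m \<le> \<iota> nz" for m
          using that i_nonneg[OF that(1)] i_inj[OF that(1) const_in(1)] by simp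
        then show ?thesis unfolding S_def using i0 by blast
      next
        case False
        then have "\<not> (\<iota> B \<le> \<iota> m \<and> \<iota> m \<le> \<iota> nz)" for m by (meson order_trans)
        then show ?thesis unfolding S_def using const_in(1) by blast
      qed
    next
      fix d assume d: "d \<in> N" and "S d"
      then obtain i0 where i0: "i0 \<in> N" "\<And>i m. i \<in> N \<Longrightarrow> \<iota> i0 \<le> \<iota> i \<Longrightarrow> m \<in> N \<Longrightarrow> \<iota> B \<le> \<iota> m \<Longrightarrow> \<iota> m \<le> \<iota> d \<Longrightarrow> Big (G m n (cst (ap z i)))"
        unfolding S_def by blast
      have dN: "pl d nu \<in> N" using d by simp
      have split: "m = pl d nu \<or> \<iota> m \<le> \<iota> d" if "m \<in> N" "\<iota> m \<le> \<iota> (pl d nu)" for m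
        using that d i_discrete[OF d that(1)] i_inj[OF that(1) dN] by fastforce
      show "S (pl d nu)"
      proof (cases "\<iota> B \<le> \<iota> (pl d nu)")
        case True
        obtain i1 where i1: "i1 \<in> N" "\<And>i. i \<in> N \<Longrightarrow> \<iota> i1 \<le> \<iota> i \<Longrightarrow> Big (G (pl d nu) n (cst (ap z i)))"
          using single[OF dN True] by blast
        have "\<iota> i0 \<le> \<iota> i \<and> \<iota> i1 \<le> \<iota> i" if "\<iota> (pl i0 i1) \<le> \<iota> i" for i
          using that i_pl[OF i0(1) i1(1)] i_nonneg[OF i0(1)] i_nonneg[OF i1(1)] by linarith
        then show ?thesis unfolding S_def using i0 i1 split op_in(1)[OF i0(1) i1(1)] by blast
      next
        case False
        then show ?thesis unfolding S_def using i0 split by blast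
      qed
    qed (rule M)
  qed
  let ?k = "pl n nu"
  have k: "?k \<in> N" using n by simp
  have "Seq n B ?k (ap p ?k)" unfolding Seq_def
  proof
    fix M assume "M \<in> N"
    then obtain i0 where i0: "i0 \<in> N" "\<And>i m. i \<in> N \<Longrightarrow> \<iota> i0 \<le> \<iota> i \<Longrightarrow> m \<in> N \<Longrightarrow> \<iota> B \<le> \<iota> m \<Longrightarrow> \<iota> m \<le> \<iota> M \<Longrightarrow> Big (G m n (cst (ap z i)))"
      using S unfolding S_def by blast
    \<comment> \<open>The approximation is taken late enough both for the common stage
      \<open>i0\<close> and for lying in the interval at level n + 1.\<close>
    have i: "pl i0 ?k \<in> N" "\<iota> i0 \<le> \<iota> (pl i0 ?k)" "\<iota> ?k \<le> \<iota> (pl i0 ?k)"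
      using i0(1) k i_pl[OF i0(1) k] i_nonneg[OF i0(1)] i_nonneg[OF k] by simp_all
    show "\<exists>r\<in>N. Inside ?k (ap p ?k) (val r) \<and> (\<forall>m\<in>N. \<iota> B \<le> \<iota> m \<longrightarrow> \<iota> m \<le> \<iota> M \<longrightarrow> Big (G m n (cst r)))"
      using zI[OF k i(1,3)] i0(2)[OF i(1,2)] zN[OF i(1)] by blast
  qed
  then have "Hit n ?k (ap p ?k)" unfolding Hit_def using B(1) by blast
  then show False using pA[OF k] n unfolding nz_pl[OF k] Avoids_def by blast
qed

end

section \<open>Baire's theorem yields no injection\<close>

context field_model
begin

lemma mn_indicator: "a \<in> N \<Longrightarrow> b \<in> N \<Longrightarrow> mn nu (pl (mn a b) (mn b a)) = (if a = b then nu else nz)"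
  using mn_test[of a b] by (auto simp: i_inj i_mn)

lemma Req_refl: "Req x x"
  unfolding Req_def ri_def by simp

lemma sat_Baire_imp_NIN:
  assumes B: "sat e Baire'"
  shows "sat e NIN"
proof (rule sat_NIN, rule ccontr)
  fix Y assume Y: "Y \<in> D (Ty1 \<Rrightarrow> TyN)" "FunNat Y" and "\<not> (\<exists>x\<in>UU. \<exists>y\<in>UU. \<not> Req x y \<and> ap Y x = ap Y y)"
  then have inj: "\<And>x y. x \<in> UU \<Longrightarrow> y \<in> UU \<Longrightarrow> ap Y x = ap Y y \<Longrightarrow> Req x y" by blast
  obtain E where E: "quantifier E" using quantifier_exists[OF Y inj] by blast
  let ?e = "e0((0, Ty1 \<Rrightarrow> TyN) := Y)"
  let ?y = "Var 0 (Ty1 \<Rrightarrow> TyN) \<cdot> Var 9 Ty1"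
  let ?b = "const_real (rat_tm \<cdot> (One \<^bold>- ((?y \<^bold>- Var 8 TyN) \<^bold>+ (Var 8 TyN \<^bold>- ?y))) \<cdot> Zero \<cdot> Zero)"
  let ?o = "const_real (rat_tm \<cdot> Zero \<cdot> Zero \<cdot> Zero)"
  have e: "valid ?e" using Y by simp
  define f where "f = ev ?e (abs_tm 8 TyN (abs_tm 9 Ty1 ?b))"
  define h where "h = ev ?e (abs_tm 9 Ty1 ?o)"
  have wb: "wf_tm ?b" "wf_tm (abs_tm 9 Ty1 ?b)" by auto
  have f: "f \<in> D (TyN \<Rrightarrow> Ty1 \<Rrightarrow> Ty1)" unfolding f_def using e by (intro ev_in') auto
  have h: "h \<in> D (Ty1 \<Rrightarrow> Ty1)" unfolding h_def using e by (intro ev_in') auto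
  have hx: "ap h x = zero_real" if "x \<in> D Ty1" for x
    unfolding h_def using that e by (simp add: zero_real_def)
  have fx: "ap (ap f n) x = (if ap Y x = n then one_real else zero_real)" if n: "n \<in> N" and x: "x \<in> D Ty1" for n x
  proof -
    have Yx: "ap Y x \<in> N" using Y(1) x by (rule ap_1N)
    have "ap f n = ev (?e((8, TyN) := n)) (abs_tm 9 Ty1 ?b)" unfolding f_def by (rule ev_abs[OF wb(2) e n])
    then have "ap (ap f n) x = ev (?e((8, TyN) := n, (9, Ty1) := x)) ?b"
      using ev_abs[OF wb(1), of "?e((8, TyN) := n)" x Ty1 9] e n x by simp
    then show ?thesis using mn_indicator[OF Yx n] by (simp add: one_real_def zero_real_def)
  qed
  have Realv: "Real (if c then one_real else zero_real)" for c
    using one_real(1) zero_real(1) unfolding UU_def Unit_def by simp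
  have B1: "Baire1 (ap f n)" if n: "n \<in> N" for n
    unfolding Baire1_def
  proof (intro conjI ballI impI)
    have Yeq: "ap Y x = ap Y y" if "x \<in> UU" "y \<in> UU" "Req x y" for x y
      using Y(2) that unfolding FunNat_def by blast
    show "FunReal (ap f n)" unfolding FunReal_def
    proof (intro conjI ballI impI)
      fix x assume x: "x \<in> UU"
      show "Real (ap (ap f n) x)" unfolding fx[OF n UU_in[OF x]] by (rule Realv)
    next
      fix x y assume xy: "x \<in> UU" "y \<in> UU" "Req x y"
      show "Req (ap (ap f n) x) (ap (ap f n) y)"
        unfolding fx[OF n UU_in[OF xy(1)]] fx[OF n UU_in[OF xy(2)]] Yeq[OF xy] by (rule Req_refl)
    qed
    fix P assume P: "P \<in> D (Ty1 \<Rrightarrow> TyN)" and "Perfect P \<and> (\<exists>x\<in>RR. ap P x = nu)"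
    then have unit: "\<And>x. x \<in> RR \<Longrightarrow> ap P x = nu \<Longrightarrow> x \<in> UU" and noiso: "NoIso P" and ne: "\<exists>x\<in>RR. ap P x = nu"
      unfolding Perfect_def RR_def UU_def by blast+
    \<comment> \<open>It suffices to find a point of P near which the indicator of the exceptional
      point vanishes on P. If the exceptional point w lies in P, it is not isolated there, so P has
      a different point x, and w stays away from a neighbourhood of x.\<close>
    have "\<exists>x\<in>RR. ap P x = nu \<and> (\<exists>M\<in>N. ap Y x \<noteq> n \<and> (\<forall>y\<in>RR. ap P y = nu \<longrightarrow> DL M x y \<longrightarrow> ap Y y \<noteq> n))"
    proof (cases "\<exists>x\<in>RR. ap P x = nu \<and> ap Y x = n")
      case False
      then show ?thesis using ne const_in(1) by blast
    next
      case True
      then obtain w where w: "w \<in> RR" "ap P w = nu" "ap Y w = n" by blast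
      obtain x where x: "x \<in> RR" "ap P x = nu" "\<not> Req w x"
        using noiso w const_in(1) unfolding NoIso_def by blast
      obtain M where M: "M \<in> N" "\<not> DL M w x" using not_Req[OF w(1) x(1,3)] by blast
      \<comment> \<open>The radius 2^-(M+1) is half of the known separation of w and x, so the
        triangle inequality applies.\<close>
      have "ap Y y \<noteq> n" if y: "y \<in> RR" "ap P y = nu" "DL (pl M nu) x y" for y
      proof
        assume "ap Y y = n"
        then have "Req w y" using inj[OF unit[OF w(1,2)] unit[OF y(1,2)]] w(3) by simp
        then have "DL (pl M nu) w y" using Req_DL[OF w(1) y(1)] M(1) by simp
        then have "DL M w x" using DL_trans[OF w(1) y(1) x(1) M(1)] DL_sym[OF y(3)] by blast
        then show False using M(2) by blast
      qed
      moreover have "ap Y x \<noteq> n" using inj[OF unit[OF w(1,2)] unit[OF x(1,2)]] w(3) x(3) by auto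
      moreover have "pl M nu \<in> N" using M(1) by simp
      ultimately show ?thesis using x(1,2) by blast
    qed
    then obtain x M where x: "x \<in> RR" "ap P x = nu" "M \<in> N" "ap Y x \<noteq> n"
      and far: "\<And>y. y \<in> RR \<Longrightarrow> ap P y = nu \<Longrightarrow> DL M x y \<Longrightarrow> ap Y y \<noteq> n" by blast
    have "DL k (ap (ap f n) x) (ap (ap f n) y)" if "k \<in> N" "y \<in> RR" "ap P y = nu" "DL M x y" for k y
      using fx[OF n RR_in[OF x(1)]] fx[OF n RR_in[OF that(2)]] x(4) far[OF that(2-4)]
        DL_refl[OF UU_RR[OF zero_real(1)] that(1)] by simp
    then show "\<exists>x\<in>RR. ap P x = nu \<and> (\<forall>k\<in>N. \<exists>M\<in>N. \<forall>y\<in>RR. ap P y = nu \<longrightarrow> DL M x y \<longrightarrow>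
        DL k (ap (ap f n) x) (ap (ap f n) y))" using x(1,2,3) by blast
  qed
  have hF: "FunReal h" unfolding FunReal_def using hx[OF UU_in] Realv[of False] Req_refl by simp
  have C: "Conv (\<lambda>n. ap (ap f n) x) (ap h x)" if x: "x \<in> UU" for x
    unfolding Conv_def
  proof
    fix k assume k: "k \<in> N"
    have Yx: "ap Y x \<in> N" using Y(1) UU_in[OF x] by (rule ap_1N)
    \<comment> \<open>Beyond Y x the values at x are exactly 0, so the threshold does not depend on
      k.\<close>
    have "DL k (ap (ap f n) x) (ap h x)" if n: "n \<in> N" "\<iota> (pl (ap Y x) nu) \<le> \<iota> n" for n
    proof -
      have "ap Y x \<noteq> n" using n Yx by auto
      then show ?thesis using fx[OF n(1) UU_in[OF x]] hx[OF UU_in[OF x]] DL_refl[OF UU_RR[OF zero_real(1)] k] by simp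
    qed
    moreover have "pl (ap Y x) nu \<in> N" using Yx by simp
    ultimately show "\<exists>M\<in>N. \<forall>n\<in>N. \<iota> M \<le> \<iota> n \<longrightarrow> DL k (ap (ap f n) x) (ap h x)" by blast
  qed
  obtain g where g: "g \<in> D (TyN \<Rrightarrow> TyN \<Rrightarrow> Ty1 \<Rrightarrow> Ty1)" and gC: "\<forall>m\<in>N. \<forall>n\<in>N. Cont (ap (ap g m) n)"
    and gL: "\<forall>n\<in>N. \<forall>x\<in>UU. Conv (\<lambda>m. ap (ap (ap g m) n) x) (ap (ap f n) x)"
    using sat_Baire'[OF B f h B1 hF C] by blast
  interpret separated D ap cn le T \<iota> Y E g
  proof
    show "Conv (\<lambda>m. ap (ap (ap g m) n) x) (if ap Y x = n then one_real else zero_real)" if "n \<in> N" "x \<in> UU" for n x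
      using gL[rule_format, OF that] unfolding fx[OF that(1) UU_in[OF that(2)]] .
  qed (use Y(1) inj E g gC in blast)+
  show False by (rule contradiction)
qed

end

section \<open>The numbers of a countermodel as a type\<close>

text \<open>The type-0 domain of a countermodel has to become a HOL type before its field of fractions
  can be formed.  As a type definition cannot depend on the existence of a countermodel, the
  standard natural numbers, copied into terms, take its place if there is none.\<close>

locale number_structure =
  fixes A :: "'b set" and z u :: 'b and pl tm :: "'b \<Rightarrow> 'b \<Rightarrow> 'b" and lt :: "'b \<Rightarrow> 'b \<Rightarrow> bool"
  assumes closed [simp]: "z \<in> A" "u \<in> A" "a \<in> A \<Longrightarrow> b \<in> A \<Longrightarrow> pl a b \<in> A" "a \<in> A \<Longrightarrow> b \<in> A \<Longrightarrow> tm a b \<in> A"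
    and pl_assoc: "a \<in> A \<Longrightarrow> b \<in> A \<Longrightarrow> c \<in> A \<Longrightarrow> pl (pl a b) c = pl a (pl b c)"
    and pl_comm: "a \<in> A \<Longrightarrow> b \<in> A \<Longrightarrow> pl a b = pl b a"
    and pl_z: "a \<in> A \<Longrightarrow> pl a z = a"
    and tm_assoc: "a \<in> A \<Longrightarrow> b \<in> A \<Longrightarrow> c \<in> A \<Longrightarrow> tm (tm a b) c = tm a (tm b c)"
    and tm_comm: "a \<in> A \<Longrightarrow> b \<in> A \<Longrightarrow> tm a b = tm b a"
    and tm_u: "a \<in> A \<Longrightarrow> tm a u = a" and tm_z: "a \<in> A \<Longrightarrow> tm a z = z"
    and distr: "a \<in> A \<Longrightarrow> b \<in> A \<Longrightarrow> c \<in> A \<Longrightarrow> tm a (pl b c) = pl (tm a b) (tm a c)"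
    and lt_irrefl: "a \<in> A \<Longrightarrow> \<not> lt a a"
    and lt_trans: "a \<in> A \<Longrightarrow> b \<in> A \<Longrightarrow> c \<in> A \<Longrightarrow> lt a b \<Longrightarrow> lt b c \<Longrightarrow> lt a c"
    and lt_total: "a \<in> A \<Longrightarrow> b \<in> A \<Longrightarrow> lt a b \<or> a = b \<or> lt b a"
    and lt_zu: "lt z u"
    and lt_pl: "a \<in> A \<Longrightarrow> b \<in> A \<Longrightarrow> c \<in> A \<Longrightarrow> lt a b \<Longrightarrow> lt (pl a c) (pl b c)"
    and lt_tm: "a \<in> A \<Longrightarrow> b \<in> A \<Longrightarrow> c \<in> A \<Longrightarrow> lt z c \<Longrightarrow> lt a b \<Longrightarrow> lt (tm a c) (tm b c)"
    and lt_z: "a \<in> A \<Longrightarrow> \<not> lt a z"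
    and lt_diff: "a \<in> A \<Longrightarrow> b \<in> A \<Longrightarrow> lt a b \<Longrightarrow> \<exists>c\<in>A. b = pl a c"

lemma (in base_model) number_structure: "number_structure N nz nu pl tm le"
proof (unfold_locales, goal_cases)
  case 1
  then show ?case using const_in(1) by blast
next
  case 2
  then show ?case using const_in(2) by blast
next
  case 3
  then show ?case using op_in(1) by blast
next
  case 4
  then show ?case using op_in(2) by blast
next
  case 5
  then show ?case using arith_facts(1) by blast
next
  case 6
  then show ?case using arith_facts(2) by blast
next
  case 7
  then show ?case using arith_facts(3) by blast
next
  case 8
  then show ?case using arith_facts(4) by blast
next
  case 9
  then show ?case using arith_facts(5) by blast
next
  case 10
  then show ?case using arith_facts(6) by blast
next
  case 11
  then show ?case using arith_facts(7) by blast
next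
  case 12
  then show ?case using arith_facts(8) by blast
next
  case 13
  then show ?case using arith_facts(9) by blast
next
  case 14
  then show ?case using arith_facts(10) by blast
next
  case 15
  then show ?case using arith_facts(11) by blast
next
  case 16
  then show ?case using arith_facts(12) by blast
next
  case 17
  then show ?case using arith_facts(13) by blast
next
  case 18
  then show ?case using arith_facts(14) by blast
next
  case 19
  then show ?case using nonneg by blast
next
  case 20
  then show ?case using subtract by blast
qed

text \<open>A number is represented by the variable with that index, which \<open>vmax_tm\<close>
  reads back.\<close>

definition copy :: "nat \<Rightarrow> tm" where "copy n = Var n TyN"

lemma copy_structure:
  "number_structure (range copy) (copy 0) (copy 1) (\<lambda>a b. copy (vmax_tm a + vmax_tm b)) (\<lambda>a b. copy (vmax_tm a * vmax_tm b))
    (\<lambda>a b. vmax_tm a < vmax_tm b)"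
proof
  fix a b assume "a \<in> range copy" "b \<in> range copy" "vmax_tm a < vmax_tm b"
  then obtain m n where mn: "a = copy m" "b = copy n" "m < n" by (auto simp: copy_def)
  then show "\<exists>c\<in>range copy. b = copy (vmax_tm a + vmax_tm c)"
    by (intro bexI[of _ "copy (n - m)"]) (auto simp: copy_def)
qed (auto simp: copy_def algebra_simps)

section \<open>The chosen countermodel and its numbers\<close>

definition is_countermodel :: "(ty \<Rightarrow> tm set) \<times> (tm \<Rightarrow> tm \<Rightarrow> tm) \<times> (tm \<Rightarrow> tm) \<times> (tm \<Rightarrow> tm \<Rightarrow> bool) \<Rightarrow> bool" where
  "is_countermodel = (\<lambda>(D, ap, cn, le). hmodel D ap cn le (RCA0_omega \<union> QF_AC TyN Ty1) \<and>
     (\<exists>e. fo_structure.valid D e \<and> \<not> fo_structure.sat D ap cn (=) le e (Baire' \<^bold>\<longrightarrow> NIN)))"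

fun numbers_of :: "(ty \<Rightarrow> tm set) \<times> (tm \<Rightarrow> tm \<Rightarrow> tm) \<times> (tm \<Rightarrow> tm) \<times> (tm \<Rightarrow> tm \<Rightarrow> bool) \<Rightarrow>
    tm set \<times> tm \<times> tm \<times> (tm \<Rightarrow> tm \<Rightarrow> tm) \<times> (tm \<Rightarrow> tm \<Rightarrow> tm) \<times> (tm \<Rightarrow> tm \<Rightarrow> bool)" where
  "numbers_of (D, ap, cn, le) = (D TyN, cn Zero, cn One, \<lambda>a b. ap (ap (cn Plus) a) b, \<lambda>a b. ap (ap (cn Times) a) b, le)"

definition numbers :: "tm set \<times> tm \<times> tm \<times> (tm \<Rightarrow> tm \<Rightarrow> tm) \<times> (tm \<Rightarrow> tm \<Rightarrow> tm) \<times> (tm \<Rightarrow> tm \<Rightarrow> bool)" where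
  "numbers = (if \<exists>m. is_countermodel m then numbers_of (SOME m. is_countermodel m)
     else (range copy, copy 0, copy 1, \<lambda>a b. copy (vmax_tm a + vmax_tm b), \<lambda>a b. copy (vmax_tm a * vmax_tm b),
       \<lambda>a b. vmax_tm a < vmax_tm b))"

lemma numbers_countermodel: "\<exists>m. is_countermodel m \<Longrightarrow> numbers = numbers_of (SOME m. is_countermodel m)"
  unfolding numbers_def by (rule if_P)

lemma numbers_copy: "\<nexists>m. is_countermodel m \<Longrightarrow> numbers = (range copy, copy 0, copy 1,
    \<lambda>a b. copy (vmax_tm a + vmax_tm b), \<lambda>a b. copy (vmax_tm a * vmax_tm b), \<lambda>a b. vmax_tm a < vmax_tm b)"
  unfolding numbers_def by (rule if_not_P)

lemma countermodel_base:
  assumes "is_countermodel (D, ap, cn, le)"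
  shows "base_model D ap cn le (RCA0_omega \<union> QF_AC TyN Ty1)"
  using assms by (simp add: is_countermodel_def base_model_def base_model_axioms_def)

lemma numbers_structure: "case numbers of (A, z, u, pl, tm, lt) \<Rightarrow> number_structure A z u pl tm lt"
proof (cases "\<exists>m. is_countermodel m")
  case True
  obtain D ap cn le where m: "(SOME m. is_countermodel m) = (D, ap, cn, le)" by (metis prod_cases4)
  have "is_countermodel (D, ap, cn, le)" unfolding m[symmetric] by (rule someI_ex[OF True])
  then interpret base_model D ap cn le "RCA0_omega \<union> QF_AC TyN Ty1" by (rule countermodel_base)
  have eq: "numbers = (N, nz, nu, pl, tm, le)"
    unfolding numbers_countermodel[OF True] m numbers_of.simps pl_def[abs_def] tm_def[abs_def] by (rule refl)
  show ?thesis unfolding eq prod.case by (rule number_structure)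
next
  case False
  show ?thesis unfolding numbers_copy[OF False] prod.case by (rule copy_structure)
qed

definition "nset = fst numbers"
definition "nzero = fst (snd numbers)"
definition "none = fst (snd (snd numbers))"
definition "nplus = fst (snd (snd (snd numbers)))"
definition "ntimes = fst (snd (snd (snd (snd numbers))))"
definition "nless = snd (snd (snd (snd (snd numbers))))"

interpretation n: number_structure nset nzero none nplus ntimes nless
  using numbers_structure unfolding nset_def nzero_def none_def nplus_def ntimes_def nless_def
  by (simp add: case_prod_unfold)

typedef num0 = nset
  using n.closed(1) by blast

instantiation num0 :: linordered_semidom
begin

definition zero_num0 :: num0 where "zero_num0 = Abs_num0 nzero"
definition one_num0 :: num0 where "one_num0 = Abs_num0 none"
definition plus_num0 :: "num0 \<Rightarrow> num0 \<Rightarrow> num0" where "plus_num0 a b = Abs_num0 (nplus (Rep_num0 a) (Rep_num0 b))"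
definition times_num0 :: "num0 \<Rightarrow> num0 \<Rightarrow> num0" where "times_num0 a b = Abs_num0 (ntimes (Rep_num0 a) (Rep_num0 b))"
definition less_num0 :: "num0 \<Rightarrow> num0 \<Rightarrow> bool" where "less_num0 a b \<longleftrightarrow> nless (Rep_num0 a) (Rep_num0 b)"
definition less_eq_num0 :: "num0 \<Rightarrow> num0 \<Rightarrow> bool" where "less_eq_num0 a b \<longleftrightarrow> a = b \<or> a < b"
text \<open>Cancellation makes the chosen difference unique. Where there is none, the default 0
  keeps a - b - c = a - (b + c) and the distributive law valid.\<close>

definition minus_num0 :: "num0 \<Rightarrow> num0 \<Rightarrow> num0" where "minus_num0 a b = (if \<exists>c. a = b + c then SOME c. a = b + c else 0)"

instance
proof
  note R = Rep_num0
  have rep [simp]: "Rep_num0 0 = nzero" "Rep_num0 1 = none" "Rep_num0 (a + b) = nplus (Rep_num0 a) (Rep_num0 b)"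
    "Rep_num0 (a * b) = ntimes (Rep_num0 a) (Rep_num0 b)" for a b :: num0
    by (simp_all add: zero_num0_def one_num0_def plus_num0_def times_num0_def Abs_num0_inverse R)
  note eq = Rep_num0_inject[symmetric]
  have assoc: "a + b + c = a + (b + c)" for a b c :: num0 by (simp add: eq n.pl_assoc R)
  have comm: "a + b = b + a" for a b :: num0 by (simp add: eq n.pl_comm R)
  have zero: "0 + a = a" for a :: num0 by (simp add: eq n.pl_comm[of nzero] n.pl_z R)
  have tcomm: "a * b = b * a" for a b :: num0 by (simp add: eq n.tm_comm R)
  have irr: "\<not> a < a" for a :: num0 by (simp add: less_num0_def n.lt_irrefl R)
  have tr: "a < b \<Longrightarrow> b < c \<Longrightarrow> a < c" for a b c :: num0 unfolding less_num0_def by (rule n.lt_trans[OF R R R])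
  have tot: "a < b \<or> a = b \<or> b < a" for a b :: num0 unfolding less_num0_def eq by (rule n.lt_total[OF R R])
  have mono: "a < b \<Longrightarrow> a + c < b + c" for a b c :: num0 unfolding less_num0_def rep by (rule n.lt_pl[OF R R R])
  have tmono: "a < b \<Longrightarrow> 0 < c \<Longrightarrow> a * c < b * c" for a b c :: num0 unfolding less_num0_def rep by (rule n.lt_tm[OF R R R])
  have nonneg: "\<not> a < 0" for a :: num0 by (simp add: less_num0_def n.lt_z R)
  have cancel: "a + b = a + c \<longleftrightarrow> b = c" for a b c :: num0
    using tot[of b c] mono[of b c a] mono[of c b a] irr comm by metis
  have minus: "a + b - a = b" for a b :: num0
  proof -
    have "(SOME c. a + b = a + c) = b" using cancel by (intro some_equality) auto
    then show ?thesis unfolding minus_num0_def by auto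
  qed
  have minus0: "a - b = 0" if "\<nexists>c. a = b + c" for a b :: num0 using that by (simp add: minus_num0_def)
  have sum0: "a = 0" if "0 = b + a" for a b :: num0
  proof (rule ccontr)
    assume "a \<noteq> 0"
    then have "0 < a" using tot[of 0 a] nonneg by blast
    then have "0 + b < a + b" by (rule mono)
    then show False using that comm[of a b] nonneg by (metis)
  qed
  have zero_minus: "0 - a = 0" for a :: num0
  proof (cases "\<exists>c. 0 = a + c")
    case True
    then obtain c where c: "0 = a + c" by blast
    then have "0 - a = c" using minus[of a c] by simp
    then show ?thesis using sum0[OF c] by simp
  qed (rule minus0)
  have le_ex: "\<exists>c. a = b + c" if "\<not> a < b" for a b :: num0
  proof (cases "a = b")
    case True
    then have "a = b + 0" using zero[of b] comm[of b 0] by simp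
    then show ?thesis by blast
  next
    case False
    then have "nless (Rep_num0 b) (Rep_num0 a)" using that tot[of a b] by (simp add: less_num0_def)
    then obtain c where "c \<in> nset" "Rep_num0 a = nplus (Rep_num0 b) c" using n.lt_diff[OF R R] by blast
    then have "a = b + Abs_num0 c" by (simp add: eq Abs_num0_inverse)
    then show ?thesis by blast
  qed
  have dist: "a * (b + c) = a * b + a * c" for a b c :: num0 by (simp add: eq n.distr R)
  have tz: "a * 0 = 0" for a :: num0 by (simp add: eq n.tm_z R)
  have pos: "0 < a" if "a \<noteq> 0" for a :: num0 using that tot[of a 0] nonneg by blast
  fix a b c :: num0
  show "a + b + c = a + (b + c)" "a + b = b + a" "0 + a = a" "a + b - a = b" by (rule assoc comm zero minus)+
  show "a - b - c = a - (b + c)"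
  proof (cases "\<exists>d. a = b + c + d")
    case True
    then obtain d where d: "a = b + c + d" by blast
    have "a - b = c + d" unfolding d assoc by (rule minus)
    then show ?thesis using minus[of c d] minus[of "b + c" d] d by simp
  next
    case no: False
    show ?thesis
    proof (cases "\<exists>d. a = b + d")
      case True
      then obtain d where d: "a = b + d" by blast
      have "\<nexists>x. d = c + x" using no d assoc by metis
      then have "d - c = 0" by (rule minus0)
      then show ?thesis using minus[of b d] d minus0[OF no] by simp
    qed (use minus0[OF no] minus0[of a b] zero_minus in simp)
  qed
  show "a * b * c = a * (b * c)" by (simp add: eq n.tm_assoc R)
  show "a * b = b * a" by (rule tcomm)
  show "1 * a = a" using tcomm[of 1 a] by (simp add: eq n.tm_u R)
  show "(a + b) * c = a * c + b * c" unfolding tcomm[of _ c] by (rule dist)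
  show "a * (b + c) = a * b + a * c" by (rule dist)
  show "0 * a = 0" "a * 0 = 0" using tz tcomm by metis+
  show 01: "(0 :: num0) < 1" by (simp add: less_num0_def n.lt_zu)
  show "(0 :: num0) \<noteq> 1" using 01 irr by metis
  show "a * (b - c) = a * b - a * c"
  proof (cases "\<exists>d. b = c + d")
    case True
    then obtain d where d: "b = c + d" by blast
    show ?thesis unfolding d minus dist by simp
  next
    case False
    then have "b < c" using le_ex by blast
    show ?thesis
    proof (cases "a = 0")
      case True
      then show ?thesis using tz tcomm zero_minus by metis
    next
      case an: False
      have less: "a * b < a * c" using tmono[OF \<open>b < c\<close> pos[OF an]] tcomm by metis
      have "\<nexists>d. a * b = a * c + d"
      proof
        assume "\<exists>d. a * b = a * c + d"
        then obtain d where d: "a * b = a * c + d" by blast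
        show False
        proof (cases "d = 0")
          case True
          then show False using d less irr zero comm by metis
        next
          case False
          then have "0 + a * c < d + a * c" using pos mono by blast
          then show False using d less irr tr zero comm by metis
        qed
      qed
      then show ?thesis using minus0 False tz by metis
    qed
  qed
  show "a \<noteq> 0 \<Longrightarrow> b \<noteq> 0 \<Longrightarrow> a * b \<noteq> 0"
    using tmono[of 0 a b] pos tz tcomm irr by metis
  show "(a < b) = (a \<le> b \<and> \<not> b \<le> a)" unfolding less_eq_num0_def using irr tr by metis
  show "a \<le> a" by (simp add: less_eq_num0_def)
  show "a \<le> b \<Longrightarrow> b \<le> c \<Longrightarrow> a \<le> c" unfolding less_eq_num0_def using tr by metis
  show "a \<le> b \<Longrightarrow> b \<le> a \<Longrightarrow> a = b" unfolding less_eq_num0_def using irr tr by metis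
  show "a \<le> b \<or> b \<le> a" unfolding less_eq_num0_def using tot by metis
  show "a \<le> b \<Longrightarrow> c + a \<le> c + b" unfolding less_eq_num0_def using mono comm by metis
  show "a < b \<Longrightarrow> 0 < c \<Longrightarrow> c * a < c * b" using tmono tcomm by metis
  show "b \<le> a \<Longrightarrow> a - b + b = a"
  proof -
    assume "b \<le> a"
    then have "\<not> a < b" unfolding less_eq_num0_def using irr tr by metis
    then obtain d where "a = b + d" using le_ex by blast
    then show ?thesis using minus[of b d] comm by simp
  qed
qed

end

definition embed :: "tm \<Rightarrow> num0 differences fract" where
  "embed a = of_semi_fract (Abs_num0 a)"

theorem theorem3p6:
  shows "RCA0_omega \<union> QF_AC TyN Ty1 \<turnstile> (Baire' \<^bold>\<longrightarrow> NIN)"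
proof (rule ccontr)
  assume "\<not> ?thesis"
  then have ex: "\<exists>m. is_countermodel m"
    using countermodel[OF Un_upper1 wf_target] by (auto simp: is_countermodel_def)
  \<comment> \<open>The type \<open>num0\<close> was formed from the countermodel selected by
    \<open>SOME\<close>, so the argument has to use exactly this one.\<close>
  obtain D ap cn le where m: "(SOME m. is_countermodel m) = (D, ap, cn, le)" by (metis prod_cases4)
  have cm: "is_countermodel (D, ap, cn, le)" unfolding m[symmetric] by (rule someI_ex[OF ex])
  then interpret base_model D ap cn le "RCA0_omega \<union> QF_AC TyN Ty1" by (rule countermodel_base)
  have eq: "numbers = (N, nz, nu, pl, tm, le)"
    unfolding numbers_countermodel[OF ex] m numbers_of.simps pl_def[abs_def] tm_def[abs_def] by (rule refl)
  have num: "N = nset" "nz = nzero" "nu = none" "pl = nplus" "tm = ntimes" "le = nless"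
    unfolding nset_def nzero_def none_def nplus_def ntimes_def nless_def eq fst_conv snd_conv by (rule refl)+
  interpret field_model D ap cn le "RCA0_omega \<union> QF_AC TyN Ty1" embed
  proof
    show "embed nz = 0" "embed nu = 1"
      by (simp_all add: num embed_def of_semi_fract_simps zero_num0_def[symmetric] one_num0_def[symmetric])
    fix a b assume ab: "a \<in> N" "b \<in> N"
    show "embed (pl a b) = embed a + embed b" "embed (tm a b) = embed a * embed b"
      using ab by (simp_all add: num embed_def of_semi_fract_simps(3,4)[symmetric] plus_num0_def times_num0_def Abs_num0_inverse)
    show "le a b \<longleftrightarrow> embed a < embed b"
      using ab by (simp add: num embed_def of_semi_fract_simps less_num0_def Abs_num0_inverse)
    show "a = b \<longleftrightarrow> embed a = embed b"
      using ab by (simp add: num embed_def of_semi_fract_simps Abs_num0_inject)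
  qed
  obtain e where "\<not> sat e (Baire' \<^bold>\<longrightarrow> NIN)" using cm unfolding is_countermodel_def prod.case by blast
  then show False using sat_Baire_imp_NIN by simp
qed

end
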